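(* Let $d\ge 1$ and $p\in[0,1]$, and consider the parking process on $\mathbb{Z}^d$ (with nearest-neighbor edges) with car density $p$ in which cars perform simple symmetric random walks. Let $V_t$ denote the number of visits by cars to a given site up to time $t$ and let $V=\lim_{t\to\infty}V_t$. (i) If $p\ge 1/2$, then $V=\infty$ almost surely. Moreover, $\mathbf{E}V_t=(2p-1)t+o(t)$ as $t\to\infty$. (ii) If $p<1/2$, then $V<\infty$ almost surely. Moreover, if $p<(256\,d^6e^2)^{-1}$, then $\mathbf{E}V<\infty$.
   Context: Parking process on $\mathbb{Z}^d$: initially each site independently contains one car with probability $p$, and otherwise (probability $1-p$) is a parking spot that can fit one car. In discrete time, all unparked cars simultaneously perform independent simple symmetric random walks on $\mathbb{Z}^d$ (each step goes to one of the $2d$ nearest neighbors with probability $1/(2d)$). When one or more unparked cars move at the same time to a parking spot that is still unoccupied, exactly one of them, chosen uniformly at random (e.g. by i.i.d. uniform $[0,1]$ tie-breaking variables, the smallest value winning), parks there and stays forever; the other cars remain unparked and continue walking. Cars arriving at an occupied spot, or at a site that initially contained a car, pass through unaffected, and cars do not interact otherwise. A car visits site $v$ at time $t\ge1$ if it is unparked at a neighbor of $v$ at time $t-1$ and moves to $v$ at time $t$ (whether or not it parks there). $V_t^{(v)}$ is the total number of visits to $v$ by cars at times $1,\dots,t$ (counting multiple visits by the same car and simultaneous visits by different cars), so time $0$ is not counted and $V_0^{(v)}=0$; $V^{(v)}=\lim_{t\to\infty}V^{(v)}_t\in[0,\infty]$. The laws of $V_t^{(v)}$ and $V^{(v)}$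 do not depend on $v$, and $V_t$, $V$ denote random variables with these laws. *)

theory Defs
  imports "HOL-Probability.Probability" "HOL-Library.Landau_Symbols"
begin

text \<open>
  Sites are the points of \<open>int ^ 'd\<close>, with \<open>CARD('d)\<close> the dimension. A direction \<open>(i, b)\<close> encodes
  one of the \<open>2 * CARD('d)\<close> nearest-neighbour steps.
\<close>

type_synonym 'd site = "int ^ 'd"

definition step_vec :: "'d \<times> bool \<Rightarrow> 'd::finite site" where
  "step_vec e = axis (fst e) (if snd e then 1 else - 1)"

text \<open>
  Randomness attached to a site: whether it initially holds a car, the directions of the successive
  steps of that car, and its tie-breaking values (one for each time). The last two are also sampled,
  but never used, at sites that start as parking spots.
\<close>

type_synonym 'd site_data = "bool \<times> (nat \<Rightarrow> 'd \<times> bool) \<times> (nat \<Rightarrow> real)"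
type_synonym 'd config = "'d site \<Rightarrow> 'd site_data"

definition site_law :: "real \<Rightarrow> ('d::finite) site_data measure" where
  "site_law p =
     measure_pmf (bernoulli_pmf p)
       \<Otimes>\<^sub>M (Pi\<^sub>M UNIV (\<lambda>_. measure_pmf (pmf_of_set UNIV))
       \<Otimes>\<^sub>M Pi\<^sub>M UNIV (\<lambda>_. uniform_measure lborel {0..1}))"

definition parking_space :: "real \<Rightarrow> ('d::finite) config measure" where
  "parking_space p = Pi\<^sub>M UNIV (\<lambda>_. site_law p)"

definition has_car :: "('d::finite) config \<Rightarrow> 'd site \<Rightarrow> bool" where
  "has_car \<omega> u = fst (\<omega> u)"

definition direction :: "('d::finite) config \<Rightarrow> 'd site \<Rightarrow> nat \<Rightarrow> 'd \<times> bool" where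
  "direction \<omega> u = fst (snd (\<omega> u))"

definition tie_value :: "('d::finite) config \<Rightarrow> 'd site \<Rightarrow> nat \<Rightarrow> real" where
  "tie_value \<omega> u = snd (snd (\<omega> u))"

text \<open>
  Cars are named by their starting site. The walk below is that of a car ignoring parking; it gives
  the true position of the car for as long as the car is unparked.
\<close>

definition walk :: "('d::finite) config \<Rightarrow> 'd site \<Rightarrow> nat \<Rightarrow> 'd site" where
  "walk \<omega> u t = u + (\<Sum>s<t. step_vec (direction \<omega> u s))"

text \<open>
  A parking state \<open>P\<close> maps each occupied spot to the car parked there, so \<open>ran P\<close> is the set of
  parked cars. \<open>arrivals \<omega> P t v\<close> are the cars stepping onto \<open>v\<close> at time \<open>t \<ge> 1\<close> when \<open>P\<close> is the
  state at time \<open>t - 1\<close>.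
\<close>

definition arrivals ::
  "('d::finite) config \<Rightarrow> ('d site \<rightharpoonup> 'd site) \<Rightarrow> nat \<Rightarrow> 'd site \<Rightarrow> 'd site set" where
  "arrivals \<omega> P t v = {u. has_car \<omega> u \<and> u \<notin> ran P \<and> walk \<omega> u t = v}"

text \<open>Equal tie-breaking values have probability zero; \<^const>\<open>arg_min_on\<close> then picks one car.\<close>

primrec parked :: "('d::finite) config \<Rightarrow> nat \<Rightarrow> 'd site \<rightharpoonup> 'd site" where
  "parked \<omega> 0 = Map.empty"
| "parked \<omega> (Suc t) = (\<lambda>v.
     let A = arrivals \<omega> (parked \<omega> t) (Suc t) v in
     if parked \<omega> t v \<noteq> None then parked \<omega> t v
     else if has_car \<omega> v \<or> A = {} then None
     else Some (arg_min_on (\<lambda>u. tie_value \<omega> u (Suc t)) A))"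

definition visits :: "('d::finite) config \<Rightarrow> 'd site \<Rightarrow> nat \<Rightarrow> nat" where
  "visits \<omega> v t = (\<Sum>s<t. card (arrivals \<omega> (parked \<omega> s) (Suc s) v))"

definition total_visits :: "('d::finite) config \<Rightarrow> 'd site \<Rightarrow> ennreal" where
  "total_visits \<omega> v = lim (\<lambda>t. of_nat (visits \<omega> v t))"

text \<open>The cardinalities in \<^const>\<open>visits\<close> are those of finite sets, for every configuration.\<close>

lemma finite_arrivals: "finite (arrivals \<omega> P t v)"
proof (rule finite_subset)
  show "arrivals \<omega> P t v \<subseteq>
      (\<lambda>\<sigma>. v - (\<Sum>s<t. step_vec (\<sigma> s))) ` (PiE {..<t} (\<lambda>_. UNIV))"
  proof
    fix u assume "u \<in> arrivals \<omega> P t v"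
    then have "u = v - (\<Sum>s<t. step_vec (restrict (direction \<omega> u) {..<t} s))"
      by (auto simp: arrivals_def walk_def)
    then show "u \<in> (\<lambda>\<sigma>. v - (\<Sum>s<t. step_vec (\<sigma> s))) ` (PiE {..<t} (\<lambda>_. UNIV))"
      by (intro image_eqI[where x = "restrict (direction \<omega> u) {..<t}"]) auto
  qed
qed (auto intro!: finite_imageI finite_PiE)

text \<open>The limit in \<^const>\<open>total_visits\<close> exists.\<close>

lemma visits_LIMSEQ:
  "(\<lambda>t. of_nat (visits \<omega> v t)) \<longlonglongrightarrow> total_visits \<omega> v"
proof -
  have "incseq (\<lambda>t. of_nat (visits \<omega> v t) :: ennreal)"
    by (intro incseq_SucI) (simp add: visits_def)
  then show ?thesis
    unfolding total_visits_def by (metis LIMSEQ_SUP limI)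
qed

end

theory Submission
  imports Defs
begin

text \<open>
  By mass transport the expected number of visits at time \<open>t + 1\<close> is the probability that a given site
  starts with a car still unparked at time \<open>t\<close>, and this exceeds the probability that a given site is a
  spot still vacant at time \<open>t\<close> by exactly \<open>2 p - 1\<close>. Let \<open>\<zeta>\<close> and \<open>\<theta>\<close> be the limits of these two
  probabilities, so that \<open>\<zeta> - \<theta> = 2 p - 1\<close>. If \<open>\<theta> > 0\<close>, a random walk independent of the process almost
  surely hits a forever vacant spot: its escape probabilities form a stationary harmonic function, which
  is therefore constant, and they vanish on the forever vacant spots, which exist by mixing. By
  monotonicity in the set of cars, a given car then parks almost surely. Hence \<open>\<theta> > 0\<close> forces
  \<open>\<zeta> = 0\<close> and \<open>p < 1/2\<close>. So for \<open>p \<ge> 1/2\<close> every spot is filled, and a finite modification of the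
  configuration upgrades this to infinitely many visits. For \<open>p < 1/2\<close> there are forever vacant spots,
  whereas infinitely many visits to one site would spread to all sites.

  For small \<open>p\<close>, the range of a car unparked at time \<open>t\<close> lies in a finite connected set in which a
  majority of the sites start with a car. Such sets of size \<open>n\<close> are exponentially rare, and the
  expected time during which the range has size at most \<open>n\<close> is at most \<open>n (2 d)\<^sup>n\<close>.
\<close>

subsection \<open>Pathwise properties of the parking process\<close>

text \<open>No car's walk is independent of the final vacancies, since it helps to shape them. The
  way out is to resample the data at the origin: a configuration with a car there supplies the
  vacancies, an independent datum supplies the walk. If the new car never parked, it might as well
  be absent; the original configuration then has one car more, so its vacancies are vacancies for
  the new car too, and the new walk meets one of them. This is why \<open>parking_mono\<close>
  carries a set \<open>N\<close> of cars that never park.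

  Visits spread to a neighbour because each time some car is at a site, a chosen one takes the given
  direction with chance 1 / (2 d), whatever the past. An exponential supermartingale does the work
  of a conditional Borel-Cantelli lemma.

  The density threshold comes from a union bound. A cluster of n sites is traced by at most 2 n
  directions, at a cost of \<open>(2 d)^(2 n)\<close>; its cars form one of \<open>2^n\<close>
  subsets, each present with probability at most \<open>sqrt p ^ n\<close>. With the time bound, the
  terms are at most \<open>n x^n\<close> for \<open>x = 2 (2 d)^3 sqrt p\<close>, and
  \<open>x < 1\<close> means \<open>256 d^6 p < 1\<close>.\<close>

definition unparked :: "('d::finite) config \<Rightarrow> nat \<Rightarrow> 'd site \<Rightarrow> bool" where
  "unparked \<omega> t u \<longleftrightarrow> has_car \<omega> u \<and> u \<notin> ran (parked \<omega> t)"

definition vacant :: "('d::finite) config \<Rightarrow> nat \<Rightarrow> 'd site \<Rightarrow> bool" where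
  "vacant \<omega> t v \<longleftrightarrow> \<not> has_car \<omega> v \<and> parked \<omega> t v = None"

definition arriving :: "('d::finite) config \<Rightarrow> nat \<Rightarrow> 'd site \<Rightarrow> 'd site set" where
  "arriving \<omega> t v = {u. unparked \<omega> t u \<and> walk \<omega> u (Suc t) = v}"

definition winner :: "('d::finite) config \<Rightarrow> nat \<Rightarrow> 'd site \<Rightarrow> 'd site" where
  "winner \<omega> t v = arg_min_on (\<lambda>u. tie_value \<omega> u (Suc t)) (arriving \<omega> t v)"

text \<open>Almost sure by \<open>AE_no_ties\<close>. When tie values coincide,
  \<open>arg_min_on\<close> falls back on Hilbert choice, which respects neither translations nor
  the addition of cars, so both kinds of argument are confined to this event.\<close>

definition no_ties :: "('d::finite) config \<Rightarrow> bool" where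
  "no_ties \<omega> \<longleftrightarrow> (\<forall>u u' t. tie_value \<omega> u t = tie_value \<omega> u' t \<longrightarrow> u = u')"

lemma arrivals_parked: "arrivals \<omega> (parked \<omega> t) (Suc t) v = arriving \<omega> t v"
  by (simp add: arrivals_def arriving_def unparked_def)

lemma finite_arriving: "finite (arriving \<omega> t v)"
  using finite_arrivals[of \<omega> "parked \<omega> t" "Suc t" v] by (simp add: arrivals_parked)

lemma arrivingI: "unparked \<omega> t u \<Longrightarrow> walk \<omega> u (Suc t) = v \<Longrightarrow> u \<in> arriving \<omega> t v"
  by (simp add: arriving_def)

lemma parked_Suc:
  "parked \<omega> (Suc t) v =
     (if vacant \<omega> t v \<and> arriving \<omega> t v \<noteq> {} then Some (winner \<omega> t v) else parked \<omega> t v)"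
  by (simp add: arrivals_parked winner_def vacant_def Let_def)

declare parked.simps(2) [simp del]

lemma parked_has_car: "has_car \<omega> v \<Longrightarrow> parked \<omega> t v = None"
  by (induction t) (auto simp: parked_Suc vacant_def)

lemma parked_mono: "parked \<omega> s v = Some u \<Longrightarrow> s \<le> t \<Longrightarrow> parked \<omega> t v = Some u"
  by (rotate_tac, induction rule: dec_induct) (auto simp: parked_Suc vacant_def)

lemma unparked_antimono: "unparked \<omega> t u \<Longrightarrow> s \<le> t \<Longrightarrow> unparked \<omega> s u"
  unfolding unparked_def ran_def using parked_mono by blast

lemma vacant_antimono: "vacant \<omega> t u \<Longrightarrow> s \<le> t \<Longrightarrow> vacant \<omega> s u"
  unfolding vacant_def by (metis not_None_eq parked_mono)

lemma unparked_0 [simp]: "unparked \<omega> 0 u \<longleftrightarrow> has_car \<omega> u"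
  by (simp add: unparked_def)

lemma winner_arriving: "arriving \<omega> t v \<noteq> {} \<Longrightarrow> winner \<omega> t v \<in> arriving \<omega> t v"
  unfolding winner_def by (intro arg_min_if_finite finite_arriving)

lemma winner_le: "u \<in> arriving \<omega> t v \<Longrightarrow> tie_value \<omega> (winner \<omega> t v) (Suc t) \<le> tie_value \<omega> u (Suc t)"
  unfolding winner_def by (rule arg_min_least) (auto intro: finite_arriving)

lemma parkedE:
  assumes "parked \<omega> t v = Some u"
  obtains s where "s < t" "vacant \<omega> s v" "unparked \<omega> s u" "walk \<omega> u (Suc s) = v"
    "u = winner \<omega> s v" "parked \<omega> (Suc s) v = Some u"
proof -
  have "\<exists>s<t. vacant \<omega> s v \<and> unparked \<omega> s u \<and> walk \<omega> u (Suc s) = v \<and> u = winner \<omega> s v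
          \<and> parked \<omega> (Suc s) v = Some u"
    using assms
  proof (induction t)
    case (Suc t)
    show ?case
    proof (cases "vacant \<omega> t v \<and> arriving \<omega> t v \<noteq> {}")
      case True
      then have u: "u = winner \<omega> t v"
        using Suc.prems by (simp add: parked_Suc)
      then have "u \<in> arriving \<omega> t v"
        using winner_arriving True by blast
      then show ?thesis
        using True u Suc.prems by (auto simp: arriving_def)
    next
      case False
      then have "parked \<omega> t v = Some u"
        using Suc.prems by (auto simp: parked_Suc)
      then show ?thesis
        using Suc.IH less_Suc_eq by metis
    qed
  qed simp
  then show ?thesis
    using that by blast
qed

lemma unparked_SucE:
  assumes "unparked \<omega> t u" "\<not> unparked \<omega> (Suc t) u"
  shows "vacant \<omega> t (walk \<omega> u (Suc t))" "winner \<omega> t (walk \<omega> u (Suc t)) = u"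
proof -
  obtain v where v: "parked \<omega> (Suc t) v = Some u"
    using assms by (auto simp: unparked_def ran_def)
  from v obtain s where s: "s < Suc t" "vacant \<omega> s v" "walk \<omega> u (Suc s) = v" "u = winner \<omega> s v"
    "parked \<omega> (Suc s) v = Some u"
    by (rule parkedE)
  have "s = t"
  proof (rule ccontr)
    assume "s \<noteq> t"
    then have "parked \<omega> t v = Some u"
      using parked_mono[OF s(5), of t] s(1) by simp
    then show False
      using assms(1) by (auto simp: unparked_def ran_def)
  qed
  then show "vacant \<omega> t (walk \<omega> u (Suc t))" "winner \<omega> t (walk \<omega> u (Suc t)) = u"
    using s by auto
qed

lemma winner_parks:
  assumes "vacant \<omega> t v" "arriving \<omega> t v \<noteq> {}"
  shows "\<not> unparked \<omega> (Suc t) (winner \<omega> t v)"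
  using assms by (auto simp: unparked_def ran_def parked_Suc intro!: exI[of _ v])

lemma vacant_Suc: "vacant \<omega> (Suc t) v \<longleftrightarrow> vacant \<omega> t v \<and> arriving \<omega> t v = {}"
  by (auto simp: vacant_def parked_Suc)

text \<open>Parking ends the unparked state for good, so two parking times of one car must coincide,
  and its walk has a single position at that time.\<close>

lemma parked_inj:
  assumes "parked \<omega> t v = Some u" "parked \<omega> t v' = Some u"
  shows "v = v'"
proof -
  obtain s where s: "unparked \<omega> s u" "walk \<omega> u (Suc s) = v" "parked \<omega> (Suc s) v = Some u"
    using parkedE[OF assms(1)] by metis
  obtain s' where s': "unparked \<omega> s' u" "walk \<omega> u (Suc s') = v'" "parked \<omega> (Suc s') v' = Some u"
    using parkedE[OF assms(2)] by metis
  have "\<not> unparked \<omega> (Suc s) u" "\<not> unparked \<omega> (Suc s') u"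
    using s s' by (auto simp: unparked_def ran_def)
  then have "s' < Suc s" "s < Suc s'"
    using unparked_antimono[OF s'(1), of "Suc s"] unparked_antimono[OF s(1), of "Suc s'"]
    by linarith+
  then show ?thesis
    using s s' by (simp add: less_Suc_eq_le)
qed

lemma visits_arriving: "visits \<omega> v t = (\<Sum>s<t. card (arriving \<omega> s v))"
  by (simp add: visits_def arrivals_parked)

lemma visits_mono: "s \<le> t \<Longrightarrow> visits \<omega> v s \<le> visits \<omega> v t"
  unfolding visits_arriving by (intro sum_mono2) auto

lemma total_visits_SUP: "total_visits \<omega> v = (SUP t. of_nat (visits \<omega> v t))"
proof -
  have "incseq (\<lambda>t. of_nat (visits \<omega> v t) :: ennreal)"
    by (auto intro!: monoI visits_mono)
  then show ?thesis
    using LIMSEQ_SUP visits_LIMSEQ LIMSEQ_unique by blast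
qed

lemma total_visits_finite_iff:
  "total_visits \<omega> v < \<infinity> \<longleftrightarrow> (\<exists>T. \<forall>t\<ge>T. arriving \<omega> t v = {})"
proof
  assume "total_visits \<omega> v < \<infinity>"
  then obtain n :: nat where n: "total_visits \<omega> v < of_nat n"
    using ennreal_Ex_less_of_nat by (metis infinity_ennreal_def)
  have bound: "visits \<omega> v t < n" for t
  proof -
    have "of_nat (visits \<omega> v t) \<le> total_visits \<omega> v"
      unfolding total_visits_SUP by (rule SUP_upper) simp
    then show ?thesis
      using n by (metis of_nat_less_iff order.strict_trans1)
  qed
  \<comment> \<open>A bounded nondecreasing integer sequence attains its maximum; no car can arrive
    from then on.\<close>
  define m where "m = Max (range (visits \<omega> v))"
  have fin: "finite (range (visits \<omega> v))"
    by (rule finite_subset[of _ "{..n}"]) (use bound in \<open>auto intro: less_imp_le\<close>)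
  then have "m \<in> range (visits \<omega> v)"
    unfolding m_def by (intro Max_in) auto
  then obtain T where T: "visits \<omega> v T = m"
    by auto
  have "arriving \<omega> t v = {}" if "t \<ge> T" for t
  proof -
    have "visits \<omega> v (Suc t) \<le> m"
      unfolding m_def using fin by (intro Max_ge) auto
    moreover have "m \<le> visits \<omega> v t"
      using visits_mono[OF that] T by metis
    ultimately have "card (arriving \<omega> t v) = 0"
      by (simp add: visits_arriving)
    then show ?thesis
      using finite_arriving[of \<omega> t v] by simp
  qed
  then show "\<exists>T. \<forall>t\<ge>T. arriving \<omega> t v = {}"
    by blast
next
  assume "\<exists>T. \<forall>t\<ge>T. arriving \<omega> t v = {}"
  then obtain T where T: "\<And>t. t \<ge> T \<Longrightarrow> arriving \<omega> t v = {}"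
    by blast
  have "visits \<omega> v t \<le> visits \<omega> v T" for t
  proof (cases "t \<le> T")
    case False
    then have "visits \<omega> v t = visits \<omega> v T"
      unfolding visits_arriving
      by (intro sum.mono_neutral_right) (auto simp: T)
    then show ?thesis by simp
  qed (simp add: visits_mono)
  then have "total_visits \<omega> v \<le> of_nat (visits \<omega> v T)"
    unfolding total_visits_SUP by (intro SUP_least) auto
  also have "\<dots> < \<infinity>"
    by (simp add: of_nat_less_top)
  finally show "total_visits \<omega> v < \<infinity>" .
qed

lemma vacant_iff_no_arrivals: "vacant \<omega> t v \<longleftrightarrow> \<not> has_car \<omega> v \<and> (\<forall>s<t. arriving \<omega> s v = {})"
proof (induction t)
  case 0
  show ?case
    by (simp add: vacant_def)
next
  case (Suc t)
  then show ?case
    by (auto simp: vacant_Suc less_Suc_eq)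
qed

definition forever_vacant :: "('d::finite) config \<Rightarrow> 'd site set" where
  "forever_vacant \<omega> = {v. \<forall>t. vacant \<omega> t v}"

text \<open>
  Adding cars (which may start on former parking spots) helps no car and no spot. The cars in \<open>N\<close>
  are those of \<open>\<omega>\<close> whose walk is changed in \<open>\<omega>'\<close>; as they never park in \<open>\<omega>\<close>, they may as well be
  absent there.
\<close>

lemma parking_mono:
  assumes "no_ties \<omega>'"
    and same: "\<And>u. has_car \<omega> u \<Longrightarrow> u \<notin> N \<Longrightarrow> \<omega>' u = \<omega> u"
    and car: "\<And>u. has_car \<omega> u \<Longrightarrow> has_car \<omega>' u"
    and N: "\<And>u t. u \<in> N \<Longrightarrow> unparked \<omega> t u"
  shows "(\<forall>u. unparked \<omega> t u \<longrightarrow> u \<notin> N \<longrightarrow> unparked \<omega>' t u) \<and> (\<forall>v. vacant \<omega>' t v \<longrightarrow> vacant \<omega> t v)"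
proof (induction t)
  case 0
  show ?case
    using car by (auto simp: vacant_def)
next
  case (Suc t)
  have walk: "walk \<omega>' u = walk \<omega> u" and tie: "tie_value \<omega>' u = tie_value \<omega> u"
    if "unparked \<omega> s u" "u \<notin> N" for s u
    using same[of u] that by (auto simp: walk_def direction_def tie_value_def unparked_def)
  have sub: "arriving \<omega> t v - N \<subseteq> arriving \<omega>' t v" for v
    using Suc.IH walk by (auto simp: arriving_def)
  have "unparked \<omega>' (Suc t) u" if u: "unparked \<omega> (Suc t) u" "u \<notin> N" for u
  proof (rule ccontr)
    assume *: "\<not> unparked \<omega>' (Suc t) u"
    have ut: "unparked \<omega> t u"
      using u(1) by (rule unparked_antimono) simp
    then have "unparked \<omega>' t u"
      using Suc.IH u by blast
    note E = unparked_SucE[OF this *]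
    define v where "v = walk \<omega> u (Suc t)"
    have v: "vacant \<omega> t v" "winner \<omega>' t v = u"
      using E Suc.IH walk[OF ut u(2)] by (auto simp: v_def)
    have ua: "u \<in> arriving \<omega> t v"
      using ut by (simp add: arriving_def v_def)
    then have ne: "arriving \<omega> t v \<noteq> {}"
      by blast
    \<comment> \<open>In \<open>\<omega>\<close> the car \<open>u\<close> survives this step, so
      another car wins \<open>v\<close> there. Since \<open>w\<close> parks, it is not in
      \<open>N\<close>; hence it competes in \<open>\<omega>'\<close> as well, and its loss to
      \<open>u\<close> there would be a tie.\<close>
    define w where "w = winner \<omega> t v"
    have w: "w \<in> arriving \<omega> t v" "w \<notin> N"
      using winner_arriving[OF ne] winner_parks[OF v(1) ne] N by (auto simp: w_def)
    have wu: "unparked \<omega> t w"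
      using w by (simp add: arriving_def)
    have "tie_value \<omega>' u (Suc t) \<le> tie_value \<omega>' w (Suc t)"
      using winner_le[of w \<omega>' t v] sub[of v] w v by blast
    moreover have "tie_value \<omega> w (Suc t) \<le> tie_value \<omega> u (Suc t)"
      using winner_le[OF ua] by (simp add: w_def)
    ultimately have "tie_value \<omega>' u (Suc t) = tie_value \<omega>' w (Suc t)"
      using tie[OF ut u(2)] tie[OF wu w(2)] by simp
    then have "u = w"
      using \<open>no_ties \<omega>'\<close> unfolding no_ties_def by blast
    then show False
      using winner_parks[OF v(1) ne] u(1) by (simp add: w_def)
  qed
  moreover have "vacant \<omega> (Suc t) v" if v: "vacant \<omega>' (Suc t) v" for v
  proof -
    have *: "vacant \<omega>' t v" "arriving \<omega>' t v = {}"
      using v by (auto simp: vacant_Suc)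
    then have vt: "vacant \<omega> t v"
      using Suc.IH by blast
    have "arriving \<omega> t v = {}"
    proof (rule ccontr)
      assume ne: "arriving \<omega> t v \<noteq> {}"
      \<comment> \<open>The winner parks, so it cannot belong to \<open>N\<close>, and by
        \<open>sub\<close> it arrives in the larger configuration too.\<close>
      then have "winner \<omega> t v \<in> arriving \<omega> t v - N"
        using winner_arriving[OF ne] winner_parks[OF vt ne] N by auto
      then show False
        using sub[of v] * by blast
    qed
    then show ?thesis
      using vt by (simp add: vacant_Suc)
  qed
  ultimately show ?case
    by blast
qed

section \<open>Translation equivariance of the process\<close>

definition translate :: "('d::finite) site \<Rightarrow> 'd config \<Rightarrow> 'd config" where
  "translate x \<omega> = (\<lambda>u. \<omega> (u + x))"

lemma has_car_translate [simp]: "has_car (translate x \<omega>) u = has_car \<omega> (u + x)"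
  and direction_translate [simp]: "direction (translate x \<omega>) u = direction \<omega> (u + x)"
  and tie_value_translate [simp]: "tie_value (translate x \<omega>) u = tie_value \<omega> (u + x)"
  by (simp_all add: translate_def has_car_def direction_def tie_value_def)

lemma walk_translate [simp]: "walk (translate x \<omega>) u t = walk \<omega> (u + x) t - x"
  by (simp add: walk_def)

lemma no_ties_translate: "no_ties \<omega> \<Longrightarrow> no_ties (translate x \<omega>)"
  unfolding no_ties_def by (metis tie_value_translate add_right_cancel)

text \<open>Without ties the winner is determined by minimality alone, which allows winners of two
  configurations to be compared.\<close>

lemma winner_eqI:
  assumes "no_ties \<omega>" "u \<in> arriving \<omega> t v"
    and "\<And>u'. u' \<in> arriving \<omega> t v \<Longrightarrow> tie_value \<omega> u (Suc t) \<le> tie_value \<omega> u' (Suc t)"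
  shows "winner \<omega> t v = u"
proof -
  have "winner \<omega> t v \<in> arriving \<omega> t v"
    using assms winner_arriving by blast
  then have "tie_value \<omega> (winner \<omega> t v) (Suc t) = tie_value \<omega> u (Suc t)"
    using winner_le[OF assms(2)] assms(3) by (intro antisym) auto
  then show ?thesis
    using \<open>no_ties \<omega>\<close> unfolding no_ties_def by blast
qed

lemma parked_translate:
  assumes "no_ties \<omega>"
  shows "parked (translate x \<omega>) t v = map_option (\<lambda>u. u - x) (parked \<omega> t (v + x))"
proof (induction t arbitrary: v)
  case (Suc t)
  have unp: "unparked (translate x \<omega>) t u = unparked \<omega> t (u + x)" for u
  proof -
    have "u \<in> ran (parked (translate x \<omega>) t) \<longleftrightarrow> (\<exists>v. parked \<omega> t (v + x) = Some (u + x))"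
      by (auto simp: ran_def Suc algebra_simps)
    also have "\<dots> \<longleftrightarrow> u + x \<in> ran (parked \<omega> t)"
      by (auto simp: ran_def) (metis diff_add_cancel)
    finally show ?thesis
      by (simp add: unparked_def)
  qed
  have vac: "vacant (translate x \<omega>) t v = vacant \<omega> t (v + x)"
    by (simp add: vacant_def Suc)
  have arr: "u \<in> arriving (translate x \<omega>) t v \<longleftrightarrow> u + x \<in> arriving \<omega> t (v + x)" for u
    by (auto simp: arriving_def unp algebra_simps)
  have arr_empty: "arriving (translate x \<omega>) t v = {} \<longleftrightarrow> arriving \<omega> t (v + x) = {}"
    using arr by (metis all_not_in_conv diff_add_cancel)
  have win: "winner (translate x \<omega>) t v = winner \<omega> t (v + x) - x" if "arriving \<omega> t (v + x) \<noteq> {}"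
  proof (rule winner_eqI)
    show "no_ties (translate x \<omega>)"
      using assms by (rule no_ties_translate)
    show "winner \<omega> t (v + x) - x \<in> arriving (translate x \<omega>) t v"
      using winner_arriving[OF that] by (simp add: arr)
    show "tie_value (translate x \<omega>) (winner \<omega> t (v + x) - x) (Suc t) \<le> tie_value (translate x \<omega>) u' (Suc t)"
      if "u' \<in> arriving (translate x \<omega>) t v" for u'
      using winner_le that by (simp add: arr)
  qed
  show ?case
    by (auto simp: parked_Suc vac arr_empty win Suc)
qed simp

lemma unparked_translate:
  assumes "no_ties \<omega>"
  shows "unparked (translate x \<omega>) t u = unparked \<omega> t (u + x)"
proof -
  have "u \<in> ran (parked (translate x \<omega>) t) \<longleftrightarrow> (\<exists>v. parked \<omega> t (v + x) = Some (u + x))"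
    by (auto simp: ran_def parked_translate[OF assms] algebra_simps)
  also have "\<dots> \<longleftrightarrow> u + x \<in> ran (parked \<omega> t)"
    by (auto simp: ran_def) (metis diff_add_cancel)
  finally show ?thesis
    by (simp add: unparked_def)
qed

lemma vacant_translate: "no_ties \<omega> \<Longrightarrow> vacant (translate x \<omega>) t v = vacant \<omega> t (v + x)"
  by (simp add: vacant_def parked_translate)

lemma forever_vacant_translate:
  "no_ties \<omega> \<Longrightarrow> v \<in> forever_vacant (translate x \<omega>) \<longleftrightarrow> v + x \<in> forever_vacant \<omega>"
  by (simp add: forever_vacant_def vacant_translate)

subsection \<open>Measurability and resampling\<close>

lemma prob_space_uniform_01: "prob_space (uniform_measure lborel {0..1::real})"
  by (rule prob_space_uniform_measure) auto

lemma prob_space_site_law: "prob_space (site_law p :: ('d::finite) site_data measure)"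
proof -
  have 1: "prob_space (Pi\<^sub>M UNIV (\<lambda>_::nat. measure_pmf (pmf_of_set (UNIV :: ('d \<times> bool) set))))"
    by (intro prob_space_PiM prob_space_measure_pmf)
  have 2: "prob_space (Pi\<^sub>M UNIV (\<lambda>_::nat. uniform_measure lborel {0..1::real}))"
    by (intro prob_space_PiM prob_space_uniform_01)
  have 3: "prob_space (measure_pmf (bernoulli_pmf p))"
    by (rule prob_space_measure_pmf)
  show ?thesis
    unfolding site_law_def
    using 1 2 3 by (intro prob_space_pair)
qed

lemma prob_space_parking_space: "prob_space (parking_space p)"
  unfolding parking_space_def by (intro prob_space_PiM prob_space_site_law)

lemma space_site_law [simp]: "space (site_law p) = UNIV"
  by (auto simp: site_law_def space_pair_measure space_PiM)

lemma space_parking_space [simp]: "space (parking_space p) = UNIV"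
  by (auto simp: parking_space_def space_PiM PiE_def)

lemma measurable_site [measurable]: "(\<lambda>\<omega>. \<omega> u) \<in> measurable (parking_space p) (site_law p)"
  unfolding parking_space_def by (rule measurable_component_singleton) simp

lemma measurable_fst_site_law [measurable]: "fst \<in> measurable (site_law p) (count_space UNIV)"
proof -
  have "fst \<in> measurable (site_law p) (measure_pmf (bernoulli_pmf p))"
    unfolding site_law_def by (rule measurable_fst)
  then show ?thesis
    by (simp cong: measurable_cong_sets)
qed

lemma measurable_direction_site_law [measurable]:
  "(\<lambda>a. fst (snd a) t) \<in> measurable (site_law p :: ('d::finite) site_data measure) (count_space UNIV)"
proof -
  have "(\<lambda>a. fst (snd a) t) \<in> measurable (site_law p) (measure_pmf (pmf_of_set (UNIV :: ('d \<times> bool) set)))"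
    unfolding site_law_def by measurable
  then show ?thesis
    by (simp cong: measurable_cong_sets)
qed

lemma measurable_tie_site_law [measurable]:
  "(\<lambda>a. snd (snd a) t) \<in> borel_measurable (site_law p)"
proof -
  have "(\<lambda>a. snd (snd a) t) \<in> measurable (site_law p) (uniform_measure lborel {0..1})"
    unfolding site_law_def by measurable
  then show ?thesis
    by (simp cong: measurable_cong_sets)
qed

lemma measurable_has_car [measurable]: "Measurable.pred (parking_space p) (\<lambda>\<omega>. has_car \<omega> u)"
  unfolding has_car_def by (rule measurable_compose[OF measurable_site]) measurable

lemma measurable_direction [measurable]:
  "(\<lambda>\<omega>. direction \<omega> u t) \<in> measurable (parking_space p) (count_space UNIV)"
  unfolding direction_def by (rule measurable_compose[OF measurable_site]) measurable

lemma measurable_tie_value [measurable]: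
  "(\<lambda>\<omega>. tie_value \<omega> u t) \<in> borel_measurable (parking_space p)"
  unfolding tie_value_def by (rule measurable_compose[OF measurable_site]) measurable

lemma walk_0 [simp]: "walk \<omega> u 0 = u"
  by (simp add: walk_def)

lemma walk_Suc: "walk \<omega> u (Suc t) = walk \<omega> u t + step_vec (direction \<omega> u t)"
  by (simp add: walk_def add.assoc)

lemma measurable_walk [measurable]:
  "(\<lambda>\<omega>. walk \<omega> u t) \<in> measurable (parking_space p) (count_space UNIV)"
proof (induction t)
  case (Suc t)
  note Suc [measurable]
  show ?case
    unfolding walk_Suc by measurable
qed simp

lemma measurable_tie_value_eq [measurable]:
  "Measurable.pred (parking_space p) (\<lambda>\<omega>. tie_value \<omega> u t = tie_value \<omega> u' t)"
  unfolding pred_def by (rule borel_measurable_eq) measurable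

lemma measurable_tie_value_le [measurable]:
  "Measurable.pred (parking_space p) (\<lambda>\<omega>. tie_value \<omega> u t \<le> tie_value \<omega> u' t)"
  unfolding pred_def by (rule borel_measurable_le) measurable

lemma measurable_parked [measurable]:
  "(\<lambda>\<omega>. parked \<omega> t v) \<in> measurable (parking_space p) (count_space UNIV)"
proof (induction t arbitrary: v)
  case (Suc t)
  note Suc [measurable]
  have [measurable]: "Measurable.pred (parking_space p) (\<lambda>\<omega>. unparked \<omega> t u)" for u :: "'a site"
    unfolding unparked_def ran_def by measurable
  have [measurable]: "Measurable.pred (parking_space p) (\<lambda>\<omega>. vacant \<omega> t v)" for v :: "'a site"
    unfolding vacant_def by measurable
  have [measurable]: "Measurable.pred (parking_space p) (\<lambda>\<omega>. u \<in> arriving \<omega> t v)" for u v :: "'a site"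
    unfolding arriving_def by measurable
  \<comment> \<open>The minimisers form a finite set. Quantifying over lists, a countable type,
    presents the event as a countable combination of measurable ones, even where a tie leaves the
    decision to \<open>SOME\<close>.\<close>
  have win: "winner \<omega> t v = u \<longleftrightarrow> (\<exists>xs.
      (\<forall>x. x \<in> set xs \<longleftrightarrow> x \<in> arriving \<omega> t v \<and>
         (\<forall>y. y \<in> arriving \<omega> t v \<longrightarrow> tie_value \<omega> x (Suc t) \<le> tie_value \<omega> y (Suc t))) \<and>
      (SOME x. x \<in> set xs) = u)" (is "_ \<longleftrightarrow> ?R") for \<omega> :: "'a config" and u v
  proof -
    define M where "M = {x \<in> arriving \<omega> t v. \<forall>y. y \<in> arriving \<omega> t v \<longrightarrow> tie_value \<omega> x (Suc t) \<le> tie_value \<omega> y (Suc t)}"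
    have "winner \<omega> t v = (SOME x. x \<in> M)"
      unfolding winner_def arg_min_on_def arg_min_def is_arg_min_linorder M_def by simp
    moreover obtain ys where "set ys = M"
      using finite_list[of M] finite_arriving[of \<omega> t v] by (auto simp: M_def)
    then have "(\<exists>xs. set xs = M \<and> (SOME x. x \<in> set xs) = u) \<longleftrightarrow> (SOME x. x \<in> M) = u"
      by (intro iffI exI[of _ ys]) auto
    moreover have "?R \<longleftrightarrow> (\<exists>xs. set xs = M \<and> (SOME x. x \<in> set xs) = u)"
    proof -
      have "(\<forall>x. x \<in> set xs \<longleftrightarrow> x \<in> arriving \<omega> t v \<and>
         (\<forall>y. y \<in> arriving \<omega> t v \<longrightarrow> tie_value \<omega> x (Suc t) \<le> tie_value \<omega> y (Suc t))) \<longleftrightarrow> set xs = M" for xs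
        by (auto simp: M_def)
      then show ?thesis
        by simp
    qed
    ultimately show ?thesis
      by simp
  qed
  have [measurable]: "Measurable.pred (parking_space p) (\<lambda>\<omega>. winner \<omega> t v = u)" for u v :: "'a site"
    unfolding win by measurable
  have *: "parked \<omega> (Suc t) v = x \<longleftrightarrow>
      (if vacant \<omega> t v \<and> (\<exists>u. u \<in> arriving \<omega> t v) then (\<exists>u. x = Some u \<and> winner \<omega> t v = u)
       else parked \<omega> t v = x)" for x and \<omega> :: "'a config"
    by (auto simp: parked_Suc)
  have "Measurable.pred (parking_space p) (\<lambda>\<omega>. parked \<omega> (Suc t) v = x)" for x
    unfolding * by measurable
  then have "(\<lambda>\<omega>. parked \<omega> (Suc t) v) -` {x} \<inter> space (parking_space p) \<in> sets (parking_space p)" for x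
    by (simp add: pred_def vimage_def)
  then show ?case
    by (simp add: measurable_count_space_eq2_countable)
qed simp

lemma measurable_unparked [measurable]: "Measurable.pred (parking_space p) (\<lambda>\<omega>. unparked \<omega> t u)"
  unfolding unparked_def ran_def by measurable

lemma measurable_vacant [measurable]: "Measurable.pred (parking_space p) (\<lambda>\<omega>. vacant \<omega> t v)"
  unfolding vacant_def by measurable

lemma measurable_arriving [measurable]: "Measurable.pred (parking_space p) (\<lambda>\<omega>. u \<in> arriving \<omega> t v)"
  unfolding arriving_def by measurable

lemma measurable_forever_vacant [measurable]:
  "Measurable.pred (parking_space p) (\<lambda>\<omega>. v \<in> forever_vacant \<omega>)"
  unfolding forever_vacant_def by measurable

lemma measurable_no_ties [measurable]: "Measurable.pred (parking_space p) no_ties"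
  unfolding no_ties_def by measurable

lemma measurable_translate: "translate x \<in> measurable (parking_space p) (parking_space p)"
proof -
  have "translate x \<in> measurable (parking_space p) (Pi\<^sub>M UNIV (\<lambda>_. site_law p))"
    unfolding translate_def by (rule measurable_PiM_single') auto
  then show ?thesis
    by (simp add: parking_space_def)
qed

lemma distr_translate: "distr (parking_space p) (parking_space p) (translate x) = parking_space p"
proof -
  have "distr (Pi\<^sub>M UNIV (\<lambda>_. site_law p)) (Pi\<^sub>M UNIV (\<lambda>_. site_law p)) (\<lambda>\<omega>. \<lambda>n\<in>UNIV. \<omega> (n + x))
      = Pi\<^sub>M UNIV (\<lambda>_. site_law p)"
    by (rule distr_PiM_reindex) (auto intro: prob_space_site_law)
  then show ?thesis
    by (simp add: parking_space_def translate_def[abs_def] restrict_def)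
qed

lemma AE_translate: "AE \<omega> in parking_space p. Q \<omega> \<Longrightarrow> AE \<omega> in parking_space p. Q (translate x \<omega>)"
  by (rule AE_distrD[OF measurable_translate]) (simp only: distr_translate)

section \<open>Resampling the data of one site\<close>

lemma measurable_PiM_update:
  "(\<lambda>(a, x). x(i := a)) \<in> measurable (M \<Otimes>\<^sub>M Pi\<^sub>M UNIV (\<lambda>_. M)) (Pi\<^sub>M UNIV (\<lambda>_. M))"
proof -
  have "(\<lambda>(a, x). x(i := a)) \<in> measurable (M \<Otimes>\<^sub>M Pi\<^sub>M UNIV (\<lambda>_. M)) (Pi\<^sub>M (insert i UNIV) (\<lambda>_. M))"
    by measurable
  then show ?thesis
    by simp
qed

text \<open>As \<open>insert i UNIV\<close> is \<open>UNIV\<close>, extending a product by one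
  coordinate becomes overwriting a coordinate by an independent copy. Conditioning on all sites but
  one is done through this identity, without conditional expectations.\<close>

lemma distr_PiM_update:
  assumes "prob_space M"
  shows "distr (M \<Otimes>\<^sub>M Pi\<^sub>M UNIV (\<lambda>_. M)) (Pi\<^sub>M UNIV (\<lambda>_. M)) (\<lambda>(a, x). x(i := a)) = Pi\<^sub>M UNIV (\<lambda>_. M)"
proof -
  have "distr (M \<Otimes>\<^sub>M Pi\<^sub>M UNIV (\<lambda>_. M)) (Pi\<^sub>M (insert i UNIV) (\<lambda>_. M)) (\<lambda>(a, x). x(i := a))
     = Pi\<^sub>M (insert i UNIV) (\<lambda>_. M)"
    using assms by (intro distr_pair_PiM_eq_PiM)
  then show ?thesis
    by simp
qed

lemma pair_sigma_finite_PiM: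
  assumes "prob_space M"
  shows "pair_sigma_finite M (Pi\<^sub>M UNIV (\<lambda>_. M))"
  using assms by (simp add: pair_sigma_finite_def prob_space_imp_sigma_finite prob_space_PiM)

lemma AE_PiM_update:
  assumes "prob_space M" "AE x in Pi\<^sub>M UNIV (\<lambda>_. M). Q x"
  shows "AE a in M. AE x in Pi\<^sub>M UNIV (\<lambda>_. M). Q (x(i := a))"
proof -
  interpret pair_sigma_finite M "Pi\<^sub>M UNIV (\<lambda>_. M)"
    using assms(1) by (rule pair_sigma_finite_PiM)
  have "AE x in M \<Otimes>\<^sub>M Pi\<^sub>M UNIV (\<lambda>_. M). Q (case x of (a, x) \<Rightarrow> x(i := a))"
    by (rule AE_distrD[OF measurable_PiM_update]) (simp only: distr_PiM_update assms)
  from AE_pair[OF this] show ?thesis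
    by simp
qed

lemma nn_integral_PiM_update:
  assumes M: "prob_space M" and [measurable]: "f \<in> borel_measurable (Pi\<^sub>M UNIV (\<lambda>_. M))"
  shows "(\<integral>\<^sup>+x. f x \<partial>Pi\<^sub>M UNIV (\<lambda>_. M)) = (\<integral>\<^sup>+x. (\<integral>\<^sup>+a. f (x(i := a)) \<partial>M) \<partial>Pi\<^sub>M UNIV (\<lambda>_. M))"
proof -
  interpret pair_sigma_finite M "Pi\<^sub>M UNIV (\<lambda>_. M)"
    using M by (rule pair_sigma_finite_PiM)
  note measurable_PiM_update [measurable]
  have f: "(\<lambda>x. f (case x of (a, x) \<Rightarrow> x(i := a))) \<in> borel_measurable (M \<Otimes>\<^sub>M Pi\<^sub>M UNIV (\<lambda>_. M))"
    by measurable
  have "(\<integral>\<^sup>+x. f x \<partial>Pi\<^sub>M UNIV (\<lambda>_. M))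
      = (\<integral>\<^sup>+x. f x \<partial>distr (M \<Otimes>\<^sub>M Pi\<^sub>M UNIV (\<lambda>_. M)) (Pi\<^sub>M UNIV (\<lambda>_. M)) (\<lambda>(a, x). x(i := a)))"
    by (simp only: distr_PiM_update[OF M])
  also have "\<dots> = (\<integral>\<^sup>+x. f (case x of (a, x) \<Rightarrow> x(i := a)) \<partial>(M \<Otimes>\<^sub>M Pi\<^sub>M UNIV (\<lambda>_. M)))"
    by (intro nn_integral_distr measurable_PiM_update) simp
  also have "\<dots> = (\<integral>\<^sup>+x. (\<integral>\<^sup>+a. f (x(i := a)) \<partial>M) \<partial>Pi\<^sub>M UNIV (\<lambda>_. M))"
    by (subst nn_integral_snd[symmetric]) (use f in \<open>auto simp: case_prod_beta'\<close>)
  finally show ?thesis .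
qed

lemma AE_update:
  "AE \<xi> in parking_space p. Q \<xi> \<Longrightarrow> AE a in site_law p. AE \<xi> in parking_space p. Q (\<xi>(u := a))"
  unfolding parking_space_def by (intro AE_PiM_update prob_space_site_law)

lemma nn_integral_update:
  "f \<in> borel_measurable (parking_space p) \<Longrightarrow>
    (\<integral>\<^sup>+\<xi>. f \<xi> \<partial>parking_space p) = (\<integral>\<^sup>+\<xi>. (\<integral>\<^sup>+a. f (\<xi>(u := a)) \<partial>site_law p) \<partial>parking_space p)"
  unfolding parking_space_def by (intro nn_integral_PiM_update prob_space_site_law)

lemma measurable_update:
  "(\<lambda>(a, \<xi>). \<xi>(u := a)) \<in> measurable (site_law p \<Otimes>\<^sub>M parking_space p) (parking_space p)"
  unfolding parking_space_def by (rule measurable_PiM_update)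

lemma distr_site: "distr (parking_space p) (site_law p) (\<lambda>\<omega>. \<omega> u) = site_law p"
  unfolding parking_space_def by (rule distr_PiM_component) (auto intro: prob_space_site_law)

lemma AE_pair_snd:
  assumes "prob_space B" "AE y in B. Q y"
  shows "AE x in A \<Otimes>\<^sub>M B. Q (snd x)"
proof -
  interpret B: prob_space B by fact
  obtain N where N: "{y \<in> space B. \<not> Q y} \<subseteq> N" "emeasure B N = 0" "N \<in> sets B"
    using assms(2) by (rule AE_E)
  have "emeasure (A \<Otimes>\<^sub>M B) (space A \<times> N) = 0"
    using N by (subst B.emeasure_pair_measure_Times) auto
  then have "space A \<times> N \<in> null_sets (A \<Otimes>\<^sub>M B)"
    using N by auto
  then show ?thesis
    by (rule AE_I') (use N in \<open>auto simp: space_pair_measure\<close>)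
qed

lemma AE_site_law_tie_neq: "AE a in (site_law p :: ('d::finite) site_data measure). snd (snd a) t \<noteq> c"
proof -
  define D where "D = Pi\<^sub>M UNIV (\<lambda>_::nat. measure_pmf (pmf_of_set (UNIV :: ('d \<times> bool) set)))"
  define U where "U = Pi\<^sub>M UNIV (\<lambda>_::nat. uniform_measure lborel {0..1::real})"
  have D: "prob_space D" and U: "prob_space U"
    unfolding D_def U_def by (intro prob_space_PiM prob_space_measure_pmf prob_space_uniform_01)+
  have "AE x in uniform_measure lborel {0..1::real}. x \<noteq> c"
    by (rule AE_uniform_measureI) (auto intro: eventually_mono[OF AE_lborel_singleton])
  then have *: "AE z in U. z t \<noteq> c"
    unfolding U_def using prob_space_uniform_01 by (intro AE_PiM_component[where P = "\<lambda>x. x \<noteq> c"]) auto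
  have "AE x in D \<Otimes>\<^sub>M U. snd x t \<noteq> c"
    using AE_pair_snd[OF U *] .
  then have "AE x in measure_pmf (bernoulli_pmf p) \<Otimes>\<^sub>M (D \<Otimes>\<^sub>M U). snd (snd x) t \<noteq> c"
    by (rule AE_pair_snd[OF prob_space_pair[OF D U]])
  then show ?thesis
    unfolding site_law_def D_def U_def .
qed

text \<open>Resampling the site \<open>u\<close> alone turns a tie with \<open>u'\<close> into the
  event that a uniform variable hits a fixed number. There are countably many triples of two sites
  and a time.\<close>

lemma AE_no_ties: "AE \<xi> in parking_space p. no_ties \<xi>"
proof -
  have "AE \<xi> in parking_space p. tie_value \<xi> u t = tie_value \<xi> u' t \<longrightarrow> u = u'" for u u' :: "'a site" and t
  proof (cases "u = u'")
    case False
    have "(\<integral>\<^sup>+\<xi>. indicator {\<xi>. tie_value \<xi> u t = tie_value \<xi> u' t} \<xi> \<partial>parking_space p)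
       = (\<integral>\<^sup>+\<xi>. (\<integral>\<^sup>+a. indicator {\<xi>. tie_value \<xi> u t = tie_value \<xi> u' t} (\<xi>(u := a)) \<partial>site_law p) \<partial>parking_space p)"
      by (intro nn_integral_update) measurable
    also have "\<dots> = (\<integral>\<^sup>+\<xi>. 0 \<partial>(parking_space p :: 'a config measure))"
    proof (intro nn_integral_cong nn_integral_zero')
      fix \<xi> :: "'a config"
      show "AE a in site_law p. indicator {\<xi>. tie_value \<xi> u t = tie_value \<xi> u' t} (\<xi>(u := a)) = (0::ennreal)"
        using AE_site_law_tie_neq[where t = t and c = "tie_value \<xi> u' t"]
        by eventually_elim (use False in \<open>auto simp: tie_value_def indicator_def\<close>)
    qed
    finally have "(\<integral>\<^sup>+\<xi>. indicator {\<xi>. tie_value \<xi> u t = tie_value \<xi> u' t} \<xi> \<partial>parking_space p) = 0"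
      by simp
    then have "emeasure (parking_space p) {\<xi>. tie_value \<xi> u t = tie_value \<xi> u' t} = 0"
      using measurable_tie_value_eq[of u t u' p] by (subst (asm) nn_integral_indicator) (auto simp: pred_def)
    then have "AE \<xi> in parking_space p. \<xi> \<notin> {\<xi>. tie_value \<xi> u t = tie_value \<xi> u' t}"
      using measurable_tie_value_eq[of u t u' p] by (intro AE_not_in) (auto simp: null_sets_def pred_def)
    then show ?thesis
      by (rule eventually_mono) auto
  qed simp
  then show ?thesis
    unfolding no_ties_def AE_all_countable by blast
qed

subsection \<open>Mass transport\<close>

lemma measurable_card_arriving [measurable]:
  "(\<lambda>\<omega>. card (arriving \<omega> t v)) \<in> measurable (parking_space p) (count_space UNIV)"
proof -
  have *: "card (arriving \<omega> t v) = k \<longleftrightarrow>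
      (\<exists>xs. distinct xs \<and> length xs = k \<and> (\<forall>x. x \<in> set xs \<longleftrightarrow> x \<in> arriving \<omega> t v))" for \<omega> :: "'a config" and k
  proof
    assume "card (arriving \<omega> t v) = k"
    moreover obtain xs where "set xs = arriving \<omega> t v" "distinct xs"
      using finite_distinct_list[OF finite_arriving] by metis
    ultimately show "\<exists>xs. distinct xs \<and> length xs = k \<and> (\<forall>x. x \<in> set xs \<longleftrightarrow> x \<in> arriving \<omega> t v)"
      by (intro exI[of _ xs]) (auto simp: distinct_card[symmetric])
  next
    assume "\<exists>xs. distinct xs \<and> length xs = k \<and> (\<forall>x. x \<in> set xs \<longleftrightarrow> x \<in> arriving \<omega> t v)"
    then obtain xs where "distinct xs" "length xs = k" "set xs = arriving \<omega> t v"
      by blast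
    then show "card (arriving \<omega> t v) = k"
      using distinct_card by metis
  qed
  have "Measurable.pred (parking_space p) (\<lambda>\<omega>. card (arriving \<omega> t v) = k)" for k
    unfolding * by measurable
  then have "(\<lambda>\<omega>. card (arriving \<omega> t v)) -` {k} \<inter> space (parking_space p) \<in> sets (parking_space p)" for k
    by (simp add: pred_def vimage_def)
  then show ?thesis
    by (simp add: measurable_count_space_eq2_countable)
qed

lemma measurable_visits [measurable]:
  "(\<lambda>\<omega>. visits \<omega> v t) \<in> measurable (parking_space p) (count_space UNIV)"
  unfolding visits_arriving by measurable

text \<open>The assumptions mention only \<open>p\<close>; the argument \<open>dim\<close> ties the
  dimension \<open>'d\<close> to the locale.\<close>

locale parking =
  fixes p :: real and dim :: "('d::finite) itself"
  assumes p_nonneg: "0 \<le> p" and p_le_1: "p \<le> 1"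
begin

abbreviation P :: "'d config measure" where
  "P \<equiv> parking_space p"

sublocale prob_space P
  by (rule prob_space_parking_space)

lemma sets_Collect: "Measurable.pred P Q \<Longrightarrow> {\<omega>. Q \<omega>} \<in> events"
  by (simp add: pred_def)

lemma emeasure_cong_no_ties:
  assumes "Measurable.pred P Q" "Measurable.pred P R"
    and "\<And>\<omega>. no_ties \<omega> \<Longrightarrow> R \<omega> \<longleftrightarrow> Q \<omega>"
  shows "emeasure P {\<omega>. R \<omega>} = emeasure P {\<omega>. Q \<omega>}"
proof (rule emeasure_eq_AE)
  show "AE \<omega> in P. \<omega> \<in> {\<omega>. R \<omega>} \<longleftrightarrow> \<omega> \<in> {\<omega>. Q \<omega>}"
    using AE_no_ties by (rule eventually_mono) (simp add: assms(3))
qed (use assms in \<open>auto intro: sets_Collect\<close>)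

lemma emeasure_translate:
  assumes Q: "Measurable.pred P Q" and R: "Measurable.pred P R"
    and QR: "\<And>\<omega>. no_ties \<omega> \<Longrightarrow> R \<omega> \<longleftrightarrow> Q (translate x \<omega>)"
  shows "emeasure P {\<omega>. R \<omega>} = emeasure P {\<omega>. Q \<omega>}"
proof -
  have *: "Measurable.pred P (\<lambda>\<omega>. Q (translate x \<omega>))"
    using measurable_translate Q by (rule measurable_compose)
  have "emeasure P {\<omega>. R \<omega>} = emeasure P {\<omega>. Q (translate x \<omega>)}"
    using * R QR by (rule emeasure_cong_no_ties)
  also have "{\<omega>. Q (translate x \<omega>)} = translate x -` {\<omega>. Q \<omega>} \<inter> space P"
    by auto
  also have "emeasure P \<dots> = emeasure (distr P P (translate x)) {\<omega>. Q \<omega>}"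
    using Q by (intro emeasure_distr[symmetric] measurable_translate sets_Collect)
  finally show ?thesis
    by (simp only: distr_translate)
qed

lemma emeasure_site:
  assumes [measurable]: "Measurable.pred (site_law p) Q"
  shows "emeasure P {\<omega>. Q (\<omega> u)} = emeasure (site_law p) {a. Q a}"
proof -
  have "emeasure (site_law p) {a. Q a} = emeasure (distr P (site_law p) (\<lambda>\<omega>. \<omega> u)) {a. Q a}"
    by (simp only: distr_site)
  also have "\<dots> = emeasure P ((\<lambda>\<omega>. \<omega> u) -` {a. Q a} \<inter> space P)"
    by (intro emeasure_distr measurable_site) (use assms in \<open>simp add: pred_def\<close>)
  finally show ?thesis
    by (simp add: vimage_def)
qed

lemma emeasure_forever_vacant:
  "emeasure P {\<omega>. u \<in> forever_vacant \<omega>} = emeasure P {\<omega>. v \<in> forever_vacant \<omega>}"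
  by (rule emeasure_translate[where x = "u - v"]) (auto simp: forever_vacant_translate)

text \<open>Mass transport in a group: mass going from \<open>u\<close> to \<open>v\<close> has the
  expectation of mass going from \<open>v\<close> to \<open>v + v - u\<close>, and this reflection
  turns the sum over senders into a sum over receivers.\<close>

lemma bij_reflect: "bij_betw (\<lambda>u. v - u) UNIV (UNIV :: 'd site set)"
  by (rule bij_betwI[where g = "\<lambda>u. v - u"]) auto

text \<open>Mass transport: every car sends mass 1 to the site it moves to.\<close>

lemma nn_integral_card_arriving:
  "(\<integral>\<^sup>+\<omega>. of_nat (card (arriving \<omega> t v)) \<partial>P) = emeasure P {\<omega>. unparked \<omega> t v}"
proof -
  have eq: "emeasure P {\<omega>. u \<in> arriving \<omega> t v} = emeasure P {\<omega>. unparked \<omega> t v \<and> walk \<omega> v (Suc t) = v + v - u}" for u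
    by (rule emeasure_translate[where x = "u - v"])
      (auto simp: arriving_def unparked_translate algebra_simps)
  have "(\<integral>\<^sup>+\<omega>. of_nat (card (arriving \<omega> t v)) \<partial>P)
      = (\<integral>\<^sup>+\<omega>. (\<integral>\<^sup>+u. indicator {\<omega>. u \<in> arriving \<omega> t v} \<omega> \<partial>count_space UNIV) \<partial>P)"
  proof (rule nn_integral_cong)
    fix \<omega>
    have "(\<integral>\<^sup>+u. indicator {\<omega>. u \<in> arriving \<omega> t v} \<omega> \<partial>count_space UNIV)
       = (\<integral>\<^sup>+u. indicator (arriving \<omega> t v) u \<partial>count_space UNIV)"
      by (intro nn_integral_cong) (auto simp: indicator_def)
    also have "\<dots> = of_nat (card (arriving \<omega> t v))"
      by (simp add: finite_arriving)
    finally show "of_nat (card (arriving \<omega> t v)) = (\<integral>\<^sup>+u. indicator {\<omega>. u \<in> arriving \<omega> t v} \<omega> \<partial>count_space UNIV)" by simp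
  qed
  also have "\<dots> = (\<integral>\<^sup>+u. (\<integral>\<^sup>+\<omega>. indicator {\<omega>. u \<in> arriving \<omega> t v} \<omega> \<partial>P) \<partial>count_space UNIV)"
    by (intro nn_integral_count_space_nn_integral) (auto intro!: borel_measurable_indicator sets_Collect)
  also have "\<dots> = (\<integral>\<^sup>+u. emeasure P {\<omega>. u \<in> arriving \<omega> t v} \<partial>count_space UNIV)"
    by (intro nn_integral_cong nn_integral_indicator sets_Collect) simp
  also have "\<dots> = (\<integral>\<^sup>+u. emeasure P {\<omega>. unparked \<omega> t v \<and> walk \<omega> v (Suc t) = v + v - u} \<partial>count_space UNIV)"
    by (simp only: eq)
  also have "\<dots> = (\<integral>\<^sup>+u. emeasure P {\<omega>. unparked \<omega> t v \<and> walk \<omega> v (Suc t) = u} \<partial>count_space UNIV)"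
    by (rule nn_integral_bij_count_space[OF bij_reflect])
  also have "\<dots> = emeasure P (\<Union>u\<in>UNIV. {\<omega>. unparked \<omega> t v \<and> walk \<omega> v (Suc t) = u})"
    by (intro emeasure_UN_countable[symmetric]) (auto simp: disjoint_family_on_def intro!: sets_Collect)
  finally show ?thesis
    by (simp add: UNION_eq)
qed

text \<open>Mass transport: every parked car sends mass 1 to its parking spot.\<close>

lemma emeasure_occupied:
  "emeasure P {\<omega>. parked \<omega> t v \<noteq> None} = emeasure P {\<omega>. v \<in> ran (parked \<omega> t)}"
proof -
  have eq: "emeasure P {\<omega>. parked \<omega> t v = Some u} = emeasure P {\<omega>. parked \<omega> t (v + v - u) = Some v}" for u
    by (rule emeasure_translate[where x = "u - v"]) (auto simp: parked_translate algebra_simps)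
  have "emeasure P {\<omega>. parked \<omega> t v \<noteq> None} = emeasure P (\<Union>u\<in>UNIV. {\<omega>. parked \<omega> t v = Some u})"
    by (rule arg_cong[where f = "emeasure P"]) auto
  also have "\<dots> = (\<integral>\<^sup>+u. emeasure P {\<omega>. parked \<omega> t v = Some u} \<partial>count_space UNIV)"
    by (intro emeasure_UN_countable) (auto simp: disjoint_family_on_def intro!: sets_Collect)
  also have "\<dots> = (\<integral>\<^sup>+u. emeasure P {\<omega>. parked \<omega> t (v + v - u) = Some v} \<partial>count_space UNIV)"
    by (simp only: eq)
  also have "\<dots> = (\<integral>\<^sup>+u. emeasure P {\<omega>. parked \<omega> t u = Some v} \<partial>count_space UNIV)"
    by (rule nn_integral_bij_count_space[OF bij_reflect])
  also have "\<dots> = emeasure P (\<Union>u\<in>UNIV. {\<omega>. parked \<omega> t u = Some v})"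
    by (intro emeasure_UN_countable[symmetric])
      (auto simp: disjoint_family_on_def intro!: sets_Collect dest: parked_inj)
  also have "(\<Union>u\<in>UNIV. {\<omega>. parked \<omega> t u = Some v}) = {\<omega>. v \<in> ran (parked \<omega> t)}"
    by (auto simp: ran_def)
  finally show ?thesis .
qed

lemma emeasure_site_has_car: "emeasure (site_law p :: 'd site_data measure) {a. fst a} = ennreal p"
proof -
  define D where "D = Pi\<^sub>M UNIV (\<lambda>_::nat. measure_pmf (pmf_of_set (UNIV :: ('d \<times> bool) set)))"
  define U where "U = Pi\<^sub>M UNIV (\<lambda>_::nat. uniform_measure lborel {0..1::real})"
  have "prob_space (D \<Otimes>\<^sub>M U)"
    unfolding D_def U_def by (intro prob_space_pair prob_space_PiM prob_space_measure_pmf prob_space_uniform_01)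
  then interpret DU: prob_space "D \<Otimes>\<^sub>M U" .
  have "{a. fst a} = {True} \<times> space (D \<Otimes>\<^sub>M U)"
    by (auto simp: D_def U_def space_pair_measure space_PiM)
  then have "emeasure (site_law p :: 'd site_data measure) {a. fst a} =
      emeasure (measure_pmf (bernoulli_pmf p) \<Otimes>\<^sub>M (D \<Otimes>\<^sub>M U)) ({True} \<times> space (D \<Otimes>\<^sub>M U))"
    by (simp add: site_law_def D_def U_def)
  also have "\<dots> = emeasure (measure_pmf (bernoulli_pmf p)) {True} * emeasure (D \<Otimes>\<^sub>M U) (space (D \<Otimes>\<^sub>M U))"
    by (rule DU.emeasure_pair_measure_Times) auto
  also have "\<dots> = ennreal p"
    using p_nonneg p_le_1 by (simp add: DU.emeasure_space_1 emeasure_pmf_single)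
  finally show ?thesis .
qed

lemma prob_has_car: "prob {\<omega>. has_car \<omega> u} = p"
  using emeasure_site[of fst u] p_nonneg unfolding has_car_def
  by (simp add: emeasure_site_has_car measure_def)

text \<open>Initial cars have density \<open>p\<close> and lose the parked ones; spots have density
  \<open>1 - p\<close> and lose the occupied ones. By \<open>emeasure_occupied\<close> the two
  losses agree and cancel in the difference.\<close>

lemma prob_unparked_vacant: "prob {\<omega>. unparked \<omega> t v} - prob {\<omega>. vacant \<omega> t v} = 2 * p - 1"
proof -
  have occ: "prob {\<omega>. parked \<omega> t v \<noteq> None} = prob {\<omega>. v \<in> ran (parked \<omega> t)}"
    by (simp only: measure_def emeasure_occupied)
  have ran: "v \<in> ran (parked \<omega> t) \<Longrightarrow> has_car \<omega> v" for \<omega> :: "'d config"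
    unfolding ran_def using parkedE unparked_def by blast
  have [measurable]: "Measurable.pred P (\<lambda>\<omega>. v \<in> ran (parked \<omega> t))"
    unfolding ran_def by measurable
  have "{\<omega>. unparked \<omega> t v} = {\<omega>. has_car \<omega> v} - {\<omega>. v \<in> ran (parked \<omega> t)}"
    by (auto simp: unparked_def)
  then have 1: "prob {\<omega>. unparked \<omega> t v} = p - prob {\<omega>. v \<in> ran (parked \<omega> t)}"
    using ran by (simp add: finite_measure_Diff sets_Collect prob_has_car Collect_mono)
  have "{\<omega>. vacant \<omega> t v} = {\<omega>. \<not> has_car \<omega> v} - {\<omega>. parked \<omega> t v \<noteq> None}"
    by (auto simp: vacant_def)
  then have "prob {\<omega>. vacant \<omega> t v} = prob {\<omega>. \<not> has_car \<omega> v} - prob {\<omega>. parked \<omega> t v \<noteq> None}"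
    by (simp only:) (auto intro!: finite_measure_Diff sets_Collect simp: parked_has_car)
  moreover have "prob {\<omega>. \<not> has_car \<omega> v} = 1 - p"
    using prob_neg[of "\<lambda>\<omega>. has_car \<omega> v"] by (simp add: sets_Collect prob_has_car)
  ultimately show ?thesis
    using 1 occ by simp
qed

lemma prob_unparked_LIMSEQ:
  "(\<lambda>t. prob {\<omega>. unparked \<omega> t v}) \<longlonglongrightarrow> prob {\<omega>. \<forall>t. unparked \<omega> t v}"
proof -
  have "(\<lambda>t. prob {\<omega>. unparked \<omega> t v}) \<longlonglongrightarrow> prob (\<Inter>t. {\<omega>. unparked \<omega> t v})"
    by (rule finite_Lim_measure_decseq) (auto intro!: sets_Collect simp: decseq_def intro: unparked_antimono)
  then show ?thesis
    by (simp add: INTER_eq)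
qed

lemma prob_vacant_LIMSEQ:
  "(\<lambda>t. prob {\<omega>. vacant \<omega> t v}) \<longlonglongrightarrow> prob {\<omega>. v \<in> forever_vacant \<omega>}"
proof -
  have "(\<lambda>t. prob {\<omega>. vacant \<omega> t v}) \<longlonglongrightarrow> prob (\<Inter>t. {\<omega>. vacant \<omega> t v})"
    by (rule finite_Lim_measure_decseq) (auto intro!: sets_Collect simp: decseq_def intro: vacant_antimono)
  then show ?thesis
    by (simp add: INTER_eq forever_vacant_def)
qed

lemma prob_survive_forever_vacant:
  "prob {\<omega>. \<forall>t. unparked \<omega> t v} - prob {\<omega>. v \<in> forever_vacant \<omega>} = 2 * p - 1"
proof (rule LIMSEQ_unique)
  show "(\<lambda>t. prob {\<omega>. unparked \<omega> t v} - prob {\<omega>. vacant \<omega> t v})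
     \<longlonglongrightarrow> prob {\<omega>. \<forall>t. unparked \<omega> t v} - prob {\<omega>. v \<in> forever_vacant \<omega>}"
    by (intro tendsto_diff prob_unparked_LIMSEQ prob_vacant_LIMSEQ)
qed (simp add: prob_unparked_vacant)

lemma nn_integral_visits:
  "(\<integral>\<^sup>+\<omega>. of_nat (visits \<omega> v t) \<partial>P) = (\<Sum>s<t. emeasure P {\<omega>. unparked \<omega> s v})"
  unfolding visits_arriving of_nat_sum
  by (subst nn_integral_sum) (auto simp: nn_integral_card_arriving)

lemma expectation_visits:
  "(\<integral>\<omega>. real (visits \<omega> v t) \<partial>P) = (\<Sum>s<t. prob {\<omega>. unparked \<omega> s v})"
proof -
  have "(\<integral>\<omega>. real (visits \<omega> v t) \<partial>P) = enn2real (\<integral>\<^sup>+\<omega>. ennreal (real (visits \<omega> v t)) \<partial>P)"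
    by (rule integral_eq_nn_integral) auto
  also have "(\<integral>\<^sup>+\<omega>. ennreal (real (visits \<omega> v t)) \<partial>P) = (\<Sum>s<t. emeasure P {\<omega>. unparked \<omega> s v})"
    by (simp add: nn_integral_visits ennreal_of_nat_eq_real_of_nat[symmetric])
  also have "\<dots> = ennreal (\<Sum>s<t. prob {\<omega>. unparked \<omega> s v})"
    by (simp add: emeasure_eq_measure)
  finally show ?thesis
    by (simp add: sum_nonneg)
qed

lemma nn_integral_total_visits:
  "(\<integral>\<^sup>+\<omega>. total_visits \<omega> v \<partial>P) = (\<Sum>t. emeasure P {\<omega>. unparked \<omega> t v})"
proof -
  have "(\<integral>\<^sup>+\<omega>. total_visits \<omega> v \<partial>P) = (SUP t. \<integral>\<^sup>+\<omega>. of_nat (visits \<omega> v t) \<partial>P)"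
    unfolding total_visits_SUP
    by (intro nn_integral_monotone_convergence_SUP) (auto simp: incseq_def le_fun_def visits_mono)
  then show ?thesis
    by (simp add: nn_integral_visits suminf_eq_SUP)
qed

end

subsection \<open>Mixing\<close>

lemma tendsto_suminf_dominated:
  fixes a :: "nat \<Rightarrow> nat \<Rightarrow> real"
  assumes "summable M" "\<And>i n. norm (a i n) \<le> M i" "\<And>i. (\<lambda>n. a i n) \<longlonglongrightarrow> b i"
  shows "(\<lambda>n. \<Sum>i. a i n) \<longlonglongrightarrow> (\<Sum>i. b i)"
  using tannerys_theorem[of a b sequentially M] assms by (simp add: always_eventually)

context parking
begin

lemma prob_rectangle:
  assumes "finite J" "\<And>u. u \<in> J \<Longrightarrow> Measurable.pred (site_law p) (E u)"
  shows "prob {\<omega>. \<forall>u\<in>J. E u (\<omega> u)} = (\<Prod>u\<in>J. measure (site_law p) {a. E u a})"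
proof -
  interpret S: product_prob_space "\<lambda>_::'d site. site_law p :: 'd site_data measure" UNIV
    by (simp add: product_prob_space_def product_prob_space_axioms_def product_sigma_finite_def
        prob_space_site_law prob_space_imp_sigma_finite)
  have "emeasure P {\<omega>. \<forall>u\<in>J. E u (\<omega> u)} = (\<Prod>u\<in>J. emeasure (site_law p) {a. E u a})"
    using S.emeasure_PiM_Collect[of J "\<lambda>u. {a. E u a}"] assms
    by (simp add: parking_space_def pred_def space_PiM PiE_def)
  also have "\<dots> = ennreal (\<Prod>u\<in>J. measure (site_law p) {a. E u a})"
    by (simp add: finite_measure.emeasure_eq_measure[OF prob_space.finite_measure[OF prob_space_site_law]] prod_ennreal)
  finally show ?thesis
    by (simp add: emeasure_eq_measure prod_nonneg)
qed

text \<open>Dynkin's pi-lambda theorem: finite-dimensional rectangles form an intersection-stable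
  generator, so only disjoint unions have to be treated.\<close>

lemma rectangle_induct [consumes 1, case_names rectangle compl union]:
  assumes "A \<in> events"
    and rectangle: "\<And>J E. finite J \<Longrightarrow> (\<And>u. Measurable.pred (site_law p) (E u)) \<Longrightarrow> Q {\<omega>. \<forall>u\<in>J. E u (\<omega> u)}"
    and compl: "\<And>A. A \<in> events \<Longrightarrow> Q A \<Longrightarrow> Q (- A)"
    and union: "\<And>A. disjoint_family A \<Longrightarrow> range A \<subseteq> events \<Longrightarrow> (\<And>i. Q (A i)) \<Longrightarrow> Q (\<Union>i::nat. A i)"
  shows "Q A"
proof -
  let ?G = "prod_algebra UNIV (\<lambda>_::'d site. site_law p :: 'd site_data measure)"
  have sets: "events = sigma_sets UNIV ?G"
    by (simp add: parking_space_def sets_PiM PiE_def)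
  have "Int_stable ?G"
    by (rule Int_stable_prod_algebra)
  moreover have "?G \<subseteq> Pow UNIV"
    by simp
  moreover have "A \<in> sigma_sets UNIV ?G"
    using assms(1) sets by simp
  ultimately show ?thesis
  proof (induction rule: sigma_sets_induct_disjoint)
    case (basic X)
    then obtain J E where JE: "X = prod_emb UNIV (\<lambda>_. site_law p) J (Pi\<^sub>E J E)" "finite J"
      "\<And>u. u \<in> J \<Longrightarrow> E u \<in> sets (site_law p)"
      by (auto elim!: prod_algebraE)
    \<comment> \<open>The sides outside \<open>J\<close> are set to the whole space so that
      measurability holds at every site, as the rectangle case demands.\<close>
    define F where "F u = (if u \<in> J then E u else UNIV)" for u
    have "F u \<in> sets (site_law p)" for u
      using JE(3) sets.top[of "site_law p :: 'd site_data measure"] by (auto simp: F_def)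
    then have "Q {\<omega>. \<forall>u\<in>J. \<omega> u \<in> F u}"
      by (intro rectangle JE(2)) (simp add: pred_def)
    also have "{\<omega>. \<forall>u\<in>J. \<omega> u \<in> F u} = X"
      by (auto simp: JE(1) prod_emb_def F_def PiE_iff extensional_def)
    finally show ?case .
  next
    case empty
    have "Q (- UNIV)"
      using rectangle[of "{}" "\<lambda>_ _. True"] sets.top[of P] by (intro assms(3)) auto
    then show ?case by simp
  next
    case (compl X)
    then show ?case
      using assms(3)[of X] sets by (simp add: Compl_eq_Diff_UNIV)
  next
    case (union X)
    then show ?case
      using assms(4)[of X] sets by auto
  qed
qed

text \<open>Mixing along one direction is enough for a zero-one law; the diagonal singles out no
  coordinate of \<open>'d\<close>.\<close>

definition diag :: "nat \<Rightarrow> 'd site" where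
  "diag n = (\<chi> i. int n)"

lemma eventually_diag_disjoint:
  fixes J K :: "'d site set"
  assumes "finite J" "finite K"
  shows "\<forall>\<^sub>F n in sequentially. J \<inter> (\<lambda>u. u + diag n) ` K = {}"
proof -
  obtain i :: 'd where True by simp
  define N where "N = (\<lambda>(u, k). nat ((u - k) $ i)) ` (J \<times> K)"
  have "finite N"
    using assms by (simp add: N_def)
  then obtain m where m: "\<And>n. n \<in> N \<Longrightarrow> n < m"
    using finite_nat_set_iff_bounded by auto
  have "J \<inter> (\<lambda>u. u + diag n) ` K = {}" if "n \<ge> m" for n
  proof (rule ccontr)
    assume "J \<inter> (\<lambda>u. u + diag n) ` K \<noteq> {}"
    then obtain k where k: "k \<in> K" "k + diag n \<in> J"
      by auto
    then have "nat ((k + diag n - k) $ i) \<in> N"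
      unfolding N_def by force
    then have "n \<in> N"
      by (simp add: diag_def)
    then show False
      using m that by force
  qed
  then show ?thesis
    by (auto simp: eventually_sequentially)
qed

lemma events_translate: "B \<in> events \<Longrightarrow> {\<omega>. translate x \<omega> \<in> B} \<in> events"
  using measurable_sets[OF measurable_translate, of B p x] by (simp add: vimage_def)

lemma prob_translate: "B \<in> events \<Longrightarrow> prob {\<omega>. translate x \<omega> \<in> B} = prob B"
  using measure_distr[OF measurable_translate, of B p x] distr_translate[of p x]
  by (simp add: vimage_def)

lemma prob_countable_union_LIMSEQ:
  assumes disj: "disjoint_family A" and A: "range A \<subseteq> events" "\<And>n. D n \<in> events"
    and conv: "\<And>i. (\<lambda>n. prob (A i \<inter> D n)) \<longlonglongrightarrow> prob (A i) * c"
  shows "(\<lambda>n. prob ((\<Union>i::nat. A i) \<inter> D n)) \<longlonglongrightarrow> prob (\<Union>i. A i) * c"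
proof -
  have sums: "(\<lambda>i. prob (A i)) sums prob (\<Union>i. A i)"
    using A disj by (intro finite_measure_UNION)
  have eq: "prob ((\<Union>i. A i) \<inter> D n) = (\<Sum>i. prob (A i \<inter> D n))" for n
  proof -
    have "(\<lambda>i. prob (A i \<inter> D n)) sums prob (\<Union>i. A i \<inter> D n)"
      using A disj by (intro finite_measure_UNION) (auto simp: disjoint_family_on_def, blast)
    then show ?thesis
      by (simp add: sums_iff Int_UN_distrib2)
  qed
  have "(\<lambda>n. \<Sum>i. prob (A i \<inter> D n)) \<longlonglongrightarrow> (\<Sum>i. prob (A i) * c)"
  proof (rule tendsto_suminf_dominated)
    show "summable (\<lambda>i. prob (A i))"
      using sums by (simp add: sums_iff)
    show "norm (prob (A i \<inter> D n)) \<le> prob (A i)" for i n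
      using A by (auto intro!: finite_measure_mono)
  qed (rule conv)
  also have "(\<Sum>i. prob (A i) * c) = prob (\<Union>i. A i) * c"
    using sums suminf_mult2[of "\<lambda>i. prob (A i)" c] by (simp add: sums_iff)
  finally show ?thesis
    by (simp add: eq)
qed

text \<open>Two rectangles depend on finitely many sites, so far translates of one are exactly
  independent of the other. \<open>rectangle_induct\<close> then extends this in \<open>B\<close>,
  and inside its rectangle case in \<open>A\<close>.\<close>

theorem mixing:
  assumes "A \<in> events" "B \<in> events"
  shows "(\<lambda>n. prob (A \<inter> {\<omega>. translate (diag n) \<omega> \<in> B})) \<longlonglongrightarrow> prob A * prob B"
  using assms(2,1)
proof (induction B rule: rectangle_induct)
  case (rectangle K F)
  show ?case
    using \<open>A \<in> events\<close>
  proof (induction A rule: rectangle_induct)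
    case (rectangle J E)
    have "\<forall>\<^sub>F n in sequentially. prob ({\<omega>. \<forall>u\<in>J. E u (\<omega> u)} \<inter> {\<omega>. translate (diag n) \<omega> \<in> {\<omega>. \<forall>u\<in>K. F u (\<omega> u)}})
       = prob {\<omega>. \<forall>u\<in>J. E u (\<omega> u)} * prob {\<omega>. \<forall>u\<in>K. F u (\<omega> u)}"
      using eventually_diag_disjoint[OF \<open>finite J\<close> \<open>finite K\<close>]
    proof eventually_elim
      case (elim n)
      then have disj: "u + diag n \<notin> J" if "u \<in> K" for u
        using that by blast
      define K' where "K' = (\<lambda>u. u + diag n) ` K"
      define G where "G w = (if w \<in> J then E w else F (w - diag n))" for w
      have "{\<omega>. \<forall>u\<in>J. E u (\<omega> u)} \<inter> {\<omega>. translate (diag n) \<omega> \<in> {\<omega>. \<forall>u\<in>K. F u (\<omega> u)}}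
          = {\<omega>. \<forall>u\<in>J \<union> K'. G u (\<omega> u)}"
        using disj by (auto simp: translate_def G_def K'_def ball_Un)
      also have "prob \<dots> = (\<Prod>u\<in>J \<union> K'. measure (site_law p) {a. G u a})"
        using rectangle \<open>finite K\<close> \<open>\<And>u. Measurable.pred (site_law p) (F u)\<close>
        by (intro prob_rectangle) (auto simp: K'_def G_def)
      also have "\<dots> = (\<Prod>u\<in>J. measure (site_law p) {a. G u a}) * (\<Prod>u\<in>K'. measure (site_law p) {a. G u a})"
        using elim rectangle \<open>finite K\<close> by (intro prod.union_disjoint) (auto simp: K'_def)
      also have "(\<Prod>u\<in>J. measure (site_law p) {a. G u a}) = (\<Prod>u\<in>J. measure (site_law p) {a. E u a})"
        by (intro prod.cong) (auto simp: G_def)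
      also have "(\<Prod>u\<in>K'. measure (site_law p) {a. G u a}) = (\<Prod>u\<in>K. measure (site_law p) {a. F u a})"
        unfolding K'_def by (subst prod.reindex) (use disj in \<open>auto simp: G_def intro!: prod.cong\<close>)
      finally show ?case
        using rectangle \<open>finite K\<close> \<open>\<And>u. Measurable.pred (site_law p) (F u)\<close> by (simp add: prob_rectangle)
    qed
    then show ?case
      by (rule tendsto_eventually)
  next
    case (compl A)
    define D where "D n = {\<omega>. translate (diag n) \<omega> \<in> {\<omega>. \<forall>u\<in>K. F u (\<omega> u)}}" for n
    have F: "{\<omega>. \<forall>u\<in>K. F u (\<omega> u)} \<in> events"
      using \<open>finite K\<close> \<open>\<And>u. Measurable.pred (site_law p) (F u)\<close>
      by (intro sets_Collect pred_intros_finite) (auto intro!: measurable_compose[OF measurable_site])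
    then have D: "D n \<in> events" "prob (D n) = prob {\<omega>. \<forall>u\<in>K. F u (\<omega> u)}" for n
      unfolding D_def by (rule events_translate, rule prob_translate)
    have "prob (- A \<inter> D n) = prob {\<omega>. \<forall>u\<in>K. F u (\<omega> u)} - prob (A \<inter> D n)" for n
      using finite_measure_Diff'[of "D n" A] D compl.hyps
      by (simp add: Int_commute Diff_eq)
    moreover have "prob (- A) = 1 - prob A"
      using prob_compl[OF compl.hyps(1)] by (simp add: Compl_eq_Diff_UNIV)
    moreover have "(\<lambda>n. prob {\<omega>. \<forall>u\<in>K. F u (\<omega> u)} - prob (A \<inter> D n))
        \<longlonglongrightarrow> prob {\<omega>. \<forall>u\<in>K. F u (\<omega> u)} - prob A * prob {\<omega>. \<forall>u\<in>K. F u (\<omega> u)}"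
      unfolding D_def by (intro tendsto_diff tendsto_const compl.IH)
    ultimately have "(\<lambda>n. prob (- A \<inter> D n)) \<longlonglongrightarrow> prob (- A) * prob {\<omega>. \<forall>u\<in>K. F u (\<omega> u)}"
      by (simp only: left_diff_distrib mult_1)
    then show ?case
      unfolding D_def .
  next
    case (union A)
    have F: "{\<omega>. \<forall>u\<in>K. F u (\<omega> u)} \<in> events"
      using \<open>finite K\<close> \<open>\<And>u. Measurable.pred (site_law p) (F u)\<close>
      by (intro sets_Collect pred_intros_finite) (auto intro!: measurable_compose[OF measurable_site])
    show ?case
      using union by (intro prob_countable_union_LIMSEQ events_translate F) auto
  qed
next
  case (compl B)
  have "prob (A \<inter> {\<omega>. translate (diag n) \<omega> \<in> - B}) = prob A - prob (A \<inter> {\<omega>. translate (diag n) \<omega> \<in> B})" for n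
    using finite_measure_Diff'[of A "{\<omega>. translate (diag n) \<omega> \<in> B}"] compl events_translate
    by (simp add: Diff_eq Collect_neg_eq)
  moreover have "prob (- B) = 1 - prob B"
    using prob_compl[OF compl.hyps(1)] by (simp add: Compl_eq_Diff_UNIV)
  moreover have "(\<lambda>n. prob A - prob (A \<inter> {\<omega>. translate (diag n) \<omega> \<in> B})) \<longlonglongrightarrow> prob A - prob A * prob B"
    by (intro tendsto_diff tendsto_const compl.IH compl.prems)
  ultimately show ?case
    by (simp only: right_diff_distrib mult_1_right)
next
  case (union B)
  have "prob (A \<inter> {\<omega>. translate (diag n) \<omega> \<in> (\<Union>i. B i)}) = (\<Sum>i. prob (A \<inter> {\<omega>. translate (diag n) \<omega> \<in> B i}))" for n
  proof -
    have "(\<lambda>i. prob (A \<inter> {\<omega>. translate (diag n) \<omega> \<in> B i})) sums prob (\<Union>i. A \<inter> {\<omega>. translate (diag n) \<omega> \<in> B i})"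
    proof (rule finite_measure_UNION)
      show "range (\<lambda>i. A \<inter> {\<omega>. translate (diag n) \<omega> \<in> B i}) \<subseteq> events"
        using union.hyps(2) union.prems events_translate by auto
      show "disjoint_family (\<lambda>i. A \<inter> {\<omega>. translate (diag n) \<omega> \<in> B i})"
        using union.hyps(1) unfolding disjoint_family_on_def by blast
    qed
    moreover have "(\<Union>i. A \<inter> {\<omega>. translate (diag n) \<omega> \<in> B i}) = A \<inter> {\<omega>. translate (diag n) \<omega> \<in> (\<Union>i. B i)}"
      by auto
    ultimately show ?thesis
      by (simp add: sums_iff)
  qed
  moreover have sums: "(\<lambda>i. prob (B i)) sums prob (\<Union>i. B i)"
    using union by (intro finite_measure_UNION) auto
  moreover have "(\<lambda>n. \<Sum>i. prob (A \<inter> {\<omega>. translate (diag n) \<omega> \<in> B i})) \<longlonglongrightarrow> (\<Sum>i. prob A * prob (B i))"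
  proof (rule tendsto_suminf_dominated)
    show "summable (\<lambda>i. prob (B i))"
      using sums by (simp add: sums_iff)
    show "norm (prob (A \<inter> {\<omega>. translate (diag n) \<omega> \<in> B i})) \<le> prob (B i)" for i n
    proof -
      have "prob (A \<inter> {\<omega>. translate (diag n) \<omega> \<in> B i}) \<le> prob {\<omega>. translate (diag n) \<omega> \<in> B i}"
        using union events_translate by (intro finite_measure_mono) auto
      then show ?thesis
        using union by (auto simp: prob_translate)
    qed
  qed (use union in auto)
  ultimately show ?case
    by (simp add: sums_iff suminf_mult)
qed

text \<open>Mixing makes an invariant event independent of itself. Invariance is asked only almost
  surely because the process is equivariant only in the absence of ties.\<close>

corollary zero_one_law:
  assumes "A \<in> events" "AE \<omega> in P. \<forall>x. translate x \<omega> \<in> A \<longleftrightarrow> \<omega> \<in> A"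
  shows "prob A = 0 \<or> prob A = 1"
proof -
  have "prob (A \<inter> {\<omega>. translate (diag n) \<omega> \<in> A}) = prob A" for n
    using assms events_translate[OF assms(1)]
    by (intro finite_measure_eq_AE) (auto elim!: eventually_mono)
  then have "prob A * prob A = prob A"
    using mixing[OF assms(1) assms(1)] by (simp add: LIMSEQ_const_iff)
  then show ?thesis
    by auto
qed

text \<open>The absence of forever vacant spots is translation invariant and excludes an event of
  positive probability, so it cannot have probability one.\<close>

lemma AE_forever_vacant_nonempty:
  assumes "prob {\<omega>. v \<in> forever_vacant \<omega>} > 0"
  shows "AE \<omega> in P. forever_vacant \<omega> \<noteq> {}"
proof -
  define A where "A = {\<omega> :: 'd config. \<forall>v. v \<notin> forever_vacant \<omega>}"
  have A: "A \<in> events"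
    unfolding A_def by (rule sets_Collect, rule pred_intros_countable(1)) measurable
  have "AE \<omega> in P. \<forall>x. translate x \<omega> \<in> A \<longleftrightarrow> \<omega> \<in> A"
    using AE_no_ties
  proof (rule eventually_mono)
    fix \<omega> :: "'d config" assume "no_ties \<omega>"
    then have "(\<forall>v. v \<notin> forever_vacant (translate x \<omega>)) \<longleftrightarrow> (\<forall>v. v \<notin> forever_vacant \<omega>)" for x
      by (metis forever_vacant_translate diff_add_cancel)
    then show "\<forall>x. translate x \<omega> \<in> A \<longleftrightarrow> \<omega> \<in> A"
      by (simp add: A_def)
  qed
  then consider "prob A = 0" | "prob A = 1"
    using zero_one_law[OF A] by auto
  then have "prob A = 0"
  proof cases
    case 2
    have "prob (A \<union> {\<omega>. v \<in> forever_vacant \<omega>}) = prob A + prob {\<omega>. v \<in> forever_vacant \<omega>}"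
      by (intro finite_measure_Union A sets_Collect) (auto simp: A_def)
    then show ?thesis
      using 2 assms prob_le_1[of "A \<union> {\<omega>. v \<in> forever_vacant \<omega>}"] by simp
  qed
  then have "AE \<omega> in P. \<omega> \<notin> A"
    using prob_eq_0[OF A] by blast
  then show ?thesis
    by (rule eventually_mono) (auto simp: A_def)
qed

end

subsection \<open>Survival of cars\<close>

text \<open>Moves from \<open>x\<close> to \<open>y\<close> one coordinate after the other. It will
  carry a null escape probability, and infinitely many visits, from one site to all.\<close>

lemma site_connected:
  fixes Q :: "('d::finite) site \<Rightarrow> bool"
  assumes step: "\<And>x e. Q x \<Longrightarrow> Q (x + step_vec e)" and "Q x"
  shows "Q y"
proof -
  have nat_axis: "Q (x + axis i (int k))" "Q (x - axis i (int k))" if "Q x" for i x k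
  proof (induction k)
    case (Suc k)
    {
      case 1
      have "x + axis i (int (Suc k)) = x + axis i (int k) + step_vec (i, True)"
        by (simp add: step_vec_def vec_eq_iff axis_def)
      then show ?case
        using step[OF Suc(1), of "(i, True)"] by metis
    next
      case 2
      have "x - axis i (int (Suc k)) = x - axis i (int k) + step_vec (i, False)"
        by (simp add: step_vec_def vec_eq_iff axis_def)
      then show ?case
        using step[OF Suc(2), of "(i, False)"] by metis
    }
  qed (use that in \<open>simp_all add: axis_def zero_vec_def[symmetric]\<close>)
  have axis: "Q (x + axis i k)" if "Q x" for i x k
  proof (cases "0 \<le> k")
    case True
    then show ?thesis
      using nat_axis(1)[OF that, of i "nat k"] by simp
  next
    case False
    moreover have "axis i (- k) = - axis i k"
      by (simp add: vec_eq_iff axis_def)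
    ultimately show ?thesis
      using nat_axis(2)[OF that, of i "nat (- k)"] by simp
  qed
  have sum: "Q (x + (\<Sum>i\<in>A. axis i ((y - x) $ i)))" if "finite A" for A
    using that
  proof (induction A rule: finite_induct)
    case (insert i A)
    have "x + (\<Sum>i\<in>insert i A. axis i ((y - x) $ i))
        = x + (\<Sum>i\<in>A. axis i ((y - x) $ i)) + axis i ((y - x) $ i)"
      using insert.hyps by (simp add: add_ac)
    then show ?case
      using axis[OF insert.IH, of i "(y - x) $ i"] by metis
  qed (simp add: \<open>Q x\<close>)
  have "(\<Sum>i\<in>UNIV. axis i ((y - x) $ i)) = y - x"
    by (simp add: vec_eq_iff axis_def if_distrib cong: if_cong)
  then show ?thesis
    using sum[of UNIV] by simp
qed

definition valency :: "'d itself \<Rightarrow> real" where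
  "valency _ = real CARD('d \<times> bool)"

lemma valency_pos: "valency TYPE('d::finite) > 0"
  by (simp add: valency_def)

lemma valency_eq: "valency TYPE('d::finite) = 2 * real CARD('d)"
  by (simp add: valency_def card_cartesian_product)

context parking
begin

lemma emeasure_site_law_Times:
  assumes "A \<in> sets (Pi\<^sub>M UNIV (\<lambda>_::nat. measure_pmf (pmf_of_set (UNIV :: ('d \<times> bool) set))))"
  shows "emeasure (site_law p) {a. fst a \<in> X \<and> fst (snd a) \<in> A} =
    emeasure (measure_pmf (bernoulli_pmf p)) X *
    emeasure (Pi\<^sub>M UNIV (\<lambda>_::nat. measure_pmf (pmf_of_set (UNIV :: ('d \<times> bool) set)))) A"
proof -
  define D where "D = Pi\<^sub>M UNIV (\<lambda>_::nat. measure_pmf (pmf_of_set (UNIV :: ('d \<times> bool) set)))"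
  define U where "U = Pi\<^sub>M UNIV (\<lambda>_::nat. uniform_measure lborel {0..1::real})"
  have D: "prob_space D" and U: "prob_space U"
    unfolding D_def U_def by (intro prob_space_PiM prob_space_measure_pmf prob_space_uniform_01)+
  interpret U: prob_space U by fact
  interpret DU: prob_space "D \<Otimes>\<^sub>M U"
    using D U by (rule prob_space_pair)
  have "space U = UNIV"
    by (auto simp: U_def space_PiM)
  then have "{a. fst a \<in> X \<and> fst (snd a) \<in> A} = X \<times> (A \<times> space U)"
    by auto
  then have "emeasure (site_law p) {a. fst a \<in> X \<and> fst (snd a) \<in> A} =
      emeasure (measure_pmf (bernoulli_pmf p) \<Otimes>\<^sub>M (D \<Otimes>\<^sub>M U)) (X \<times> (A \<times> space U))"
    by (simp add: site_law_def D_def U_def)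
  also have "\<dots> = emeasure (measure_pmf (bernoulli_pmf p)) X * emeasure (D \<Otimes>\<^sub>M U) (A \<times> space U)"
    using assms by (intro DU.emeasure_pair_measure_Times) (auto simp: D_def)
  also have "emeasure (D \<Otimes>\<^sub>M U) (A \<times> space U) = emeasure D A"
    using assms by (subst U.emeasure_pair_measure_Times) (auto simp: D_def U.emeasure_space_1)
  finally show ?thesis
    by (simp add: D_def)
qed

lemma measurable_direction_list [measurable]:
  "(\<lambda>a. map (fst (snd a)) [0..<n]) \<in> measurable (site_law p :: 'd site_data measure) (count_space UNIV)"
proof (induction n)
  case (Suc n)
  note Suc [measurable]
  show ?case
    unfolding upt_Suc_append[OF le0] map_append list.map by measurable
qed simp

text \<open>The first \<open>n\<close> directions are uniform on \<open>valency ^ n\<close> lists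
  and independent of the car indicator, so probabilities of walk events are counts; \<open>X\<close>
  leaves room to impose a car.\<close>

lemma measure_directions:
  fixes L :: "('d \<times> bool) list set"
  assumes L: "L \<subseteq> {l. length l = n}"
  shows "measure (site_law p) {a. fst a \<in> X \<and> map (fst (snd a)) [0..<n] \<in> L} =
    measure (measure_pmf (bernoulli_pmf p)) X * card L / valency TYPE('d) ^ n"
proof -
  define D where "D = Pi\<^sub>M UNIV (\<lambda>_::nat. measure_pmf (pmf_of_set (UNIV :: ('d \<times> bool) set)))"
  interpret D: product_prob_space "\<lambda>_::nat. measure_pmf (pmf_of_set (UNIV :: ('d \<times> bool) set))" UNIV
    by (simp add: product_prob_space_def product_prob_space_axioms_def product_sigma_finite_def
        prob_space_measure_pmf prob_space_imp_sigma_finite)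
  have finL: "finite L"
    by (rule finite_subset[OF L]) (use finite_lists_length_eq[of "UNIV :: ('d \<times> bool) set" n] in simp)
  have single: "{\<sigma>. map \<sigma> [0..<n] = l} \<in> sets D \<and> emeasure D {\<sigma>. map \<sigma> [0..<n] = l} = ennreal (1 / valency TYPE('d) ^ n)"
    if "l \<in> L" for l
  proof -
    have eq: "{\<sigma>. map \<sigma> [0..<n] = l} = {\<sigma> \<in> space D. \<forall>i\<in>{..<n}. \<sigma> i \<in> {l ! i}}"
      using that L by (auto simp: D_def space_PiM list_eq_iff_nth_eq)
    have "emeasure D {\<sigma> \<in> space D. \<forall>i\<in>{..<n}. \<sigma> i \<in> {l ! i}}
       = (\<Prod>i\<in>{..<n}. emeasure (measure_pmf (pmf_of_set (UNIV :: ('d \<times> bool) set))) {l ! i})"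
      unfolding D_def by (rule D.emeasure_PiM_Collect) auto
    also have "\<dots> = ennreal (1 / valency TYPE('d) ^ n)"
      by (simp add: emeasure_pmf_single valency_def ennreal_power power_one_over del: card_prod)
    finally show ?thesis
      unfolding eq by (auto simp: D_def intro!: sets_PiM_I_finite)
  qed
  define A where "A = (\<Union>l\<in>L. {\<sigma>. map \<sigma> [0..<n] = l})"
  have "emeasure D A = (\<Sum>l\<in>L. emeasure D {\<sigma>. map \<sigma> [0..<n] = l})"
    unfolding A_def using finL single
    by (intro sum_emeasure[symmetric]) (auto simp: disjoint_family_on_def)
  also have "\<dots> = ennreal (card L / valency TYPE('d) ^ n)"
    using single valency_pos[where 'd='d] by (simp add: ennreal_of_nat_eq_real_of_nat ennreal_mult[symmetric])
  finally have "emeasure D A = ennreal (card L / valency TYPE('d) ^ n)" .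
  moreover have "A \<in> sets D"
    unfolding A_def using single finL by auto
  ultimately have "emeasure (site_law p) {a. fst a \<in> X \<and> fst (snd a) \<in> A}
      = emeasure (measure_pmf (bernoulli_pmf p)) X * ennreal (card L / valency TYPE('d) ^ n)"
    using emeasure_site_law_Times[of A X] by (simp add: D_def)
  also have "{a. fst a \<in> X \<and> fst (snd a) \<in> A} = {a. fst a \<in> X \<and> map (fst (snd a)) [0..<n] \<in> L}"
    by (auto simp: A_def)
  finally show ?thesis
    using valency_pos[where 'd='d]
    by (simp add: measure_def enn2real_mult)
qed

end

section \<open>Random walk avoiding a fixed set of sites\<close>

primrec avoids :: "('d::finite) site set \<Rightarrow> 'd site \<Rightarrow> ('d \<times> bool) list \<Rightarrow> bool" where
  "avoids S x [] \<longleftrightarrow> True"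
| "avoids S x (e # l) \<longleftrightarrow> x + step_vec e \<notin> S \<and> avoids S (x + step_vec e) l"

lemma avoids_append:
  "avoids S x (l @ [e]) \<longleftrightarrow> avoids S x l \<and> x + sum_list (map step_vec l) + step_vec e \<notin> S"
  by (induction l arbitrary: x) (auto simp: add.assoc)

lemma avoids_map:
  "avoids S x (map \<sigma> [0..<n]) \<longleftrightarrow> (\<forall>k<n. x + (\<Sum>s<Suc k. step_vec (\<sigma> s)) \<notin> S)"
proof (induction n)
  case (Suc n)
  have "sum_list (map step_vec (map \<sigma> [0..<n])) = (\<Sum>s<n. step_vec (\<sigma> s))"
    by (simp add: interv_sum_list_conv_sum_set_nat atLeast0LessThan comp_def)
  then show ?case
    using Suc by (auto simp: avoids_append less_Suc_eq add.assoc)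
qed simp

text \<open>The probability that simple random walk from \<open>x\<close> avoids \<open>S\<close> at
  times 1 to \<open>n\<close>, by first-step analysis. The start itself is not tested. No walk
  occurs in it, so it can be integrated over a random \<open>S\<close>.\<close>

primrec avoid_prob :: "('d::finite) site set \<Rightarrow> nat \<Rightarrow> 'd site \<Rightarrow> real" where
  "avoid_prob S 0 x = 1"
| "avoid_prob S (Suc n) x =
     (\<Sum>e\<in>UNIV. if x + step_vec e \<in> S then 0 else avoid_prob S n (x + step_vec e)) / valency TYPE('d)"

lemma avoid_prob_nonneg: "0 \<le> avoid_prob S n x"
  by (induction n arbitrary: x) (auto intro!: divide_nonneg_pos sum_nonneg valency_pos)

lemma avoid_prob_decseq: "avoid_prob S (Suc n) x \<le> avoid_prob S n x"
proof (induction n arbitrary: x)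
  case 0
  have "(\<Sum>e\<in>UNIV. if x + step_vec e \<in> S then 0 else 1) \<le> (\<Sum>e\<in>(UNIV :: ('a \<times> bool) set). (1::real))"
    by (intro sum_mono) auto
  then show ?case
    by (simp add: valency_def divide_simps cong: if_cong)
next
  case (Suc n)
  have "(\<Sum>e\<in>UNIV. if x + step_vec e \<in> S then 0 else avoid_prob S (Suc n) (x + step_vec e))
      \<le> (\<Sum>e\<in>UNIV. if x + step_vec e \<in> S then 0 else avoid_prob S n (x + step_vec e))"
    using Suc by (intro sum_mono) (auto simp del: avoid_prob.simps)
  then show ?case
    unfolding avoid_prob.simps(2)[of S "Suc n"] avoid_prob.simps(2)[of S n x]
    by (intro divide_right_mono) (auto simp: valency_def)
qed

lemma avoid_prob_le_1: "avoid_prob S n x \<le> 1"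
proof (induction n)
  case (Suc n)
  then show ?case
    using avoid_prob_decseq order_trans by blast
qed simp

lemma avoid_prob_translate: "avoid_prob {v. v + y \<in> S} n x = avoid_prob S n (x + y)"
  by (induction n arbitrary: x) (simp_all add: algebra_simps cong: if_cong)

lemma card_avoids:
  "card {l. length l = n \<and> avoids S x l} = avoid_prob S n x * valency TYPE('d) ^ n"
  for x :: "('d::finite) site"
proof (induction n arbitrary: x)
  case 0
  have "{l. length l = 0 \<and> avoids S x l} = {[]}"
    by auto
  then show ?case
    by (simp only:) simp
next
  case (Suc n)
  define L where "L x = {l. length l = n \<and> avoids S x l}" for x
  have fin: "finite (L x)" for x
    using finite_lists_length_eq[of "UNIV :: ('d \<times> bool) set" n]
    by (rule rev_finite_subset) (auto simp: L_def)
  have "{l. length l = Suc n \<and> avoids S x l}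
      = (\<Union>e\<in>UNIV. (#) e ` (if x + step_vec e \<in> S then {} else L (x + step_vec e)))"
  proof (intro set_eqI iffI)
    fix l assume "l \<in> {l. length l = Suc n \<and> avoids S x l}"
    then obtain e l' where "l = e # l'" "length l' = n" "x + step_vec e \<notin> S" "avoids S (x + step_vec e) l'"
      by (cases l) auto
    then show "l \<in> (\<Union>e\<in>UNIV. (#) e ` (if x + step_vec e \<in> S then {} else L (x + step_vec e)))"
      by (intro UN_I[of e]) (simp_all add: L_def)
  qed (auto simp: L_def split: if_splits)
  also have "card \<dots> = (\<Sum>e\<in>UNIV. card ((#) e ` (if x + step_vec e \<in> S then {} else L (x + step_vec e))))"
    using fin by (intro card_UN_disjoint) auto
  also have "\<dots> = (\<Sum>e\<in>UNIV. if x + step_vec e \<in> S then 0 else card (L (x + step_vec e)))"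
    by (intro sum.cong) (auto simp: card_image)
  also have "real \<dots> = (\<Sum>e\<in>UNIV. (if x + step_vec e \<in> S then 0 else avoid_prob S n (x + step_vec e)) * valency TYPE('d) ^ n)"
    using Suc by (auto simp: L_def intro!: sum.cong)
  also have "\<dots> = avoid_prob S (Suc n) x * valency TYPE('d) ^ Suc n"
    using valency_pos[where 'd='d] by (simp add: sum_distrib_right[symmetric])
  finally show ?case .
qed

definition escape_prob :: "('d::finite) site set \<Rightarrow> 'd site \<Rightarrow> real" where
  "escape_prob S x = lim (\<lambda>n. avoid_prob S n x)"

lemma escape_prob_LIMSEQ: "(\<lambda>n. avoid_prob S n x) \<longlonglongrightarrow> escape_prob S x"
proof -
  have "decseq (\<lambda>n. avoid_prob S n x)"
    by (intro decseq_SucI avoid_prob_decseq)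
  then obtain L where "(\<lambda>n. avoid_prob S n x) \<longlonglongrightarrow> L"
    using decseq_convergent[of "\<lambda>n. avoid_prob S n x" 0] avoid_prob_nonneg by metis
  then show ?thesis
    unfolding escape_prob_def using limI by metis
qed

lemma escape_prob_nonneg: "0 \<le> escape_prob S x"
  by (rule LIMSEQ_le_const[OF escape_prob_LIMSEQ]) (auto intro: avoid_prob_nonneg)

lemma escape_prob_le_1: "escape_prob S x \<le> 1"
  by (rule LIMSEQ_le_const2[OF escape_prob_LIMSEQ]) (auto intro: avoid_prob_le_1)

lemma abs_escape_prob_le_1: "\<bar>escape_prob S x\<bar> \<le> 1"
  using escape_prob_nonneg[of S x] escape_prob_le_1[of S x] by simp

lemma escape_prob_translate: "escape_prob {v. v + y \<in> S} x = escape_prob S (x + y)"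
  by (simp add: escape_prob_def avoid_prob_translate)

text \<open>Harmonicity, except that neighbours in \<open>S\<close> count as 0, whereas their own
  escape probabilities may be positive because the start of a walk is not tested.\<close>

lemma escape_prob_step:
  "escape_prob S x * valency TYPE('d) =
    (\<Sum>e\<in>UNIV. if x + step_vec e \<in> S then 0 else escape_prob S (x + step_vec e))"
  for x :: "('d::finite) site"
proof -
  have "(\<lambda>n. avoid_prob S (Suc n) x * valency TYPE('d)) \<longlonglongrightarrow> escape_prob S x * valency TYPE('d)"
    using escape_prob_LIMSEQ by (intro tendsto_mult_right LIMSEQ_Suc)
  moreover have "(\<lambda>n. avoid_prob S (Suc n) x * valency TYPE('d)) \<longlonglongrightarrow>
     (\<Sum>e\<in>UNIV. if x + step_vec e \<in> S then 0 else escape_prob S (x + step_vec e))"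
    using valency_pos[where 'd='d] by (auto intro!: tendsto_sum escape_prob_LIMSEQ)
  ultimately show ?thesis
    by (rule LIMSEQ_unique)
qed

section \<open>Escape from the forever vacant spots\<close>

context parking
begin

definition vacant_escape :: "'d config \<Rightarrow> 'd site \<Rightarrow> real" where
  "vacant_escape \<omega> x = escape_prob (forever_vacant \<omega>) x"

lemma measurable_vacant_escape [measurable]: "(\<lambda>\<omega>. vacant_escape \<omega> x) \<in> borel_measurable P"
proof (rule borel_measurable_LIMSEQ_real)
  show "(\<lambda>n. avoid_prob (forever_vacant \<omega>) n x) \<longlonglongrightarrow> vacant_escape \<omega> x" for \<omega>
    unfolding vacant_escape_def by (rule escape_prob_LIMSEQ)
  show "(\<lambda>\<omega>. avoid_prob (forever_vacant \<omega>) n x) \<in> borel_measurable P" for n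
  proof (induction n arbitrary: x)
    case (Suc n)
    note Suc [measurable]
    show ?case
      unfolding avoid_prob.simps by measurable
  qed simp
qed

lemma vacant_escape_translate: "no_ties \<omega> \<Longrightarrow> vacant_escape (translate y \<omega>) x = vacant_escape \<omega> (x + y)"
proof -
  assume "no_ties \<omega>"
  then have "forever_vacant (translate y \<omega>) = {v. v + y \<in> forever_vacant \<omega>}"
    by (auto simp: forever_vacant_translate)
  then show ?thesis
    by (simp add: vacant_escape_def escape_prob_translate)
qed

lemma integrable_bounded:
  fixes f :: "'d config \<Rightarrow> real"
  assumes [measurable]: "f \<in> borel_measurable P" and "\<And>\<omega>. \<bar>f \<omega>\<bar> \<le> c"
  shows "integrable P f"
  by (rule integrable_const_bound[where B = c]) (auto simp: assms)

lemma integral_translate: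
  fixes f :: "'d config \<Rightarrow> real"
  assumes [measurable]: "f \<in> borel_measurable P" "h \<in> borel_measurable P"
    and "\<And>\<omega>. no_ties \<omega> \<Longrightarrow> h \<omega> = f (translate x \<omega>)"
  shows "expectation h = expectation f"
proof -
  have [measurable]: "(\<lambda>\<omega>. f (translate x \<omega>)) \<in> borel_measurable P"
    using measurable_translate by (rule measurable_compose) simp
  have "expectation h = (\<integral>\<omega>. f (translate x \<omega>) \<partial>P)"
    by (intro integral_cong_AE eventually_mono[OF AE_no_ties]) (auto simp: assms(3))
  also have "\<dots> = (\<integral>\<omega>. f \<omega> \<partial>distr P P (translate x))"
    by (intro integral_distr[symmetric] measurable_translate) simp
  finally show ?thesis
    by (simp only: distr_translate)
qed

text \<open>Poincare recurrence for the environment seen from the walk. \<open>h\<close> is the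
  escape probability cut off on the vacant set. Averaging \<open>escape_prob_step\<close> and using
  stationarity gives both the same expectation; as \<open>h\<close> is the smaller one, they agree
  almost surely.\<close>

lemma AE_escape_0_on_vacant: "AE \<omega> in P. x \<in> forever_vacant \<omega> \<longrightarrow> vacant_escape \<omega> x = 0"
proof -
  define h where "h x \<omega> = (if x \<in> forever_vacant \<omega> then 0 else vacant_escape \<omega> x)" for x \<omega>
  have h [measurable]: "h x \<in> borel_measurable P" for x
    unfolding h_def by measurable
  have bound: "\<bar>vacant_escape \<omega> x\<bar> \<le> 1" "\<bar>h x \<omega>\<bar> \<le> 1" for x \<omega>
    using abs_escape_prob_le_1 by (auto simp: vacant_escape_def h_def)
  have int: "integrable P (\<lambda>\<omega>. vacant_escape \<omega> x)" "integrable P (h x)" for x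
    using bound by (auto intro!: integrable_bounded[where c = 1])
  have h_eq: "expectation (h y) = expectation (h x)" for x y
    by (rule integral_translate[where x = "y - x"]) (auto simp: h_def forever_vacant_translate vacant_escape_translate)
  have "expectation (\<lambda>\<omega>. vacant_escape \<omega> x) * valency TYPE('d) = expectation (\<lambda>\<omega>. vacant_escape \<omega> x * valency TYPE('d))"
    by simp
  also have "\<dots> = expectation (\<lambda>\<omega>. \<Sum>e\<in>UNIV. h (x + step_vec e) \<omega>)"
    by (simp only: vacant_escape_def escape_prob_step h_def)
  also have "\<dots> = (\<Sum>e\<in>UNIV. expectation (h (x + step_vec e)))"
    by (intro Bochner_Integration.integral_sum int)
  also have "\<dots> = (\<Sum>e\<in>(UNIV :: ('d \<times> bool) set). expectation (h x))"
    by (intro sum.cong refl h_eq)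
  also have "\<dots> = expectation (h x) * valency TYPE('d)"
    by (simp add: valency_def)
  finally have "expectation (\<lambda>\<omega>. vacant_escape \<omega> x) = expectation (h x)"
    using valency_pos[where 'd='d] by simp
  then have "expectation (\<lambda>\<omega>. vacant_escape \<omega> x - h x \<omega>) = 0"
    using int by simp
  moreover have "AE \<omega> in P. 0 \<le> vacant_escape \<omega> x - h x \<omega>"
    by (simp add: h_def vacant_escape_def escape_prob_nonneg)
  ultimately have "AE \<omega> in P. vacant_escape \<omega> x - h x \<omega> = 0"
    using integral_nonneg_eq_0_iff_AE[OF Bochner_Integration.integrable_diff[OF int]] by blast
  then show ?thesis
    by (rule eventually_mono) (auto simp: h_def)
qed

text \<open>The escape probabilities form a stationary harmonic function, so the variance of its increments vanishes.\<close>

lemma AE_escape_step: "AE \<omega> in P. \<forall>e. vacant_escape \<omega> (step_vec e) = vacant_escape \<omega> 0"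
proof -
  have bound: "\<bar>vacant_escape \<omega> x\<bar> \<le> 1" for x \<omega>
    using abs_escape_prob_le_1 by (auto simp: vacant_escape_def)
  have bound2: "\<bar>vacant_escape \<omega> x * vacant_escape \<omega> y\<bar> \<le> 1" for x y \<omega>
    using mult_mono[OF bound bound] by (simp add: abs_mult)
  have int: "integrable P (\<lambda>\<omega>. vacant_escape \<omega> x * vacant_escape \<omega> y)" for x y
    using bound2 by (intro integrable_bounded[where c = 1]) auto
  define m where "m = expectation (\<lambda>\<omega>. vacant_escape \<omega> 0 * vacant_escape \<omega> 0)"
  have m: "expectation (\<lambda>\<omega>. vacant_escape \<omega> x * vacant_escape \<omega> x) = m" for x
    unfolding m_def by (rule integral_translate[where x = x]) (auto simp: vacant_escape_translate)
  \<comment> \<open>The terms dropped in \<open>escape_prob_step\<close> vanish almost surely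
    anyway, so the relation becomes genuine harmonicity.\<close>
  have "AE \<omega> in P. \<forall>e. step_vec e \<in> forever_vacant \<omega> \<longrightarrow> vacant_escape \<omega> (step_vec e) = 0"
    unfolding AE_all_countable using AE_escape_0_on_vacant by blast
  then have harm: "AE \<omega> in P. vacant_escape \<omega> 0 * valency TYPE('d) = (\<Sum>e\<in>UNIV. vacant_escape \<omega> (step_vec e))"
  proof (rule eventually_mono)
    fix \<omega> assume *: "\<forall>e. step_vec e \<in> forever_vacant \<omega> \<longrightarrow> vacant_escape \<omega> (step_vec e) = 0"
    have "vacant_escape \<omega> 0 * valency TYPE('d) = (\<Sum>e\<in>UNIV. if step_vec e \<in> forever_vacant \<omega> then 0 else vacant_escape \<omega> (step_vec e))"
      unfolding vacant_escape_def using escape_prob_step[of "forever_vacant \<omega>" 0] by (simp cong: if_cong)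
    also have "\<dots> = (\<Sum>e\<in>UNIV. vacant_escape \<omega> (step_vec e))"
      using * by (intro sum.cong) auto
    finally show "vacant_escape \<omega> 0 * valency TYPE('d) = (\<Sum>e\<in>UNIV. vacant_escape \<omega> (step_vec e))" .
  qed
  \<comment> \<open>Multiplying harmonicity by the value at 0 shows that the cross moments sum to
    \<open>m * valency\<close>. By stationarity every second moment is \<open>m\<close>, so the
    squared increments sum to 0 in expectation.\<close>
  have "expectation (\<lambda>\<omega>. \<Sum>e\<in>UNIV. vacant_escape \<omega> 0 * vacant_escape \<omega> (step_vec e)) = expectation (\<lambda>\<omega>. vacant_escape \<omega> 0 * vacant_escape \<omega> 0 * valency TYPE('d))"
    using harm by (intro integral_cong_AE) (auto elim!: eventually_mono simp: sum_distrib_left[symmetric])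
  then have cross: "(\<Sum>e\<in>UNIV. expectation (\<lambda>\<omega>. vacant_escape \<omega> 0 * vacant_escape \<omega> (step_vec e))) = m * valency TYPE('d)"
    using int by (simp add: m_def Bochner_Integration.integral_sum)
  have sq: "(vacant_escape \<omega> (step_vec e) - vacant_escape \<omega> 0)\<^sup>2
      = vacant_escape \<omega> (step_vec e) * vacant_escape \<omega> (step_vec e) - 2 * (vacant_escape \<omega> 0 * vacant_escape \<omega> (step_vec e)) + vacant_escape \<omega> 0 * vacant_escape \<omega> 0" for \<omega> e
    by (simp add: power2_eq_square algebra_simps)
  have intsq: "integrable P (\<lambda>\<omega>. (vacant_escape \<omega> (step_vec e) - vacant_escape \<omega> 0)\<^sup>2)" for e
    unfolding sq using int by auto
  have "expectation (\<lambda>\<omega>. (vacant_escape \<omega> (step_vec e) - vacant_escape \<omega> 0)\<^sup>2)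
      = m - 2 * expectation (\<lambda>\<omega>. vacant_escape \<omega> 0 * vacant_escape \<omega> (step_vec e)) + m" for e
    unfolding sq using int m by simp
  then have "(\<Sum>e\<in>UNIV. expectation (\<lambda>\<omega>. (vacant_escape \<omega> (step_vec e) - vacant_escape \<omega> 0)\<^sup>2)) = 0"
    using cross by (simp add: sum.distrib sum_subtractf sum_distrib_left[symmetric] valency_def)
  then have "\<forall>e\<in>UNIV. expectation (\<lambda>\<omega>. (vacant_escape \<omega> (step_vec e) - vacant_escape \<omega> 0)\<^sup>2) = 0"
    by (rule iffD1[OF sum_nonneg_eq_0_iff, rotated 2]) simp_all
  then have "expectation (\<lambda>\<omega>. (vacant_escape \<omega> (step_vec e) - vacant_escape \<omega> 0)\<^sup>2) = 0" for e
    by blast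
  then have "AE \<omega> in P. (vacant_escape \<omega> (step_vec e) - vacant_escape \<omega> 0)\<^sup>2 = 0" for e
    using intsq by (subst (asm) integral_nonneg_eq_0_iff_AE) auto
  then show ?thesis
    by (simp add: AE_all_countable)
qed

text \<open>The datum \<open>a\<close> is independent of \<open>\<omega>\<close>, so its walk avoids
  the vacancies for \<open>n\<close> steps with probability exactly \<open>avoid_prob\<close>. The
  limit is constant in the starting site and zero at a vacant one.\<close>

lemma AE_walk_hits_vacant:
  assumes "prob {\<omega>. 0 \<in> forever_vacant \<omega>} > 0"
  shows "AE \<omega> in P. AE a in site_law p. \<exists>t. (\<Sum>s<Suc t. step_vec (fst (snd a) s)) \<in> forever_vacant \<omega>"
proof -
  have "AE \<omega> in P. \<forall>x. x \<in> forever_vacant \<omega> \<longrightarrow> vacant_escape \<omega> x = 0"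
    unfolding AE_all_countable using AE_escape_0_on_vacant by blast
  moreover have "AE \<omega> in P. \<forall>x. \<forall>e. vacant_escape (translate x \<omega>) (step_vec e) = vacant_escape (translate x \<omega>) 0"
    unfolding AE_all_countable
    using AE_translate[OF AE_escape_step] by (simp add: AE_all_countable)
  moreover have "AE \<omega> in P. forever_vacant \<omega> \<noteq> {}"
    using assms by (rule AE_forever_vacant_nonempty)
  moreover have "AE \<omega> in P. no_ties \<omega>"
    by (rule AE_no_ties)
  ultimately show ?thesis
  proof eventually_elim
    case (elim \<omega>)
    have step: "vacant_escape \<omega> (x + step_vec e) = vacant_escape \<omega> x" for x e
      using elim(2) vacant_escape_translate[OF elim(4)] by (metis add.commute add_0)
    obtain y where "y \<in> forever_vacant \<omega>"
      using elim(3) by blast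
    then have "vacant_escape \<omega> y = 0"
      using elim(1) by blast
    then have "vacant_escape \<omega> 0 = 0"
      using site_connected[of "\<lambda>x. vacant_escape \<omega> x = 0" y 0] step by simp
    then have lim: "(\<lambda>n. avoid_prob (forever_vacant \<omega>) n 0) \<longlonglongrightarrow> 0"
      using escape_prob_LIMSEQ[of "forever_vacant \<omega>" 0] by (simp add: vacant_escape_def)
    define B where "B = {a :: 'd site_data. \<forall>t. (\<Sum>s<Suc t. step_vec (fst (snd a) s)) \<notin> forever_vacant \<omega>}"
    define L where "L n = {l. length l = n \<and> avoids (forever_vacant \<omega>) 0 l}" for n
    interpret S: prob_space "site_law p :: 'd site_data measure"
      by (rule prob_space_site_law)
    have B: "B \<in> S.events"
    proof -
      have [measurable]: "(\<lambda>a :: 'd site_data. \<Sum>s<t. step_vec (fst (snd a) s)) \<in> measurable (site_law p) (count_space UNIV)" for t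
      proof (induction t)
        case (Suc t)
        note Suc [measurable]
        show ?case
          unfolding sum.lessThan_Suc by measurable
      qed simp
      have "Measurable.pred (site_law p) (\<lambda>a :: 'd site_data. a \<in> B)"
        unfolding B_def mem_Collect_eq by measurable
      then show ?thesis
        by (simp add: pred_def)
    qed
    have "S.prob B \<le> avoid_prob (forever_vacant \<omega>) n 0" for n
    proof -
      have "S.prob B \<le> S.prob {a. fst a \<in> UNIV \<and> map (fst (snd a)) [0..<n] \<in> L n}"
      proof (rule S.finite_measure_mono)
        have "Measurable.pred (site_law p) (\<lambda>a :: 'd site_data. fst a \<in> UNIV \<and> map (fst (snd a)) [0..<n] \<in> L n)"
          by measurable
        then show "{a. fst a \<in> UNIV \<and> map (fst (snd a)) [0..<n] \<in> L n} \<in> S.events"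
          by (simp add: pred_def)
      qed (auto simp: B_def L_def avoids_map)
      also have "\<dots> = avoid_prob (forever_vacant \<omega>) n 0"
        using valency_pos[where 'd='d]
        by (subst measure_directions) (auto simp: L_def card_avoids)
      finally show ?thesis .
    qed
    then have "S.prob B \<le> 0"
      by (intro LIMSEQ_le_const[OF lim]) auto
    then have "S.prob B = 0"
      using measure_nonneg[of "site_law p" B] by linarith
    then have "AE a in site_law p. a \<notin> B"
      using S.prob_eq_0[OF B] by blast
    then show ?case
      by (rule eventually_mono) (auto simp: B_def)
  qed
qed

text \<open>Data with a car have positive probability, so an almost sure property can be
  instantiated at one of them.\<close>

lemma ex_site_has_car:
  assumes "0 < p" "AE a in site_law p. R (a :: 'd site_data)"
  shows "\<exists>a. fst a \<and> R a"
proof (rule ccontr)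
  assume "\<nexists>a. fst a \<and> R a"
  then have "AE a in site_law p. \<not> fst (a :: 'd site_data)"
    using assms(2) by (auto elim!: eventually_mono)
  then have "emeasure (site_law p) {a :: 'd site_data. fst a} = 0"
    using measurable_fst_site_law[of p, where 'a = 'd]
    by (subst (asm) AE_iff_measurable[OF _ refl]) (auto simp: pred_def)
  then show False
    using emeasure_site_has_car assms(1) by simp
qed

lemma no_survivors:
  assumes "prob {\<omega>. 0 \<in> forever_vacant \<omega>} > 0"
  shows "prob {\<omega>. \<forall>t. unparked \<omega> t 0} = 0"
proof (cases "p = 0")
  case True
  have "prob {\<omega>. \<forall>t. unparked \<omega> t 0} \<le> prob {\<omega>. has_car \<omega> 0}"
    by (rule finite_measure_mono) (auto simp: unparked_def intro!: sets_Collect)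
  then show ?thesis
    using True prob_has_car[of 0] measure_nonneg[of P] by (simp add: order_antisym)
next
  case False
  then have "0 < p"
    using p_nonneg by simp
  define B where "B = {\<omega> :: 'd config. \<forall>t. unparked \<omega> t 0}"
  have [measurable]: "B \<in> events"
    unfolding B_def by (rule sets_Collect) measurable
  \<comment> \<open>The survival probability given the data off the origin. It does not depend on
    \<open>\<xi> 0\<close>, so it may be evaluated in configurations that have a car at the
    origin.\<close>
  define h where "h \<xi> = (\<integral>\<^sup>+a. indicator B (\<xi>(0 := a)) \<partial>site_law p)" for \<xi>
  have "AE \<omega> in P. has_car \<omega> 0 \<longrightarrow> h \<omega> = 0"
    using AE_walk_hits_vacant[OF assms] AE_no_ties
  proof eventually_elim
    case (elim \<xi>)
    show ?case
    proof
      assume car: "has_car \<xi> 0"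
      have "AE a in site_law p. indicator B (\<xi>(0 := a)) = (0::ennreal)"
        using elim(1)
      proof (rule eventually_mono)
        fix a :: "'d site_data" assume "\<exists>t. (\<Sum>s<Suc t. step_vec (fst (snd a) s)) \<in> forever_vacant \<xi>"
        then obtain t where t: "(\<Sum>s<Suc t. step_vec (fst (snd a) s)) \<in> forever_vacant \<xi>"
          by blast
        have "\<xi>(0 := a) \<notin> B"
        proof
          assume "\<xi>(0 := a) \<in> B"
          then have unp: "unparked (\<xi>(0 := a)) t 0" for t
            by (simp add: B_def)
          define v where "v = walk (\<xi>(0 := a)) 0 (Suc t)"
          have "v \<in> forever_vacant \<xi>"
            using t by (simp add: v_def walk_def direction_def)
          then have "vacant \<xi> (Suc t) v"
            unfolding forever_vacant_def by blast
          \<comment> \<open>Here \<open>\<xi>\<close> is the larger configuration: the car of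
            \<open>\<xi>(0 := a)\<close> at the origin never parks and is placed in
            \<open>N\<close>, so the change of its walk is harmless.\<close>
          then have "vacant (\<xi>(0 := a)) (Suc t) v"
            using parking_mono[of \<xi> "\<xi>(0 := a)" "{0}" "Suc t"] elim(2) car unp
            by (auto simp: has_car_def split: if_splits)
          then have "arriving (\<xi>(0 := a)) t v = {}"
            by (simp add: vacant_Suc)
          then show False
            using arrivingI[OF unp, of t v] v_def by auto
        qed
        then show "indicator B (\<xi>(0 := a)) = (0::ennreal)"
          by simp
      qed
      then show "h \<xi> = 0"
        unfolding h_def by (rule nn_integral_zero')
    qed
  qed
  \<comment> \<open>Fixing one datum with a car satisfies the premise, and \<open>h\<close> does not
    notice the replacement.\<close>
  from AE_update[OF this, of 0] obtain a where "fst a" "AE \<xi> in P. has_car (\<xi>(0 := a)) 0 \<longrightarrow> h (\<xi>(0 := a)) = 0"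
    using ex_site_has_car[OF \<open>0 < p\<close>] by blast
  then have "AE \<xi> in P. h \<xi> = 0"
    by (simp add: has_car_def h_def)
  moreover have "(\<integral>\<^sup>+\<omega>. indicator B \<omega> \<partial>P) = (\<integral>\<^sup>+\<omega>. h \<omega> \<partial>P)"
    unfolding h_def by (rule nn_integral_update) simp
  ultimately have "emeasure P B = 0"
    by (simp add: nn_integral_zero')
  then show ?thesis
    by (simp add: B_def measure_def)
qed

lemma prob_forever_vacant_eq_0:
  assumes "1 / 2 \<le> p"
  shows "prob {\<omega>. v \<in> forever_vacant \<omega>} = 0"
proof (rule ccontr)
  assume "prob {\<omega>. v \<in> forever_vacant \<omega>} \<noteq> 0"
  moreover have eq: "prob {\<omega>. v \<in> forever_vacant \<omega>} = prob {\<omega>. 0 \<in> forever_vacant \<omega>}"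
    using emeasure_forever_vacant[of v 0] by (simp add: measure_def)
  ultimately have pos: "prob {\<omega>. 0 \<in> forever_vacant \<omega>} > 0"
    by (simp add: measure_nonneg less_le)
  then show False
    using no_survivors prob_survive_forever_vacant[of 0] assms by simp
qed

end

subsection \<open>Recurrence\<close>

text \<open>Cesaro averaging: the first \<open>N\<close> terms contribute a constant, the others at
  most \<open>c / 2\<close> each.\<close>

lemma sum_in_smallo_of_tendsto_0:
  fixes a :: "nat \<Rightarrow> real"
  assumes "a \<longlonglongrightarrow> 0"
  shows "(\<lambda>n. \<Sum>s<n. a s) \<in> o(\<lambda>n. real n)"
proof (rule landau_o.smallI)
  fix c :: real assume "0 < c"
  then obtain N where N: "\<And>s. s \<ge> N \<Longrightarrow> \<bar>a s\<bar> \<le> c / 2"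
    using LIMSEQ_D[OF assms, of "c / 2"] by (auto intro: less_imp_le)
  define M where "M = (\<Sum>s<N. \<bar>a s\<bar>)"
  have bound: "\<bar>\<Sum>s<n. a s\<bar> \<le> M + c / 2 * real n" for n
  proof -
    have "\<bar>\<Sum>s<n. a s\<bar> \<le> (\<Sum>s<n. \<bar>a s\<bar>)"
      by (rule sum_abs)
    also have "\<dots> \<le> (\<Sum>s<n. (if s < N then \<bar>a s\<bar> else 0) + c / 2)"
      using N \<open>0 < c\<close> by (intro sum_mono) (auto simp: not_less)
    also have "\<dots> = (\<Sum>s<n. if s < N then \<bar>a s\<bar> else 0) + c / 2 * real n"
      by (simp add: sum.distrib)
    also have "(\<Sum>s<n. if s < N then \<bar>a s\<bar> else 0) = (\<Sum>s\<in>{..<n} \<inter> {..<N}. \<bar>a s\<bar>)"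
      by (simp add: sum.inter_restrict)
    also have "\<dots> \<le> M"
      unfolding M_def by (rule sum_mono2) auto
    finally show ?thesis
      by simp
  qed
  have "\<forall>\<^sub>F n in sequentially. M \<le> c / 2 * real n"
    using \<open>0 < c\<close> by real_asymp
  then show "\<forall>\<^sub>F n in sequentially. norm (\<Sum>s<n. a s) \<le> c * norm (real n)"
  proof eventually_elim
    case (elim n)
    then show ?case
      using bound[of n] by (simp add: field_simps)
  qed
qed

lemma measurable_total_visits_infinite:
  "Measurable.pred (parking_space p) (\<lambda>\<omega>. total_visits \<omega> v = \<infinity>)"
proof -
  have *: "total_visits \<omega> v = \<infinity> \<longleftrightarrow> (\<forall>T. \<exists>t. T \<le> t \<and> (\<exists>u. u \<in> arriving \<omega> t v))" for \<omega> :: "'a config"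
  proof -
    have "total_visits \<omega> v = \<infinity> \<longleftrightarrow> \<not> total_visits \<omega> v < \<infinity>"
      by (simp add: less_top[symmetric])
    then have "total_visits \<omega> v = \<infinity> \<longleftrightarrow> \<not> (\<exists>T. \<forall>t\<ge>T. arriving \<omega> t v = {})"
      unfolding total_visits_finite_iff .
    then show ?thesis
      by blast
  qed
  show ?thesis
    unfolding * by measurable
qed

context parking
begin

text \<open>The error term is exactly the sum of the vacancy probabilities up to time
  \<open>t\<close>, and these tend to 0 when no spot stays vacant.\<close>

lemma expectation_visits_asymp:
  assumes "1 / 2 \<le> p"
  shows "(\<lambda>t. (\<integral>\<omega>. real (visits \<omega> v t) \<partial>P) - (2 * p - 1) * real t) \<in> o(\<lambda>t. real t)"
proof -
  have "(\<integral>\<omega>. real (visits \<omega> v t) \<partial>P) - (2 * p - 1) * real t = (\<Sum>s<t. prob {\<omega>. vacant \<omega> s v})" for t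
  proof -
    have "prob {\<omega>. unparked \<omega> s v} = prob {\<omega>. vacant \<omega> s v} + (2 * p - 1)" for s
      using prob_unparked_vacant[of s v] by simp
    then show ?thesis
      by (simp add: expectation_visits sum.distrib)
  qed
  moreover have "(\<lambda>s. prob {\<omega>. vacant \<omega> s v}) \<longlonglongrightarrow> 0"
    using prob_vacant_LIMSEQ[of v] prob_forever_vacant_eq_0[OF assms] by simp
  ultimately show ?thesis
    by (simp add: sum_in_smallo_of_tendsto_0)
qed

lemma ex_site_spot:
  assumes "p < 1" "AE a in site_law p. R (a :: 'd site_data)"
  shows "\<exists>a. \<not> fst a \<and> R a"
proof (rule ccontr)
  assume "\<nexists>a. \<not> fst a \<and> R a"
  then have "AE a in site_law p. fst (a :: 'd site_data)"
    using assms(2) by (auto elim!: eventually_mono)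
  then have "emeasure (site_law p) {a :: 'd site_data. fst a} = 1"
    using measurable_fst_site_law[of p, where 'a = 'd]
    by (intro prob_space.emeasure_eq_1_AE[OF prob_space_site_law]) (auto simp: pred_def)
  then show False
    using emeasure_site_has_car assms(1) by simp
qed

text \<open>Almost every datum can be planted at a given site without losing an almost sure
  property, and spots have positive probability as \<open>p < 1\<close>. This is repeated over the
  finitely many sites.\<close>

lemma AE_override_spots:
  assumes "p < 1" "AE \<omega> in P. Q \<omega>" "finite K"
  shows "\<exists>\<alpha>. (\<forall>u\<in>K. \<not> has_car \<alpha> u) \<and> (AE \<omega> in P. Q (override_on \<omega> \<alpha> K))"
  using assms(3)
proof (induction K rule: finite_induct)
  case empty
  then show ?case
    using assms(2) by simp
next
  case (insert u K)
  then obtain \<alpha> where \<alpha>: "\<forall>u\<in>K. \<not> has_car \<alpha> u" "AE \<omega> in P. Q (override_on \<omega> \<alpha> K)"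
    by blast
  obtain a where a: "\<not> fst a" "AE \<xi> in P. Q (override_on (\<xi>(u := a)) \<alpha> K)"
    using ex_site_spot[OF assms(1) AE_update[OF \<alpha>(2)]] by blast
  have "override_on (\<xi>(u := a)) \<alpha> K = override_on \<xi> (\<alpha>(u := a)) (insert u K)" for \<xi>
    using insert.hyps by (auto simp: override_on_def)
  then have "AE \<xi> in P. Q (override_on \<xi> (\<alpha>(u := a)) (insert u K))"
    using a(2) by (simp only:)
  moreover have "\<forall>w\<in>insert u K. \<not> has_car (\<alpha>(u := a)) w"
    using a(1) \<alpha>(1) by (auto simp: has_car_def)
  ultimately show ?case
    by blast
qed

text \<open>
  If only finitely many cars ever arrived at \<open>v\<close>, turning their starting points and \<open>v\<close> into
  parking spots would leave \<open>v\<close> vacant forever.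
\<close>

lemma AE_infinitely_many_visits:
  assumes "p < 1" and vac: "AE \<omega> in P. v \<notin> forever_vacant \<omega>"
  shows "AE \<omega> in P. total_visits \<omega> v = \<infinity>"
proof -
  \<comment> \<open>The set to be modified will depend on \<open>\<omega>\<close>. There are
    countably many lists, so the replacements are chosen beforehand and one null set serves them
    all.\<close>
  have "\<forall>xs. \<exists>\<alpha>. (\<forall>u\<in>set xs. \<not> has_car \<alpha> u) \<and> (AE \<omega> in P. v \<notin> forever_vacant (override_on \<omega> \<alpha> (set xs)))"
    using AE_override_spots[OF assms] by blast
  then obtain \<alpha> where \<alpha>: "\<And>xs u. u \<in> set xs \<Longrightarrow> \<not> has_car (\<alpha> xs) u"
    and AE: "\<And>xs. AE \<omega> in P. v \<notin> forever_vacant (override_on \<omega> (\<alpha> xs) (set xs))"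
    by metis
  have "AE \<omega> in P. \<forall>xs. v \<notin> forever_vacant (override_on \<omega> (\<alpha> xs) (set xs))"
    using AE by (simp add: AE_all_countable)
  then show ?thesis
    using AE_no_ties
  proof eventually_elim
    case (elim \<omega>)
    show ?case
    proof (rule ccontr)
      assume "total_visits \<omega> v \<noteq> \<infinity>"
      then obtain T where T: "\<And>t. t \<ge> T \<Longrightarrow> arriving \<omega> t v = {}"
        using total_visits_finite_iff[of \<omega> v] by (auto simp: less_top)
      have "finite (insert v (\<Union>s<T. arriving \<omega> s v))"
        by (simp add: finite_arriving)
      then obtain xs where xs: "set xs = insert v (\<Union>s<T. arriving \<omega> s v)"
        using finite_list by blast
      define \<omega>' where "\<omega>' = override_on \<omega> (\<alpha> xs) (set xs)"
      have no_car: "\<not> has_car \<omega>' u" if "u \<in> set xs" for u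
        using \<alpha>[OF that] that by (simp add: \<omega>'_def has_car_def)
      have same: "\<omega>' u = \<omega> u" if "has_car \<omega>' u" for u
        using no_car that by (auto simp: \<omega>'_def override_on_def)
      have "arriving \<omega>' t v = {}" for t
      proof (rule ccontr)
        assume "arriving \<omega>' t v \<noteq> {}"
        then obtain u where u: "unparked \<omega>' t u" "walk \<omega>' u (Suc t) = v"
          by (auto simp: arriving_def)
        then have car: "has_car \<omega>' u"
          by (simp add: unparked_def)
        \<comment> \<open>Now \<open>\<omega>\<close> is the larger configuration: it arises from
          \<open>\<omega>'\<close> by putting cars back.\<close>
        have "unparked \<omega> t u"
          using parking_mono[of \<omega> \<omega>' "{}" t] elim(2) same u(1) unfolding has_car_def
          by (metis empty_iff)
        moreover have "walk \<omega> u (Suc t) = v"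
          using u(2) same[OF car] by (simp add: walk_def direction_def)
        ultimately have "u \<in> arriving \<omega> t v"
          by (rule arrivingI)
        moreover from this have "t < T"
          using T[of t] by (cases "t < T") auto
        ultimately have "u \<in> set xs"
          using xs by blast
        then show False
          using no_car car by blast
      qed
      then have "v \<in> forever_vacant \<omega>'"
        using no_car[of v] xs by (simp add: forever_vacant_def vacant_iff_no_arrivals)
      then show False
        using elim(1) by (simp add: \<omega>'_def)
    qed
  qed
qed

lemma AE_not_forever_vacant:
  assumes "1 / 2 \<le> p"
  shows "AE \<omega> in P. v \<notin> forever_vacant \<omega>"
  using prob_forever_vacant_eq_0[OF assms, of v] prob_eq_0[of "{\<omega>. v \<in> forever_vacant \<omega>}"]
  by (simp add: sets_Collect)

end

section \<open>Coupling with the fully occupied lattice\<close>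

definition fill :: "('d::finite) config \<Rightarrow> 'd config" where
  "fill \<omega> = (\<lambda>u. (True, snd (\<omega> u)))"

lemma measurable_fill_site: "(\<lambda>a. (True, snd a)) \<in> measurable (site_law p) (site_law q)"
  unfolding site_law_def by measurable

lemma emeasure_fill_site:
  assumes "E \<in> sets (site_law 1)"
  shows "emeasure (site_law p) {a. (True, snd a) \<in> E} = emeasure (site_law 1 :: ('d::finite) site_data measure) E"
proof -
  define M where "M = Pi\<^sub>M UNIV (\<lambda>_::nat. measure_pmf (pmf_of_set (UNIV :: ('d \<times> bool) set)))
     \<Otimes>\<^sub>M Pi\<^sub>M UNIV (\<lambda>_::nat. uniform_measure lborel {0..1::real})"
  have "prob_space M"
    unfolding M_def by (intro prob_space_pair prob_space_PiM prob_space_measure_pmf prob_space_uniform_01)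
  then interpret M: prob_space M .
  have law: "site_law q = measure_pmf (bernoulli_pmf q) \<Otimes>\<^sub>M M" for q
    by (simp add: site_law_def M_def)
  have "(\<lambda>a. (True, snd a)) -` E \<inter> space (site_law p) \<in> sets (site_law p)"
    using measurable_fill_site assms by (rule measurable_sets)
  then have E': "{a. (True, snd a) \<in> E} \<in> sets (site_law p)"
    by (simp add: vimage_def)
  have "emeasure (site_law p) {a. (True, snd a) \<in> E}
      = (\<integral>\<^sup>+b. emeasure M (Pair b -` {a. (True, snd a) \<in> E}) \<partial>measure_pmf (bernoulli_pmf p))"
    using E' unfolding law by (rule M.emeasure_pair_measure_alt)
  also have "\<dots> = (\<integral>\<^sup>+b. emeasure M (Pair True -` E) \<partial>measure_pmf (bernoulli_pmf p))"
    by (intro nn_integral_cong arg_cong[where f = "emeasure M"]) auto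
  also have "\<dots> = (\<integral>\<^sup>+b. emeasure M (Pair b -` E) \<partial>measure_pmf (bernoulli_pmf 1))"
    by (simp add: measure_pmf.emeasure_space_1)
  also have "\<dots> = emeasure (site_law 1) E"
    using assms unfolding law by (rule M.emeasure_pair_measure_alt[symmetric])
  finally show ?thesis .
qed

lemma measurable_fill: "fill \<in> measurable (parking_space p) (parking_space q)"
proof -
  have "fill \<in> measurable (parking_space p) (Pi\<^sub>M UNIV (\<lambda>_. site_law q))"
    unfolding fill_def
    by (rule measurable_PiM_single')
      (auto intro!: measurable_compose[OF measurable_site measurable_fill_site])
  then show ?thesis
    by (simp add: parking_space_def)
qed

lemma distr_fill:
  assumes "0 \<le> p" "p \<le> 1"
  shows "distr (parking_space p) (parking_space 1) fill = (parking_space 1 :: ('d::finite) config measure)"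
proof -
  interpret p: parking p "TYPE('d)"
    using assms by unfold_locales
  interpret one: parking 1 "TYPE('d)"
    by unfold_locales auto
  have "one.P = distr p.P one.P fill"
    unfolding parking_space_def[of 1]
  proof (rule measure_eqI_PiM_infinite)
    show "finite_measure (Pi\<^sub>M UNIV (\<lambda>_::'d site. site_law 1 :: 'd site_data measure))"
      using one.finite_measure_axioms by (simp add: parking_space_def)
    fix J and E :: "'d site \<Rightarrow> 'd site_data set"
    assume J: "finite J" "J \<subseteq> UNIV" and E: "\<And>u. u \<in> J \<Longrightarrow> E u \<in> sets (site_law 1)"
    have eq: "prod_emb UNIV (\<lambda>_. site_law 1) J (Pi\<^sub>E J E) = {\<omega>. \<forall>u\<in>J. \<omega> u \<in> E u}"
      by (auto simp: prod_emb_def PiE_iff extensional_def)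
    have meas: "{\<omega>. \<forall>u\<in>J. \<omega> u \<in> E u} \<in> one.events"
      using J E unfolding eq[symmetric] parking_space_def by (intro sets_PiM_I) auto
    have E': "{a. (True, snd a) \<in> E u} \<in> sets (site_law p)" if "u \<in> J" for u
      using measurable_sets[OF measurable_fill_site E[OF that], of p] by (simp add: vimage_def)
    have "emeasure one.P {\<omega>. \<forall>u\<in>J. \<omega> u \<in> E u} = ennreal (\<Prod>u\<in>J. measure (site_law 1) (E u))"
      using one.prob_rectangle[of J "\<lambda>u a. a \<in> E u"] J E by (simp add: one.emeasure_eq_measure pred_def)
    also have "\<dots> = ennreal (\<Prod>u\<in>J. measure (site_law p) {a. (True, snd a) \<in> E u})"
      using emeasure_fill_site[OF E, of _ p] by (simp add: measure_def)
    also have "\<dots> = emeasure p.P {\<omega>. \<forall>u\<in>J. (True, snd (\<omega> u)) \<in> E u}"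
      using p.prob_rectangle[of J "\<lambda>u a. (True, snd a) \<in> E u"] J E' by (simp add: p.emeasure_eq_measure pred_def)
    also have "\<dots> = emeasure (distr p.P one.P fill) {\<omega>. \<forall>u\<in>J. \<omega> u \<in> E u}"
      using emeasure_distr[OF measurable_fill meas, of p] by (simp add: vimage_def fill_def)
    finally show "emeasure (Pi\<^sub>M UNIV (\<lambda>_. site_law 1)) (prod_emb UNIV (\<lambda>_. site_law 1) J (Pi\<^sub>E J E))
       = emeasure (distr p.P (Pi\<^sub>M UNIV (\<lambda>_. site_law 1)) fill) (prod_emb UNIV (\<lambda>_. site_law 1) J (Pi\<^sub>E J E))"
      unfolding eq by (simp add: parking_space_def)
  qed simp_all
  then show ?thesis
    by simp
qed

context parking
begin

theorem recurrence:
  assumes "1 / 2 \<le> p"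
  shows "AE \<omega> in P. total_visits \<omega> v = \<infinity>"
proof (cases "p < 1")
  case True
  then show ?thesis
    using AE_infinitely_many_visits AE_not_forever_vacant[OF assms] by blast
next
  case False
  then have p: "p = 1"
    using p_le_1 by simp
  \<comment> \<open>With a car at every site there are no spots to plant. Instead
    \<open>fill\<close> adds cars to a process of density 1/2, which by monotonicity only creates
    arrivals; any density in [1/2, 1) could serve.\<close>
  interpret half: parking "1 / 2" "TYPE('d)"
    by unfold_locales auto
  have "AE \<omega> in half.P. v \<notin> forever_vacant \<omega>"
    by (rule half.AE_not_forever_vacant) simp
  then have "AE \<omega> in half.P. total_visits \<omega> v = \<infinity>"
    by (intro half.AE_infinitely_many_visits) simp_all
  then have "AE \<omega> in half.P. total_visits (fill \<omega>) v = \<infinity>"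
    using AE_no_ties
  proof eventually_elim
    case (elim \<omega>)
    have tie: "no_ties (fill \<omega>)"
      using elim(2) by (simp add: no_ties_def tie_value_def fill_def)
    have sub: "arriving \<omega> t v \<subseteq> arriving (fill \<omega>) t v" for t
    proof
      fix u assume "u \<in> arriving \<omega> t v"
      then have "unparked \<omega> t u" "walk \<omega> u (Suc t) = v"
        by (auto simp: arriving_def)
      moreover from this have "unparked (fill \<omega>) t u"
        using parking_mono[OF tie, of \<omega> "{}" t] by (auto simp: has_car_def fill_def prod_eq_iff)
      ultimately show "u \<in> arriving (fill \<omega>) t v"
        by (intro arrivingI) (simp_all add: walk_def direction_def fill_def)
    qed
    show ?case
    proof (rule ccontr)
      assume "total_visits (fill \<omega>) v \<noteq> \<infinity>"
      then have "total_visits \<omega> v < \<infinity>"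
        using total_visits_finite_iff[of "fill \<omega>" v] total_visits_finite_iff[of \<omega> v] sub
        by (simp add: less_top) blast
      then show False
        using elim(1) by simp
    qed
  qed
  then have "AE \<omega> in distr half.P P fill. total_visits \<omega> v = \<infinity>"
    using measurable_total_visits_infinite[of v p]
    by (subst AE_distr_iff[OF measurable_fill]) (simp_all add: pred_def)
  moreover have "distr half.P P fill = P"
    unfolding p by (rule distr_fill) simp_all
  ultimately show ?thesis
    by (simp only:)
qed

end

subsection \<open>Transience\<close>

text \<open>Invariance under \<open>set_direction t\<close> expresses that a function ignores step
  \<open>t\<close>. Together with the two integral identities below it takes the place of a
  filtration.\<close>

definition set_direction :: "nat \<Rightarrow> 'd \<times> bool \<Rightarrow> ('d::finite) site_data \<Rightarrow> 'd site_data" where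
  "set_direction t b a = (fst a, (fst (snd a))(t := b), snd (snd a))"

lemma nn_integral_site_direction:
  fixes f :: "('d::finite) site_data \<Rightarrow> ennreal"
  assumes f: "f \<in> borel_measurable (site_law p)"
    and inv: "\<And>a b. f (set_direction t b a) = f a"
  shows "(\<integral>\<^sup>+a. f a * indicator B (fst (snd a) t) \<partial>site_law p) =
    (\<integral>\<^sup>+a. f a \<partial>site_law p) * emeasure (measure_pmf (pmf_of_set UNIV)) B"
proof -
  define A where "A = measure_pmf (bernoulli_pmf p)"
  define D1 where "D1 = measure_pmf (pmf_of_set (UNIV :: ('d \<times> bool) set))"
  define D where "D = Pi\<^sub>M UNIV (\<lambda>_::nat. D1)"
  define U where "U = Pi\<^sub>M UNIV (\<lambda>_::nat. uniform_measure lborel {0..1::real})"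
  have D1: "prob_space D1"
    unfolding D1_def by (rule prob_space_measure_pmf)
  have D: "prob_space D" and U: "prob_space U"
    unfolding D_def U_def by (intro prob_space_PiM D1 prob_space_uniform_01)+
  interpret U: prob_space U by fact
  interpret DU: prob_space "D \<Otimes>\<^sub>M U"
    using D U by (rule prob_space_pair)
  have law: "site_law p = A \<Otimes>\<^sub>M (D \<Otimes>\<^sub>M U)"
    by (simp add: site_law_def A_def D1_def D_def U_def)
  have [measurable]: "f \<in> borel_measurable (A \<Otimes>\<^sub>M (D \<Otimes>\<^sub>M U))"
    using f by (simp add: law)
  have [measurable]: "(\<lambda>\<sigma>. \<sigma> t) \<in> measurable D D1"
    unfolding D_def by measurable
  have [measurable]: "B \<in> sets D1"
    by (simp add: D1_def)
  have iter: "(\<integral>\<^sup>+a. h a \<partial>site_law p) = (\<integral>\<^sup>+b. (\<integral>\<^sup>+\<sigma>. (\<integral>\<^sup>+z. h (b, \<sigma>, z) \<partial>U) \<partial>D) \<partial>A)"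
    if [measurable]: "h \<in> borel_measurable (A \<Otimes>\<^sub>M (D \<Otimes>\<^sub>M U))" for h
  proof -
    have "(\<integral>\<^sup>+a. h a \<partial>site_law p) = (\<integral>\<^sup>+b. (\<integral>\<^sup>+y. h (b, y) \<partial>(D \<Otimes>\<^sub>M U)) \<partial>A)"
      unfolding law by (rule DU.nn_integral_fst[symmetric]) simp
    also have "\<dots> = (\<integral>\<^sup>+b. (\<integral>\<^sup>+\<sigma>. (\<integral>\<^sup>+z. h (b, \<sigma>, z) \<partial>U) \<partial>D) \<partial>A)"
    proof (intro nn_integral_cong)
      fix b assume "b \<in> space A"
      then have "(\<lambda>y. h (b, y)) \<in> borel_measurable (D \<Otimes>\<^sub>M U)"
        by measurable
      from U.nn_integral_fst[OF this]
      show "(\<integral>\<^sup>+y. h (b, y) \<partial>(D \<Otimes>\<^sub>M U)) = (\<integral>\<^sup>+\<sigma>. (\<integral>\<^sup>+z. h (b, \<sigma>, z) \<partial>U) \<partial>D)"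
        by simp
    qed
    finally show ?thesis .
  qed
  define h where "h b \<sigma> = (\<integral>\<^sup>+z. f (b, \<sigma>, z) \<partial>U)" for b \<sigma>
  have hm: "h b \<in> borel_measurable D" if "b \<in> space A" for b
    unfolding h_def using that by measurable
  have h_inv: "h b (\<sigma>(t := x)) = h b \<sigma>" for b \<sigma> x
    using inv[of x "(b, \<sigma>, _)"] by (simp add: h_def set_direction_def)
  have inner: "(\<integral>\<^sup>+\<sigma>. h b \<sigma> * indicator B (\<sigma> t) \<partial>D) = (\<integral>\<^sup>+\<sigma>. h b \<sigma> \<partial>D) * emeasure D1 B" for b
  proof -
    have [measurable]: "h b \<in> borel_measurable D"
      using hm[of b] by (simp add: A_def)
    have "(\<integral>\<^sup>+\<sigma>. h b \<sigma> * indicator B (\<sigma> t) \<partial>D)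
        = (\<integral>\<^sup>+\<sigma>. (\<integral>\<^sup>+x. h b (\<sigma>(t := x)) * indicator B ((\<sigma>(t := x)) t) \<partial>D1) \<partial>D)"
      unfolding D_def by (rule nn_integral_PiM_update[OF D1]) (simp add: D_def[symmetric])
    also have "\<dots> = (\<integral>\<^sup>+\<sigma>. h b \<sigma> * emeasure D1 B \<partial>D)"
      by (simp add: h_inv nn_integral_cmult)
    also have "\<dots> = (\<integral>\<^sup>+\<sigma>. h b \<sigma> \<partial>D) * emeasure D1 B"
      by (rule nn_integral_multc) simp
    finally show ?thesis .
  qed
  have "(\<integral>\<^sup>+a. f a * indicator B (fst (snd a) t) \<partial>site_law p)
     = (\<integral>\<^sup>+b. (\<integral>\<^sup>+\<sigma>. (\<integral>\<^sup>+z. f (b, \<sigma>, z) * indicator B (\<sigma> t) \<partial>U) \<partial>D) \<partial>A)"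
    by (subst iter) simp_all
  also have "\<dots> = (\<integral>\<^sup>+b. (\<integral>\<^sup>+\<sigma>. h b \<sigma> * indicator B (\<sigma> t) \<partial>D) \<partial>A)"
  proof (intro nn_integral_cong)
    fix b \<sigma> assume "b \<in> space A" "\<sigma> \<in> space D"
    then show "(\<integral>\<^sup>+z. f (b, \<sigma>, z) * indicator B (\<sigma> t) \<partial>U) = h b \<sigma> * indicator B (\<sigma> t)"
      unfolding h_def by (intro nn_integral_multc) measurable
  qed
  also have "\<dots> = (\<integral>\<^sup>+b. (\<integral>\<^sup>+\<sigma>. h b \<sigma> \<partial>D) \<partial>A) * emeasure D1 B"
    unfolding inner by (rule nn_integral_multc) (simp add: A_def)
  also have "(\<integral>\<^sup>+b. (\<integral>\<^sup>+\<sigma>. h b \<sigma> \<partial>D) \<partial>A) = (\<integral>\<^sup>+a. f a \<partial>site_law p)"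
    unfolding h_def by (subst iter) simp_all
  finally show ?thesis
    by (simp add: D1_def)
qed

lemma nn_integral_direction:
  fixes Y :: "('d::finite) config \<Rightarrow> ennreal"
  assumes [measurable]: "Y \<in> borel_measurable (parking_space p)"
    and inv: "\<And>\<xi> b. Y (\<xi>(u := set_direction t b (\<xi> u))) = Y \<xi>"
  shows "(\<integral>\<^sup>+\<xi>. Y \<xi> * indicator B (direction \<xi> u t) \<partial>parking_space p) =
    (\<integral>\<^sup>+\<xi>. Y \<xi> \<partial>parking_space p) * emeasure (measure_pmf (pmf_of_set UNIV)) B"
proof -
  note measurable_update [measurable]
  have Y: "(\<lambda>a. Y (\<xi>(u := a))) \<in> borel_measurable (site_law p)" for \<xi>
  proof -
    have "(\<lambda>a. (a, \<xi>)) \<in> measurable (site_law p) (site_law p \<Otimes>\<^sub>M parking_space p)"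
      by measurable
    from measurable_compose[OF measurable_compose[OF this measurable_update] assms(1)]
    show ?thesis
      by simp
  qed
  have Yinv: "Y (\<xi>(u := set_direction t b a)) = Y (\<xi>(u := a))" for \<xi> a b
    using inv[of "\<xi>(u := a)" b] by simp
  have *: "(\<lambda>\<xi>. \<integral>\<^sup>+a. Y (\<xi>(u := a)) \<partial>site_law p) \<in> borel_measurable (parking_space p)"
  proof -
    interpret S: prob_space "site_law p :: 'd site_data measure"
      by (rule prob_space_site_law)
    have "(\<lambda>(\<xi>, a). Y (case (a, \<xi>) of (a, \<xi>) \<Rightarrow> \<xi>(u := a))) \<in> borel_measurable (parking_space p \<Otimes>\<^sub>M site_law p)"
      by measurable
    from S.borel_measurable_nn_integral[OF this] show ?thesis
      by simp
  qed
  have "(\<integral>\<^sup>+\<xi>. Y \<xi> * indicator B (direction \<xi> u t) \<partial>parking_space p)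
      = (\<integral>\<^sup>+\<xi>. (\<integral>\<^sup>+a. Y (\<xi>(u := a)) * indicator B (fst (snd a) t) \<partial>site_law p) \<partial>parking_space p)"
    by (subst nn_integral_update[where u = u]) (simp_all add: direction_def)
  also have "\<dots> = (\<integral>\<^sup>+\<xi>. (\<integral>\<^sup>+a. Y (\<xi>(u := a)) \<partial>site_law p) * emeasure (measure_pmf (pmf_of_set UNIV)) B \<partial>parking_space p)"
    by (intro nn_integral_cong nn_integral_site_direction Y Yinv)
  also have "\<dots> = (\<integral>\<^sup>+\<xi>. (\<integral>\<^sup>+a. Y (\<xi>(u := a)) \<partial>site_law p) \<partial>parking_space p) * emeasure (measure_pmf (pmf_of_set UNIV)) B"
    using * by (rule nn_integral_multc)
  finally show ?thesis
    by (simp add: nn_integral_update[where u = u, symmetric])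
qed

text \<open>Adaptedness: induction on time shows that the state at time \<open>s\<close> is fixed by
  the initial cars, the tie values and the earlier directions.\<close>

lemma parked_cong_past:
  assumes car: "\<And>u. has_car \<omega>' u = has_car \<omega> u" and tie: "\<And>u. tie_value \<omega>' u = tie_value \<omega> u"
    and dir: "\<And>u s. s < t \<Longrightarrow> direction \<omega>' u s = direction \<omega> u s" and "s \<le> t"
  shows "parked \<omega>' s = parked \<omega> s" "unparked \<omega>' s u = unparked \<omega> s u" "walk \<omega>' u s = walk \<omega> u s"
proof -
  have walk: "walk \<omega>' u s = walk \<omega> u s" if "s \<le> t" for u s
    unfolding walk_def using dir that by (intro arg_cong2[where f = "(+)"] sum.cong) auto
  show "walk \<omega>' u s = walk \<omega> u s"
    using walk \<open>s \<le> t\<close> .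
  show *: "parked \<omega>' s = parked \<omega> s"
    using \<open>s \<le> t\<close>
  proof (induction s)
    case (Suc s)
    then have IH: "parked \<omega>' s = parked \<omega> s"
      by simp
    have arr: "arriving \<omega>' s v = arriving \<omega> s v" for v
      using walk[OF Suc.prems] by (simp add: arriving_def unparked_def IH car)
    show ?case
      by (rule ext) (simp add: parked_Suc vacant_def winner_def IH car arr tie)
  qed simp
  show "unparked \<omega>' s u = unparked \<omega> s u"
    by (simp add: unparked_def * car)
qed

section \<open>Cars present at a site and the directions in which they leave\<close>

definition present :: "('d::finite) config \<Rightarrow> nat \<Rightarrow> 'd site \<Rightarrow> 'd site set" where
  "present \<omega> s v = {u. unparked \<omega> s u \<and> walk \<omega> u s = v}"

definition no_exit :: "('d::finite) config \<Rightarrow> 'd site \<Rightarrow> 'd \<times> bool \<Rightarrow> nat \<Rightarrow> nat \<Rightarrow> bool" where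
  "no_exit \<omega> v e T t \<longleftrightarrow> (\<forall>s. T \<le> s \<and> s < t \<longrightarrow> (\<forall>u. u \<in> present \<omega> s v \<longrightarrow> direction \<omega> u s \<noteq> e))"

definition busy_times :: "('d::finite) config \<Rightarrow> 'd site \<Rightarrow> nat \<Rightarrow> nat \<Rightarrow> nat" where
  "busy_times \<omega> v T t = (\<Sum>s\<in>{T..<t}. if \<exists>u. u \<in> present \<omega> s v then 1 else 0)"

text \<open>Several cars may be present. An enumeration of the sites picks one of them measurably
  and from the past alone, so that a single direction can be resampled.\<close>

definition first_present :: "('d::finite) config \<Rightarrow> nat \<Rightarrow> 'd site \<Rightarrow> 'd site \<Rightarrow> bool" where
  "first_present \<omega> s v u \<longleftrightarrow>
     u \<in> present \<omega> s v \<and> (\<forall>u'. u' \<in> present \<omega> s v \<longrightarrow> to_nat u \<le> to_nat u')"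

lemma measurable_present [measurable]: "Measurable.pred (parking_space p) (\<lambda>\<omega>. u \<in> present \<omega> s v)"
  unfolding present_def by measurable

lemma measurable_no_exit [measurable]: "Measurable.pred (parking_space p) (\<lambda>\<omega>. no_exit \<omega> v e T t)"
  unfolding no_exit_def by measurable

lemma measurable_busy_times [measurable]:
  "(\<lambda>\<omega>. busy_times \<omega> v T t) \<in> measurable (parking_space p) (count_space UNIV)"
  unfolding busy_times_def by measurable

lemma measurable_first_present [measurable]:
  "Measurable.pred (parking_space p) (\<lambda>\<omega>. first_present \<omega> s v u)"
  unfolding first_present_def by measurable

lemma first_present_unique: "first_present \<omega> s v u \<Longrightarrow> first_present \<omega> s v u' \<Longrightarrow> u = u'"
  unfolding first_present_def by (metis order_antisym to_nat_split inj_to_nat injD)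

lemma ex_first_present:
  assumes "u \<in> present \<omega> s v"
  obtains u' where "first_present \<omega> s v u'"
  using ex_has_least_nat[of "\<lambda>u. u \<in> present \<omega> s v" u to_nat] assms
  unfolding first_present_def by blast

text \<open>A car that parks on arrival is never counted as present at \<open>v\<close>. Once
  \<open>v\<close> is no longer vacant this cannot happen, and every arrival is present one step
  later.\<close>

lemma total_visits_finite_of_present:
  assumes "\<And>s. s \<ge> m \<Longrightarrow> present \<omega> s v = {}"
  shows "total_visits \<omega> v < \<infinity>"
proof (cases "\<forall>s. vacant \<omega> s v")
  case True
  then have "arriving \<omega> t v = {}" for t
    using vacant_Suc by blast
  then show ?thesis
    unfolding total_visits_finite_iff by simp
next
  case False
  then obtain s0 where s0: "\<not> vacant \<omega> s0 v"
    by blast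
  have "arriving \<omega> s v = {}" if "s \<ge> max m s0" for s
  proof (rule ccontr)
    assume "arriving \<omega> s v \<noteq> {}"
    then obtain u where u: "unparked \<omega> s u" "walk \<omega> u (Suc s) = v"
      by (auto simp: arriving_def)
    have "\<not> vacant \<omega> s v"
      using vacant_antimono[of \<omega> s v s0] s0 that by auto
    then have "unparked \<omega> (Suc s) u"
      using unparked_SucE[OF u(1)] u(2) by blast
    then have "u \<in> present \<omega> (Suc s) v"
      using u by (simp add: present_def)
    then show False
      using assms[of "Suc s"] that by auto
  qed
  then show ?thesis
    unfolding total_visits_finite_iff by blast
qed

context parking
begin

abbreviation dir_law :: "('d \<times> bool) pmf" where
  "dir_law \<equiv> pmf_of_set UNIV"

lemma emeasure_dir_neq: "emeasure (measure_pmf dir_law) (- {e}) = ennreal (1 - 1 / valency TYPE('d))"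
proof -
  have "measure_pmf.prob dir_law {e} = 1 / valency TYPE('d)"
    by (simp add: measure_pmf_single valency_def del: card_prod)
  then have "measure_pmf.prob dir_law (- {e}) = 1 - 1 / valency TYPE('d)"
    using measure_pmf.prob_compl[of "{e}" dir_law] by (simp add: Compl_eq_Diff_UNIV)
  then show ?thesis
    by (simp add: measure_pmf.emeasure_eq_measure)
qed

definition stay_prob :: real where
  "stay_prob = 1 - 1 / valency TYPE('d)"

lemma stay_prob_bounds: "0 < stay_prob" "stay_prob < 1"
proof -
  have "valency TYPE('d) \<ge> 2"
    by (simp add: valency_eq)
  then show "0 < stay_prob" "stay_prob < 1"
    by (auto simp: stay_prob_def field_simps)
qed

text \<open>
  Each visit to \<open>v\<close> that does not leave in direction \<open>e\<close> costs a factor \<open>stay_prob\<close>, which makes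
  this a supermartingale in \<open>t\<close>.
\<close>

definition stay_weight :: "'d site \<Rightarrow> 'd \<times> bool \<Rightarrow> nat \<Rightarrow> nat \<Rightarrow> 'd config \<Rightarrow> ennreal" where
  "stay_weight v e T t \<omega> =
     (if no_exit \<omega> v e T t then ennreal ((1 / stay_prob) ^ busy_times \<omega> v T t) else 0)"

lemma measurable_stay_weight [measurable]: "stay_weight v e T t \<in> borel_measurable P"
  unfolding stay_weight_def by measurable

lemma past_cong:
  assumes "\<And>u. has_car \<omega>' u = has_car \<omega> u" "\<And>u. tie_value \<omega>' u = tie_value \<omega> u"
    and "\<And>u s. s < t \<Longrightarrow> direction \<omega>' u s = direction \<omega> u s"
  shows "present \<omega>' t v = present \<omega> t v" "stay_weight v e T t \<omega>' = stay_weight v e T t \<omega>"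
proof -
  have pres: "present \<omega>' s v = present \<omega> s v" if "s \<le> t" for s
    unfolding present_def using parked_cong_past(2,3)[OF assms that] by simp
  then show "present \<omega>' t v = present \<omega> t v"
    by simp
  have "no_exit \<omega>' v e T t = no_exit \<omega> v e T t"
    unfolding no_exit_def using pres assms(3) by auto
  moreover have "busy_times \<omega>' v T t = busy_times \<omega> v T t"
    unfolding busy_times_def using pres by (intro sum.cong) auto
  ultimately show "stay_weight v e T t \<omega>' = stay_weight v e T t \<omega>"
    by (simp add: stay_weight_def)
qed

lemma sum_first_present:
  "(\<integral>\<^sup>+u. f u * indicator {\<omega>. first_present \<omega> t v u} \<omega> \<partial>count_space UNIV) =
    (if first_present \<omega> t v w then f w else 0)"
  if "first_present \<omega> t v w \<or> present \<omega> t v = {}"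
proof (cases "first_present \<omega> t v w")
  case True
  then have "first_present \<omega> t v u \<longleftrightarrow> u = w" for u
    using first_present_unique by blast
  then have "(\<integral>\<^sup>+u. f u * indicator {\<omega>. first_present \<omega> t v u} \<omega> \<partial>count_space UNIV)
     = (\<integral>\<^sup>+u. f w * indicator {w} u \<partial>count_space UNIV)"
    by (intro nn_integral_cong) (simp split: split_indicator)
  then show ?thesis
    using True by (simp add: nn_integral_cmult)
next
  case False
  then have "present \<omega> t v = {}"
    using that by blast
  then show ?thesis
    by (simp add: first_present_def)
qed

text \<open>Split according to the first car present. Its direction is independent of the past and
  differs from \<open>e\<close> with probability \<open>q\<close>, which offsets the new factor
  \<open>1 / q\<close>. Further cars can only destroy the weight, hence an inequality.\<close>

lemma nn_integral_stay_weight_Suc: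
  assumes "T \<le> t"
  shows "(\<integral>\<^sup>+\<omega>. stay_weight v e T (Suc t) \<omega> \<partial>P) \<le> (\<integral>\<^sup>+\<omega>. stay_weight v e T t \<omega> \<partial>P)"
proof -
  define X where "X = stay_weight v e T t"
  define q where "q = stay_prob"
  have q: "0 < q"
    using stay_prob_bounds by (simp add: q_def)
  have [measurable]: "X \<in> borel_measurable P"
    by (simp add: X_def)
  define E where "E = {\<omega> :: 'd config. present \<omega> t v = {}}"
  define F where "F u = {\<omega> :: 'd config. first_present \<omega> t v u}" for u
  have [measurable]: "E \<in> events"
  proof -
    have "Measurable.pred P (\<lambda>\<omega>. \<forall>u. u \<notin> present \<omega> t v)"
      by (rule pred_intros_countable(1)) measurable
    then show ?thesis
      by (simp add: pred_def E_def)
  qed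
  have [measurable]: "F u \<in> events" for u
    unfolding F_def by (rule sets_Collect) measurable
  \<comment> \<open>Both \<open>X\<close> and \<open>F u\<close> are determined by the past of time
    \<open>t\<close>, so they are invariant under a change of the direction of \<open>u\<close> at
    time \<open>t\<close>.\<close>
  have resample: "(\<integral>\<^sup>+\<omega>. (X \<omega> * ennreal (1 / q) * indicator (- {e}) (direction \<omega> u t)) * indicator (F u) \<omega> \<partial>P)
      = (\<integral>\<^sup>+\<omega>. X \<omega> * indicator (F u) \<omega> \<partial>P)" for u
  proof -
    have "(\<integral>\<^sup>+\<xi>. (X \<xi> * ennreal (1 / q) * indicator (- {e}) (direction \<xi> u t)) * indicator (F u) \<xi> \<partial>P)
      = (\<integral>\<^sup>+\<xi>. (ennreal (1 / q) * (X \<xi> * indicator (F u) \<xi>)) * indicator (- {e}) (direction \<xi> u t) \<partial>P)"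
      by (intro nn_integral_cong) (simp add: mult_ac)
    also have "\<dots> = (\<integral>\<^sup>+\<xi>. ennreal (1 / q) * (X \<xi> * indicator (F u) \<xi>) \<partial>P) * ennreal q"
      unfolding q_def stay_prob_def emeasure_dir_neq[of e, symmetric]
    proof (rule nn_integral_direction)
      fix \<xi> :: "'d config" and b
      define \<xi>' where "\<xi>' = \<xi>(u := set_direction t b (\<xi> u))"
      have "has_car \<xi>' w = has_car \<xi> w" "tie_value \<xi>' w = tie_value \<xi> w"
        "s < t \<Longrightarrow> direction \<xi>' w s = direction \<xi> w s" for w s
        by (auto simp: \<xi>'_def set_direction_def has_car_def tie_value_def direction_def)
      note past_cong[OF this]
      then have "X \<xi>' = X \<xi>" "indicator (F u) \<xi>' = (indicator (F u) \<xi> :: ennreal)"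
        by (simp_all add: X_def F_def first_present_def indicator_def)
      then show "ennreal (1 / (1 - 1 / valency TYPE('d))) * (X (\<xi>(u := set_direction t b (\<xi> u))) * indicator (F u) (\<xi>(u := set_direction t b (\<xi> u))))
         = ennreal (1 / (1 - 1 / valency TYPE('d))) * (X \<xi> * indicator (F u) \<xi>)"
        by (simp add: \<xi>'_def)
    qed measurable
    also have "\<dots> = (ennreal (1 / q) * ennreal q) * (\<integral>\<^sup>+\<xi>. X \<xi> * indicator (F u) \<xi> \<partial>P)"
      by (subst nn_integral_cmult) (simp_all add: mult_ac)
    also have "ennreal (1 / q) * ennreal q = 1"
      using q by (simp add: ennreal_mult[symmetric])
    finally show ?thesis
      by simp
  qed
  have split: "stay_weight v e T (Suc t) \<omega> \<le> X \<omega> * indicator E \<omega> +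
      (\<integral>\<^sup>+u. (X \<omega> * ennreal (1 / q) * indicator (- {e}) (direction \<omega> u t)) * indicator (F u) \<omega> \<partial>count_space UNIV)"
    and split': "X \<omega> = X \<omega> * indicator E \<omega> + (\<integral>\<^sup>+u. X \<omega> * indicator (F u) \<omega> \<partial>count_space UNIV)" for \<omega>
  proof -
    have busy: "busy_times \<omega> v T (Suc t) = busy_times \<omega> v T t + (if \<exists>u. u \<in> present \<omega> t v then 1 else 0)"
      unfolding busy_times_def using assms by simp
    have exit: "no_exit \<omega> v e T (Suc t) \<longleftrightarrow> no_exit \<omega> v e T t \<and> (\<forall>u. u \<in> present \<omega> t v \<longrightarrow> direction \<omega> u t \<noteq> e)"
      unfolding no_exit_def using assms by (auto simp: less_Suc_eq)
    consider "present \<omega> t v = {}" | u0 where "first_present \<omega> t v u0"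
      using ex_first_present by blast
    then have "stay_weight v e T (Suc t) \<omega> \<le> X \<omega> * indicator E \<omega> +
      (\<integral>\<^sup>+u. (X \<omega> * ennreal (1 / q) * indicator (- {e}) (direction \<omega> u t)) * indicator (F u) \<omega> \<partial>count_space UNIV) \<and>
      X \<omega> = X \<omega> * indicator E \<omega> + (\<integral>\<^sup>+u. X \<omega> * indicator (F u) \<omega> \<partial>count_space UNIV)"
    proof cases
      case 1
      then have "stay_weight v e T (Suc t) \<omega> = X \<omega>"
        by (simp add: stay_weight_def X_def busy exit)
      then show ?thesis
        using 1 by (simp add: E_def F_def first_present_def)
    next
      case 2
      then have u0: "u0 \<in> present \<omega> t v"
        by (simp add: first_present_def)
      then have "stay_weight v e T (Suc t) \<omega> \<le> X \<omega> * ennreal (1 / q) * indicator (- {e}) (direction \<omega> u0 t)"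
        using q stay_prob_bounds by (auto simp: stay_weight_def X_def busy exit q_def ennreal_mult[symmetric])
      moreover have "\<omega> \<notin> E"
        using u0 by (auto simp: E_def)
      ultimately show ?thesis
        unfolding F_def using 2 by (subst (1 2) sum_first_present[where w = u0]) auto
    qed
    then show "stay_weight v e T (Suc t) \<omega> \<le> X \<omega> * indicator E \<omega> +
      (\<integral>\<^sup>+u. (X \<omega> * ennreal (1 / q) * indicator (- {e}) (direction \<omega> u t)) * indicator (F u) \<omega> \<partial>count_space UNIV)"
      "X \<omega> = X \<omega> * indicator E \<omega> + (\<integral>\<^sup>+u. X \<omega> * indicator (F u) \<omega> \<partial>count_space UNIV)"
      by blast+
  qed
  have meas: "(\<lambda>\<omega>. \<integral>\<^sup>+u. g u \<omega> \<partial>count_space UNIV) \<in> borel_measurable P"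
    if "\<And>u. g u \<in> borel_measurable P" for g :: "'d site \<Rightarrow> 'd config \<Rightarrow> ennreal"
  proof -
    have "(\<lambda>x. g (snd x) (fst x)) \<in> borel_measurable (P \<Otimes>\<^sub>M count_space UNIV)"
    proof (rule measurable_compose_countable[where f = "\<lambda>u x. g u (fst x)"])
      show "(\<lambda>x. g u (fst x)) \<in> borel_measurable (P \<Otimes>\<^sub>M count_space UNIV)" for u
        using that[of u] by measurable
    qed (rule measurable_snd)
    then have "(\<lambda>(\<omega>, u). g u \<omega>) \<in> borel_measurable (P \<Otimes>\<^sub>M count_space UNIV)"
      by (simp add: case_prod_beta')
    then show ?thesis
      by (rule sigma_finite_measure.borel_measurable_nn_integral[OF sigma_finite_measure_count_space])
  qed
  have "(\<integral>\<^sup>+\<omega>. stay_weight v e T (Suc t) \<omega> \<partial>P) \<le> (\<integral>\<^sup>+\<omega>. X \<omega> * indicator E \<omega> +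
      (\<integral>\<^sup>+u. (X \<omega> * ennreal (1 / q) * indicator (- {e}) (direction \<omega> u t)) * indicator (F u) \<omega> \<partial>count_space UNIV) \<partial>P)"
    by (intro nn_integral_mono split)
  also have "\<dots> = (\<integral>\<^sup>+\<omega>. X \<omega> * indicator E \<omega> \<partial>P) + (\<integral>\<^sup>+\<omega>.
      (\<integral>\<^sup>+u. (X \<omega> * ennreal (1 / q) * indicator (- {e}) (direction \<omega> u t)) * indicator (F u) \<omega> \<partial>count_space UNIV) \<partial>P)"
    by (intro nn_integral_add meas) measurable
  also have "(\<integral>\<^sup>+\<omega>. (\<integral>\<^sup>+u. (X \<omega> * ennreal (1 / q) * indicator (- {e}) (direction \<omega> u t)) * indicator (F u) \<omega> \<partial>count_space UNIV) \<partial>P)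
     = (\<integral>\<^sup>+u. (\<integral>\<^sup>+\<omega>. X \<omega> * indicator (F u) \<omega> \<partial>P) \<partial>count_space UNIV)"
    by (subst nn_integral_count_space_nn_integral) (simp_all add: resample)
  also have "\<dots> = (\<integral>\<^sup>+\<omega>. (\<integral>\<^sup>+u. X \<omega> * indicator (F u) \<omega> \<partial>count_space UNIV) \<partial>P)"
    by (intro nn_integral_count_space_nn_integral[symmetric]) auto
  also have "(\<integral>\<^sup>+\<omega>. X \<omega> * indicator E \<omega> \<partial>P) + \<dots>
     = (\<integral>\<^sup>+\<omega>. X \<omega> * indicator E \<omega> + (\<integral>\<^sup>+u. X \<omega> * indicator (F u) \<omega> \<partial>count_space UNIV) \<partial>P)"
    by (intro nn_integral_add[symmetric] meas) measurable
  also have "\<dots> = (\<integral>\<^sup>+\<omega>. X \<omega> \<partial>P)"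
    by (simp only: split'[symmetric])
  finally show ?thesis
    by (simp add: X_def)
qed

lemma nn_integral_stay_weight_le_1: "(\<integral>\<^sup>+\<omega>. stay_weight v e T (T + n) \<omega> \<partial>P) \<le> 1"
proof (induction n)
  case 0
  have "stay_weight v e T T \<omega> = 1" for \<omega>
    by (simp add: stay_weight_def no_exit_def busy_times_def)
  then show ?case
    using emeasure_space_1 by simp
next
  case (Suc n)
  have "(\<integral>\<^sup>+\<omega>. stay_weight v e T (Suc (T + n)) \<omega> \<partial>P) \<le> (\<integral>\<^sup>+\<omega>. stay_weight v e T (T + n) \<omega> \<partial>P)"
    by (rule nn_integral_stay_weight_Suc) simp
  then show ?case
    using Suc order_trans by fastforce
qed

text \<open>Without exits the weight is exponential in the number of busy times, while its
  expectation stays below 1. So this number is almost surely bounded on that event.\<close>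

lemma AE_no_exit_bounded:
  "AE \<omega> in P. (\<forall>t. no_exit \<omega> v e T t) \<longrightarrow> (\<exists>m. \<forall>s\<ge>m. present \<omega> s v = {})"
proof -
  \<comment> \<open>Demanding no exit at any time, rather than up to \<open>T + n\<close>, makes
    \<open>Z\<close> increasing in \<open>n\<close>, so monotone convergence applies, and keeps it
    below the supermartingale.\<close>
  define Z where "Z n \<omega> = (if \<forall>t. no_exit \<omega> v e T t then ennreal ((1 / stay_prob) ^ busy_times \<omega> v T (T + n)) else 0)"
    for n and \<omega> :: "'d config"
  have r: "1 < 1 / stay_prob"
    using stay_prob_bounds by simp
  have [measurable]: "Z n \<in> borel_measurable P" for n
    unfolding Z_def by measurable
  have mono: "busy_times \<omega> v T (T + m) \<le> busy_times \<omega> v T (T + n)" if "m \<le> n" for m n and \<omega> :: "'d config"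
    unfolding busy_times_def using that by (intro sum_mono2) auto
  have "incseq Z"
    using r mono by (auto simp: incseq_def le_fun_def Z_def intro!: ennreal_leI power_increasing)
  then have "(\<integral>\<^sup>+\<omega>. (SUP n. Z n \<omega>) \<partial>P) = (SUP n. \<integral>\<^sup>+\<omega>. Z n \<omega> \<partial>P)"
    by (intro nn_integral_monotone_convergence_SUP) auto
  also have "\<dots> \<le> 1"
  proof (rule SUP_least)
    fix n
    have "(\<integral>\<^sup>+\<omega>. Z n \<omega> \<partial>P) \<le> (\<integral>\<^sup>+\<omega>. stay_weight v e T (T + n) \<omega> \<partial>P)"
      by (intro nn_integral_mono) (auto simp: Z_def stay_weight_def)
    then show "(\<integral>\<^sup>+\<omega>. Z n \<omega> \<partial>P) \<le> 1"
      using nn_integral_stay_weight_le_1 order_trans by blast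
  qed
  finally have "(\<integral>\<^sup>+\<omega>. (SUP n. Z n \<omega>) \<partial>P) \<noteq> \<infinity>"
    by (auto simp: top_unique)
  then have "AE \<omega> in P. (SUP n. Z n \<omega>) \<noteq> \<infinity>"
    by (intro nn_integral_PInf_AE) auto
  then show ?thesis
  proof eventually_elim
    case (elim \<omega>)
    show ?case
    proof (intro impI)
      assume no_exit: "\<forall>t. no_exit \<omega> v e T t"
      obtain k :: nat where k: "(SUP n. Z n \<omega>) < of_nat k"
        using elim ennreal_Ex_less_of_nat by (metis infinity_ennreal_def less_top)
      obtain N where N: "real k < (1 / stay_prob) ^ N"
        using real_arch_pow[OF r] by blast
      have bound: "busy_times \<omega> v T (T + n) < N" for n
      proof (rule ccontr)
        assume "\<not> busy_times \<omega> v T (T + n) < N"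
        then have "(1 / stay_prob) ^ N \<le> (1 / stay_prob) ^ busy_times \<omega> v T (T + n)"
          using r by (intro power_increasing) auto
        then have "ennreal (real k) \<le> Z n \<omega>"
          using N no_exit by (auto simp: Z_def intro!: ennreal_leI)
        also have "\<dots> \<le> (SUP n. Z n \<omega>)"
          by (rule SUP_upper) simp
        finally show False
          using k by (simp add: ennreal_of_nat_eq_real_of_nat)
      qed
      have fin: "finite (range (\<lambda>n. busy_times \<omega> v T (T + n)))"
        by (rule finite_subset[of _ "{..N}"]) (use bound in \<open>auto intro: less_imp_le\<close>)
      define M where "M = Max (range (\<lambda>n. busy_times \<omega> v T (T + n)))"
      have "M \<in> range (\<lambda>n. busy_times \<omega> v T (T + n))"
        unfolding M_def using fin by (intro Max_in) auto
      then obtain n where n: "busy_times \<omega> v T (T + n) = M"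
        by auto
      have "present \<omega> s v = {}" if "s \<ge> T + n" for s
      proof (rule ccontr)
        assume ne: "present \<omega> s v \<noteq> {}"
        have "busy_times \<omega> v T (T + (Suc s - T)) \<le> M"
          unfolding M_def using fin by (intro Max_ge) auto
        moreover have "busy_times \<omega> v T (Suc s) = busy_times \<omega> v T s + 1"
          unfolding busy_times_def using ne that by auto
        moreover have "M \<le> busy_times \<omega> v T (T + (s - T))"
          using mono[of n "s - T" \<omega>] that n by (simp add: le_diff_conv2)
        ultimately show False
          using that by simp
      qed
      then show "\<exists>m. \<forall>s\<ge>m. present \<omega> s v = {}"
        by blast
    qed
  qed
qed

text \<open>If arrivals at the neighbour cease at time \<open>T\<close>, no car leaves
  \<open>v\<close> towards it from then on, so cars are eventually absent from \<open>v\<close>. The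
  exceptional sets are countably many.\<close>

lemma AE_infinite_visits_spread:
  "AE \<omega> in P. \<forall>v e. total_visits \<omega> v = \<infinity> \<longrightarrow> total_visits \<omega> (v + step_vec e) = \<infinity>"
proof -
  have "AE \<omega> in P. \<forall>v. \<forall>e. \<forall>T. (\<forall>t. no_exit \<omega> v e T t) \<longrightarrow> (\<exists>m. \<forall>s\<ge>m. present \<omega> s v = {})"
    unfolding AE_all_countable using AE_no_exit_bounded by blast
  then show ?thesis
  proof (rule eventually_mono, intro allI impI)
    fix \<omega> v e
    assume *: "\<forall>v. \<forall>e. \<forall>T. (\<forall>t. no_exit \<omega> v e T t) \<longrightarrow> (\<exists>m. \<forall>s\<ge>m. present \<omega> s v = {})"
      and inf: "total_visits \<omega> v = \<infinity>"
    show "total_visits \<omega> (v + step_vec e) = \<infinity>"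
    proof (rule ccontr)
      assume "total_visits \<omega> (v + step_vec e) \<noteq> \<infinity>"
      then obtain T where T: "\<And>t. t \<ge> T \<Longrightarrow> arriving \<omega> t (v + step_vec e) = {}"
        using total_visits_finite_iff[of \<omega> "v + step_vec e"] by (auto simp: less_top)
      have "no_exit \<omega> v e T t" for t
        unfolding no_exit_def
      proof (intro allI impI notI)
        fix s u assume "T \<le> s \<and> s < t" "u \<in> present \<omega> s v" "direction \<omega> u s = e"
        then have "u \<in> arriving \<omega> s (v + step_vec e)"
          by (auto simp: present_def walk_Suc intro!: arrivingI)
        then show False
          using T[of s] \<open>T \<le> s \<and> s < t\<close> by auto
      qed
      then obtain m where "\<forall>s\<ge>m. present \<omega> s v = {}"
        using * by blast
      then show False
        using total_visits_finite_of_present[of m \<omega> v] inf by simp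
    qed
  qed
qed

theorem transience:
  assumes "p < 1 / 2"
  shows "AE \<omega> in P. total_visits \<omega> v < \<infinity>"
proof -
  have "prob {\<omega>. 0 \<in> forever_vacant \<omega>} > 0"
    using prob_survive_forever_vacant[of 0] assms measure_nonneg[of P "{\<omega>. \<forall>t. unparked \<omega> t 0}"] by linarith
  then have "AE \<omega> in P. forever_vacant \<omega> \<noteq> {}"
    by (rule AE_forever_vacant_nonempty)
  with AE_infinite_visits_spread show ?thesis
  proof eventually_elim
    case (elim \<omega>)
    then obtain w where w: "w \<in> forever_vacant \<omega>"
      by blast
    have "arriving \<omega> t w = {}" for t
      using w vacant_Suc[of \<omega> t w] by (auto simp: forever_vacant_def)
    then have "total_visits \<omega> w < \<infinity>"
      unfolding total_visits_finite_iff by blast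
    show ?case
    proof (rule ccontr)
      assume "\<not> total_visits \<omega> v < \<infinity>"
      then have "total_visits \<omega> v = \<infinity>"
        by (simp add: less_top[symmetric])
      then have "total_visits \<omega> w = \<infinity>"
        using site_connected[of "\<lambda>x. total_visits \<omega> x = \<infinity>" v w] elim(1) by blast
      then show False
        using \<open>total_visits \<omega> w < \<infinity>\<close> by simp
    qed
  qed
qed

end

subsection \<open>Expected visits at low density\<close>

text \<open>Only the target must lie in \<open>C\<close>, so a chain that starts in \<open>C\<close>
  remains there.\<close>

definition step_rel :: "('d::finite) site set \<Rightarrow> ('d site \<times> 'd site) set" where
  "step_rel C = {(x, y). y \<in> C \<and> (\<exists>e. y = x + step_vec e)}"

definition conn :: "('d::finite) site set \<Rightarrow> bool" where
  "conn C \<longleftrightarrow> (\<forall>x\<in>C. \<forall>y\<in>C. (x, y) \<in> (step_rel C)\<^sup>*)"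

lemma step_vec_flip: "step_vec (i, \<not> b) = - step_vec (i, b)"
  by (auto simp: step_vec_def axis_def vec_eq_iff)

lemma conn_singleton [simp]: "conn {x}"
  by (simp add: conn_def)

lemma conn_Un:
  assumes "conn A" "conn B" "x \<in> A" "y \<in> B" and y: "y = x + step_vec e"
  shows "conn (A \<union> B)"
proof -
  have A: "(step_rel A)\<^sup>* \<subseteq> (step_rel (A \<union> B))\<^sup>*" and B: "(step_rel B)\<^sup>* \<subseteq> (step_rel (A \<union> B))\<^sup>*"
    by (rule rtrancl_mono, force simp: step_rel_def)+
  have "(x, y) \<in> step_rel (A \<union> B)"
    using \<open>y \<in> B\<close> y unfolding step_rel_def by blast
  moreover have "x = y + step_vec (fst e, \<not> snd e)"
    using y step_vec_flip[of "fst e" "snd e"] by simp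
  then have "(y, x) \<in> step_rel (A \<union> B)"
    using \<open>x \<in> A\<close> unfolding step_rel_def by blast
  ultimately have xy: "(x, y) \<in> (step_rel (A \<union> B))\<^sup>*" "(y, x) \<in> (step_rel (A \<union> B))\<^sup>*"
    by blast+
  have to_x: "(z, x) \<in> (step_rel (A \<union> B))\<^sup>*" and from_x: "(x, z) \<in> (step_rel (A \<union> B))\<^sup>*" if "z \<in> A \<union> B" for z
  proof -
    have "(z, x) \<in> (step_rel (A \<union> B))\<^sup>* \<and> (x, z) \<in> (step_rel (A \<union> B))\<^sup>*"
    proof (cases "z \<in> A")
      case True
      then show ?thesis
        using \<open>conn A\<close> \<open>x \<in> A\<close> A unfolding conn_def by blast
    next
      case False
      then have "(z, y) \<in> (step_rel (A \<union> B))\<^sup>*" "(y, z) \<in> (step_rel (A \<union> B))\<^sup>*"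
        using that \<open>conn B\<close> \<open>y \<in> B\<close> B unfolding conn_def by blast+
      then show ?thesis
        using xy by (meson rtrancl_trans)
    qed
    then show "(z, x) \<in> (step_rel (A \<union> B))\<^sup>*" "(x, z) \<in> (step_rel (A \<union> B))\<^sup>*"
      by blast+
  qed
  show ?thesis
    unfolding conn_def using to_x from_x by (meson rtrancl_trans)
qed

definition closed_cluster :: "('d::finite) config \<Rightarrow> nat \<Rightarrow> 'd site set \<Rightarrow> bool" where
  "closed_cluster \<omega> s C \<longleftrightarrow> finite C \<and> conn C \<and>
     (\<forall>w\<in>C. \<not> has_car \<omega> w \<longrightarrow> (\<exists>u\<in>C. parked \<omega> s w = Some u))"

lemma closed_cluster_mono: "closed_cluster \<omega> s C \<Longrightarrow> s \<le> t \<Longrightarrow> closed_cluster \<omega> t C"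
  unfolding closed_cluster_def by (meson parked_mono)

text \<open>
  Every spot crossed by a driving car is occupied, and the car parked there started nearby by
  the same reasoning; following cars back to their starting points terminates since time decreases.
\<close>

lemma ex_closed_cluster:
  "unparked \<omega> s u \<Longrightarrow> \<exists>C. closed_cluster \<omega> s C \<and> (\<forall>r\<le>s. walk \<omega> u r \<in> C)"
proof (induction s arbitrary: u rule: less_induct)
  case (less s)
  show ?case
  proof (cases s)
    case 0
    then show ?thesis
      using less.prems by (intro exI[of _ "{u}"]) (auto simp: closed_cluster_def)
  next
    case (Suc t)
    have ut: "unparked \<omega> t u"
      using less.prems by (rule unparked_antimono) (simp add: Suc)
    then obtain C where C: "closed_cluster \<omega> t C" "\<And>r. r \<le> t \<Longrightarrow> walk \<omega> u r \<in> C"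
      using less.IH[of t u] Suc by auto
    define v where "v = walk \<omega> u (Suc t)"
    have Cs: "closed_cluster \<omega> s C"
      using C(1) by (rule closed_cluster_mono) (simp add: Suc)
    have connv: "conn (C \<union> {v})"
      by (rule conn_Un[of _ _ "walk \<omega> u t" v "direction \<omega> u t"])
        (use C in \<open>auto simp: closed_cluster_def v_def walk_Suc\<close>)
    have walk: "walk \<omega> u r \<in> C \<union> {v}" if "r \<le> s" for r
      using that C(2)[of r] by (cases "r = s") (auto simp: v_def Suc)
    show ?thesis
    proof (cases "has_car \<omega> v")
      case True
      then have "closed_cluster \<omega> s (C \<union> {v})"
        using Cs connv unfolding closed_cluster_def by auto
      then show ?thesis
        using walk by blast
    next
      case False
      \<comment> \<open>The arrival of \<open>u\<close> itself ends the vacancy, although another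
        car may have taken the spot now or earlier.\<close>
      have "\<not> vacant \<omega> (Suc t) v"
        using arrivingI[OF ut, of v] by (auto simp: vacant_Suc v_def)
      then obtain u' where u': "parked \<omega> (Suc t) v = Some u'"
        using False by (auto simp: vacant_def)
      then obtain s' where s': "s' < Suc t" "unparked \<omega> s' u'" "walk \<omega> u' (Suc s') = v"
        by (rule parkedE)
      then obtain C' where C': "closed_cluster \<omega> s' C'" "\<And>r. r \<le> s' \<Longrightarrow> walk \<omega> u' r \<in> C'"
        using less.IH[of s' u'] Suc by auto
      have C's: "closed_cluster \<omega> s C'"
        using C'(1) by (rule closed_cluster_mono) (use s' Suc in simp)
      have "u' \<in> C'"
        using C'(2)[of 0] by simp
      \<comment> \<open>The parking step of \<open>u'\<close> links its cluster to \<open>v\<close>,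
        and \<open>C'\<close> supplies the start of the car parked at \<open>v\<close>.\<close>
      have "conn (C' \<union> (C \<union> {v}))"
        by (rule conn_Un[of _ _ "walk \<omega> u' s'" v "direction \<omega> u' s'"])
          (use C' connv s' in \<open>auto simp: closed_cluster_def walk_Suc\<close>)
      then have "closed_cluster \<omega> s (C' \<union> (C \<union> {v}))"
        using Cs C's u' \<open>u' \<in> C'\<close> Suc unfolding closed_cluster_def by auto
      then show ?thesis
        using walk by blast
    qed
  qed
qed

text \<open>Spots of the cluster inject into its cars through the car parked on them, and the
  unparked car \<open>u\<close> is missed.\<close>

lemma card_closed_cluster_less:
  assumes "closed_cluster \<omega> s C" "unparked \<omega> s u" "u \<in> C"
  shows "card C < 2 * card {w \<in> C. has_car \<omega> w}"
proof -
  define A where "A = {w \<in> C. has_car \<omega> w}"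
  define B where "B = {w \<in> C. \<not> has_car \<omega> w}"
  have fin: "finite A" "finite B"
    using assms by (auto simp: A_def B_def closed_cluster_def)
  have B: "\<exists>u'\<in>C. parked \<omega> s w = Some u'" if "w \<in> B" for w
    using assms(1) that by (auto simp: B_def closed_cluster_def)
  have "card B \<le> card (A - {u})"
  proof (rule card_inj_on_le)
    show "inj_on (\<lambda>w. the (parked \<omega> s w)) B"
    proof (rule inj_onI)
      fix w w' assume "w \<in> B" "w' \<in> B" "the (parked \<omega> s w) = the (parked \<omega> s w')"
      then obtain x where "parked \<omega> s w = Some x" "parked \<omega> s w' = Some x"
        using B[of w] B[of w'] by auto
      then show "w = w'"
        by (rule parked_inj)
    qed
    show "(\<lambda>w. the (parked \<omega> s w)) ` B \<subseteq> A - {u}"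
    proof
      fix x assume "x \<in> (\<lambda>w. the (parked \<omega> s w)) ` B"
      then obtain w where w: "w \<in> B" "x = the (parked \<omega> s w)"
        by blast
      then have x: "x \<in> C" "parked \<omega> s w = Some x"
        using B[OF w(1)] by auto
      then have "x \<noteq> u"
        using assms(2) by (auto simp: unparked_def ran_def)
      moreover obtain r where "unparked \<omega> r x"
        using x(2) by (rule parkedE)
      ultimately show "x \<in> A - {u}"
        using x(1) by (simp add: A_def unparked_def)
    qed
    show "finite (A - {u})"
      using fin by simp
  qed
  moreover have "u \<in> A"
    using assms by (simp add: A_def unparked_def)
  then have "card (A - {u}) < card A"
    using fin by (intro card_Diff1_less)
  moreover have "card C = card A + card B"
  proof -
    have "C = A \<union> B"
      by (auto simp: A_def B_def)
    then show ?thesis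
      using fin by (simp only:) (rule card_Un_disjoint, auto simp: A_def B_def)
  qed
  ultimately show ?thesis
    unfolding A_def[symmetric] by linarith
qed

section \<open>Traversals of connected sets and confined walks\<close>

primrec trail :: "('d::finite) site \<Rightarrow> ('d \<times> bool) list \<Rightarrow> 'd site set" where
  "trail x [] = {x}"
| "trail x (e # l) = insert x (trail (x + step_vec e) l)"

lemma finite_trail [simp]: "finite (trail x l)"
  by (induction l arbitrary: x) auto

lemma start_in_trail [simp]: "x \<in> trail x l"
  by (cases l) auto

lemma trail_append: "trail x (l @ l') = trail x l \<union> trail (x + sum_list (map step_vec l)) l'"
  by (induction l arbitrary: x) (auto simp: add.assoc)

lemma trail_map: "trail x (map \<sigma> [0..<n]) = (\<lambda>k. x + (\<Sum>s<k. step_vec (\<sigma> s))) ` {..n}"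
proof (induction n)
  case (Suc n)
  have "sum_list (map step_vec (map \<sigma> [0..<n])) = (\<Sum>s<n. step_vec (\<sigma> s))"
    by (simp add: interv_sum_list_conv_sum_set_nat atLeast0LessThan comp_def)
  then show ?case
    using Suc by (auto simp: trail_append atMost_Suc add.assoc)
qed simp

text \<open>Insert \<open>e\<close> and its reversal at a visit to \<open>z\<close>; the remaining
  steps are made from the same sites as before.\<close>

lemma trail_detour:
  "z \<in> trail x l \<Longrightarrow> \<exists>l'. length l' = length l + 2 \<and> trail x l' = insert (z + step_vec e) (trail x l)"
proof (induction l arbitrary: x)
  case Nil
  then show ?case
    using step_vec_flip[of "fst e" "snd e"]
    by (intro exI[of _ "[e, (fst e, \<not> snd e)]"]) auto
next
  case (Cons a l)
  show ?case
  proof (cases "z = x")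
    case True
    then show ?thesis
      using step_vec_flip[of "fst e" "snd e"]
      by (intro exI[of _ "e # (fst e, \<not> snd e) # a # l"]) auto
  next
    case False
    then obtain l' where "length l' = length l + 2" "trail (x + step_vec a) l' = insert (z + step_vec e) (trail (x + step_vec a) l)"
      using Cons.IH[of "x + step_vec a"] Cons.prems by auto
    then show ?thesis
      by (intro exI[of _ "a # l'"]) auto
  qed
qed

lemma rtrancl_exit:
  assumes "(x, y) \<in> r\<^sup>*" "x \<in> A" "y \<notin> A"
  shows "\<exists>a b. (a, b) \<in> r \<and> a \<in> A \<and> b \<notin> A"
  using assms by (induction rule: rtrancl_induct) auto

text \<open>Each new boundary site costs one detour, that is, two steps. So a connected set of
  \<open>m + 1\<close> sites is encoded by \<open>2 * m\<close> directions, which bounds the number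
  of such sets through \<open>x\<close>.\<close>

lemma ex_trail_subset:
  assumes "conn C" "finite C" "x \<in> C"
  shows "m < card C \<Longrightarrow> \<exists>l. length l = 2 * m \<and> trail x l \<subseteq> C \<and> card (trail x l) = Suc m"
proof (induction m)
  case 0
  then show ?case
    using assms by (intro exI[of _ "[]"]) auto
next
  case (Suc m)
  then obtain l where l: "length l = 2 * m" "trail x l \<subseteq> C" "card (trail x l) = Suc m"
    by auto
  then have "trail x l \<noteq> C"
    using Suc.prems by auto
  then obtain y where "y \<in> C" "y \<notin> trail x l"
    using l by blast
  moreover from this have "(x, y) \<in> (step_rel C)\<^sup>*"
    using assms unfolding conn_def by blast
  ultimately obtain a b where ab: "(a, b) \<in> step_rel C" "a \<in> trail x l" "b \<notin> trail x l"
    using rtrancl_exit[of x y "step_rel C" "trail x l"] by auto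
  then obtain e where "b \<in> C" "b = a + step_vec e"
    by (auto simp: step_rel_def)
  moreover obtain l' where "length l' = length l + 2" "trail x l' = insert (a + step_vec e) (trail x l)"
    using trail_detour[OF ab(2)] by blast
  ultimately show ?case
    using l ab by (intro exI[of _ l']) auto
qed

lemma ex_trail_eq:
  assumes "conn C" "finite C" "x \<in> C" "card C = Suc m"
  shows "\<exists>l. length l = 2 * m \<and> trail x l = C"
proof -
  obtain l where "length l = 2 * m" "trail x l \<subseteq> C" "card (trail x l) = Suc m"
    using ex_trail_subset[OF assms(1-3), of m] assms(4) by auto
  then show ?thesis
    using card_subset_eq[OF assms(2)] assms(4) by metis
qed

lemma trail_replicate_ge: "w \<in> trail x (replicate n (i, True)) \<Longrightarrow> x $ i \<le> w $ i"
proof (induction n arbitrary: x)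
  case (Suc n)
  then consider "w = x" | "w \<in> trail (x + step_vec (i, True)) (replicate n (i, True))"
    by auto
  then show ?case
  proof cases
    case 2
    then show ?thesis
      using Suc.IH[of "x + step_vec (i, True)"] by (simp add: step_vec_def)
  qed simp
qed simp

lemma card_trail_replicate: "card (trail x (replicate n (i, True))) = Suc n"
proof (induction n arbitrary: x)
  case (Suc n)
  have "x \<notin> trail (x + step_vec (i, True)) (replicate n (i, True))"
    using trail_replicate_ge[of x "x + step_vec (i, True)" n i] by (auto simp: step_vec_def)
  then show ?case
    using Suc by simp
qed simp

text \<open>
  A walk with a range of size at most \<open>n\<close> never makes \<open>n\<close> consecutive steps in the same direction.
\<close>

primrec wiggly :: "('d::finite) \<times> bool \<Rightarrow> nat \<Rightarrow> nat \<Rightarrow> ('d \<times> bool) list set" where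
  "wiggly e n 0 = {[]}"
| "wiggly e n (Suc k) = (\<lambda>(l, l'). l @ l') ` (({l. length l = n} - {replicate n e}) \<times> wiggly e n k)"

lemma finite_length: "finite {l :: (('d::finite) \<times> bool) list. length l = n}"
  using finite_lists_length_eq[of "UNIV :: ('d \<times> bool) set" n] by simp

lemma card_length: "card {l :: (('d::finite) \<times> bool) list. length l = n} = CARD('d \<times> bool) ^ n"
  using card_lists_length_eq[of "UNIV :: ('d \<times> bool) set" n] by simp

lemma finite_wiggly [simp]: "finite (wiggly e n k)"
  by (induction k) (auto simp: finite_length)

lemma wiggly_length: "wiggly e n k \<subseteq> {l. length l = k * n}"
  by (induction k) auto

lemma card_wiggly: "real (card (wiggly e n k)) \<le> (valency TYPE('d) ^ n - 1) ^ k"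
  for e :: "('d::finite) \<times> bool"
proof (induction k)
  case (Suc k)
  have c: "real (card ({l. length l = n} - {replicate n e})) = valency TYPE('d) ^ n - 1"
    using card_Diff_singleton[of "replicate n e" "{l. length l = n}"]
    by (simp add: card_length valency_def of_nat_diff Suc_le_eq del: card_prod)
  have "card (wiggly e n (Suc k)) \<le> card ({l. length l = n} - {replicate n e}) * card (wiggly e n k)"
    unfolding wiggly.simps card_cartesian_product[symmetric]
    by (intro card_image_le finite_cartesian_product) (auto simp: finite_length)
  then have "real (card (wiggly e n (Suc k))) \<le> (valency TYPE('d) ^ n - 1) * real (card (wiggly e n k))"
    unfolding c[symmetric] by (metis of_nat_le_iff of_nat_mult)
  also have "\<dots> \<le> (valency TYPE('d) ^ n - 1) * (valency TYPE('d) ^ n - 1) ^ k"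
    using Suc.IH c by (intro mult_left_mono) auto
  finally show ?case
    by simp
qed simp

text \<open>A straight block of \<open>n\<close> steps alone would visit \<open>n + 1\<close>
  sites.\<close>

lemma wiggly_of_card_trail:
  "length l = k * n \<Longrightarrow> card (trail x l) \<le> n \<Longrightarrow> l \<in> wiggly (i, True) n k"
proof (induction k arbitrary: x l)
  case (Suc k)
  define l1 where "l1 = take n l"
  define l2 where "l2 = drop n l"
  have l: "l = l1 @ l2" "length l1 = n" "length l2 = k * n"
    using Suc.prems(1) by (auto simp: l1_def l2_def)
  have "card (trail (x + sum_list (map step_vec l1)) l2) \<le> card (trail x l)"
    "card (trail x l1) \<le> card (trail x l)"
    unfolding l(1) trail_append by (rule card_mono; simp)+
  then have *: "card (trail (x + sum_list (map step_vec l1)) l2) \<le> n" "card (trail x l1) \<le> n"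
    using Suc.prems(2) by simp_all
  then have "l1 \<noteq> replicate n (i, True)"
    using card_trail_replicate[of x n i] by auto
  moreover have "l2 \<in> wiggly (i, True) n k"
    using Suc.IH[OF l(3) *(1)] .
  ultimately show ?case
    using l by auto
qed simp

text \<open>Grouping the times into blocks of length \<open>n\<close> leaves a geometric series in
  which every term occurs \<open>n\<close> times.\<close>

lemma sum_power_div_le:
  fixes r :: real
  assumes "0 \<le> r" "r < 1" "0 < n"
  shows "(\<Sum>t<N. r ^ (t div n)) \<le> real n / (1 - r)"
proof -
  have "(\<Sum>t<N. r ^ (t div n)) \<le> (\<Sum>t<N * n. r ^ (t div n))"
    using assms by (intro sum_mono2) auto
  also have "\<dots> = (\<Sum>j<N. \<Sum>t=j*n..<j*n+n. r ^ (t div n))"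
    by (rule sum.nat_group[symmetric])
  also have "\<dots> = (\<Sum>j<N. real n * r ^ j)"
  proof (intro sum.cong refl)
    fix j
    have "t div n = j" if "t \<in> {j*n..<j*n+n}" for t
      using that by (intro div_nat_eqI) (auto simp: mult.commute)
    then have "(\<Sum>t=j*n..<j*n+n. r ^ (t div n)) = (\<Sum>t=j*n..<j*n+n. r ^ j)"
      by (intro sum.cong) auto
    then show "(\<Sum>t=j*n..<j*n+n. r ^ (t div n)) = real n * r ^ j"
      by simp
  qed
  also have "\<dots> = real n * (\<Sum>j<N. r ^ j)"
    by (simp add: sum_distrib_left)
  also have "(\<Sum>j<N. r ^ j) \<le> 1 / (1 - r)"
    using assms sum_le_suminf[OF summable_geometric, of r "{..<N}"] by (simp add: suminf_geometric)
  finally show ?thesis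
    using assms by (simp add: mult_left_mono)
qed

section \<open>Union bound over clusters\<close>

context parking
begin

text \<open>Car indicators and directions are independent even at the same site, so the bound
  factors whether or not \<open>v\<close> belongs to \<open>J\<close>.\<close>

lemma prob_cars_wiggly:
  assumes J: "finite J"
  shows "prob {\<omega>. (\<forall>u\<in>J. has_car \<omega> u) \<and> map (direction \<omega> v) [0..<k * n] \<in> wiggly e n k}
    \<le> p ^ card J * (1 - 1 / valency TYPE('d) ^ n) ^ k"
proof -
  let ?L = "wiggly e n k"
  let ?c = "real (card ?L) / valency TYPE('d) ^ (k * n)"
  define E where "E u a = ((u \<in> J \<longrightarrow> fst a) \<and> (u = v \<longrightarrow> map (fst (snd a)) [0..<k * n] \<in> ?L))"
    for u and a :: "'d site_data"
  have "{\<omega>. (\<forall>u\<in>J. has_car \<omega> u) \<and> map (direction \<omega> v) [0..<k * n] \<in> ?L} = {\<omega>. \<forall>u\<in>insert v J. E u (\<omega> u)}"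
    by (auto simp: E_def has_car_def direction_def)
  also have "prob \<dots> = (\<Prod>u\<in>insert v J. measure (site_law p) {a. E u a})"
    using J by (intro prob_rectangle) (auto simp: E_def)
  also have "\<dots> = measure (site_law p) {a. E v a} * (\<Prod>u\<in>J - {v}. measure (site_law p) {a. E u a})"
    using J by (simp add: prod.insert_remove)
  also have "(\<Prod>u\<in>J - {v}. measure (site_law p) {a. E u a}) = p ^ card (J - {v})"
  proof -
    have "measure (site_law p) {a. E u a} = p" if "u \<in> J - {v}" for u
    proof -
      have "{a. E u a} = {a. fst a}"
        using that by (auto simp: E_def)
      then show ?thesis
        using p_nonneg by (simp add: measure_def emeasure_site_has_car)
    qed
    then show ?thesis
      by simp
  qed
  also have "measure (site_law p) {a. E v a} = (if v \<in> J then p else 1) * ?c"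
  proof -
    have "{a. E v a} = {a. fst a \<in> (if v \<in> J then {True} else UNIV) \<and> map (fst (snd a)) [0..<k * n] \<in> ?L}"
      by (auto simp: E_def)
    then show ?thesis
      using measure_directions[OF wiggly_length[of e n k], of "if v \<in> J then {True} else UNIV"] p_nonneg p_le_1
      by (simp add: measure_pmf_single)
  qed
  also have "(if v \<in> J then p else 1) * ?c * p ^ card (J - {v}) = p ^ card J * ?c"
  proof (cases "v \<in> J")
    case True
    then have "card J = Suc (card (J - {v}))"
      using J by (rule card.remove[rotated])
    then show ?thesis
      using True by (simp only: power_Suc if_True mult_ac)
  qed simp
  also have "\<dots> \<le> p ^ card J * (1 - 1 / valency TYPE('d) ^ n) ^ k"
  proof (rule mult_left_mono)
    have "?c \<le> (valency TYPE('d) ^ n - 1) ^ k / valency TYPE('d) ^ (k * n)"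
      using valency_pos[where 'd = 'd] by (intro divide_right_mono card_wiggly) simp
    also have "\<dots> = (valency TYPE('d) ^ n - 1) ^ k / (valency TYPE('d) ^ n) ^ k"
      by (metis power_mult mult.commute)
    also have "(valency TYPE('d) ^ n - 1) ^ k / (valency TYPE('d) ^ n) ^ k = (1 - 1 / valency TYPE('d) ^ n) ^ k"
      using valency_pos[where 'd = 'd] by (simp add: power_divide[symmetric] diff_divide_distrib)
    finally show "?c \<le> (1 - 1 / valency TYPE('d) ^ n) ^ k" .
  qed (use p_nonneg in simp)
  finally show ?thesis .
qed

text \<open>Survival is encoded by finite data for a union bound: \<open>l\<close> traces a cluster
  of \<open>m + 1\<close> sites, \<open>J\<close> is its set of cars, and the walk of
  \<open>v\<close> is confined to it. Only the complete blocks of \<open>m + 1\<close> steps up to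
  time \<open>t\<close> are recorded.\<close>

lemma unparked_cluster_code:
  assumes "unparked \<omega> t v"
  shows "\<exists>m l J. length l = 2 * m \<and> card (trail v l) = Suc m \<and> J \<subseteq> trail v l \<and> Suc m \<le> 2 * card J \<and>
    (\<forall>u\<in>J. has_car \<omega> u) \<and>
    map (direction \<omega> v) [0..<t div Suc m * Suc m] \<in> wiggly (i, True) (Suc m) (t div Suc m)"
proof -
  obtain C where C: "closed_cluster \<omega> t C" "\<And>r. r \<le> t \<Longrightarrow> walk \<omega> v r \<in> C"
    using ex_closed_cluster[OF assms] by blast
  have v: "v \<in> C"
    using C(2)[of 0] by simp
  have fin: "finite C" and conn: "conn C"
    using C(1) by (auto simp: closed_cluster_def)
  define m where "m = card C - 1"
  have m: "card C = Suc m"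
    using fin v card_gt_0_iff[of C] by (auto simp: m_def)
  obtain l where l: "length l = 2 * m" "trail v l = C"
    using ex_trail_eq[OF conn fin v m] by blast
  let ?N = "t div Suc m * Suc m"
  have "trail v (map (direction \<omega> v) [0..<?N]) = walk \<omega> v ` {..?N}"
    unfolding trail_map walk_def ..
  also have "\<dots> \<subseteq> C"
    using C(2) div_times_less_eq_dividend[of t "Suc m"] by (auto simp del: div_times_less_eq_dividend)
  finally have "card (trail v (map (direction \<omega> v) [0..<?N])) \<le> Suc m"
    using card_mono[OF fin] m by metis
  then have "map (direction \<omega> v) [0..<?N] \<in> wiggly (i, True) (Suc m) (t div Suc m)"
    by (intro wiggly_of_card_trail[where x = v]) simp_all
  moreover have "Suc m \<le> 2 * card {w \<in> C. has_car \<omega> w}"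
    using card_closed_cluster_less[OF C(1) assms v] m by simp
  ultimately show ?thesis
    using l m by (intro exI[of _ m] exI[of _ l] exI[of _ "{w \<in> C. has_car \<omega> w}"]) auto
qed

text \<open>The factors count the traversals of length \<open>2 * m\<close> and the subsets
  \<open>J\<close>, and bound the probability of at least \<open>(m + 1) / 2\<close> cars and of a
  walk confined to \<open>m + 1\<close> sites.\<close>

definition cluster_bound :: "nat \<Rightarrow> nat \<Rightarrow> real" where
  "cluster_bound t m = valency TYPE('d) ^ (2 * m) * (2 * sqrt p) ^ Suc m *
     (1 - 1 / valency TYPE('d) ^ Suc m) ^ (t div Suc m)"

lemma valency_ge_2: "2 \<le> valency TYPE('d)"
  by (simp add: valency_eq)

lemma ratio_bounds: "0 \<le> 1 - 1 / valency TYPE('d) ^ Suc m" "1 - 1 / valency TYPE('d) ^ Suc m < 1"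
proof -
  have "1 \<le> valency TYPE('d) ^ Suc m"
    using valency_ge_2 by (intro one_le_power) linarith
  then show "0 \<le> 1 - 1 / valency TYPE('d) ^ Suc m" "1 - 1 / valency TYPE('d) ^ Suc m < 1"
    by (auto simp: field_simps)
qed

lemma cluster_bound_nonneg: "0 \<le> cluster_bound t m"
  unfolding cluster_bound_def
  using ratio_bounds[of m] p_nonneg valency_pos[where 'd = 'd]
  by (intro mult_nonneg_nonneg zero_le_power) auto

lemma emeasure_unparked_le: "emeasure P {\<omega>. unparked \<omega> t v} \<le> (\<Sum>m. ennreal (cluster_bound t m))"
proof -
  obtain i :: 'd where True by simp
  define S where "S m l = {J. J \<subseteq> trail v l \<and> Suc m \<le> 2 * card J}" for m l
  define Ls where "Ls m = {l. length l = 2 * m \<and> card (trail v l) = Suc m}" for m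
  define B where "B m J = {\<omega>. (\<forall>u\<in>J. has_car \<omega> u) \<and>
    map (direction \<omega> v) [0..<t div Suc m * Suc m] \<in> wiggly (i, True) (Suc m) (t div Suc m)}" for m J
  define A where "A m = (\<Union>l\<in>Ls m. \<Union>J\<in>S m l. B m J)" for m
  have finLs: "finite (Ls m)" for m
    using finite_length by (rule rev_finite_subset) (auto simp: Ls_def)
  have finS: "finite (S m l)" for m l
    unfolding S_def by (rule finite_subset[of _ "Pow (trail v l)"]) auto
  have finJ: "finite J" if "J \<in> S m l" for J m l
    using that unfolding S_def by (auto intro: finite_subset[OF _ finite_trail])
  have B: "B m J \<in> events" if "finite J" for m J
  proof -
    have [measurable]: "(\<lambda>\<omega>. map (direction \<omega> v) [0..<n]) \<in> measurable P (count_space UNIV)" for n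
      unfolding direction_def
      by (rule measurable_compose[OF measurable_site measurable_direction_list])
    show ?thesis
      unfolding B_def using that by (intro sets_Collect) measurable
  qed
  have A: "A m \<in> events" for m
    unfolding A_def using finLs finS finJ B by (intro sets.finite_UN) auto
  have prob_B: "prob (B m J) \<le> sqrt p ^ Suc m * (1 - 1 / valency TYPE('d) ^ Suc m) ^ (t div Suc m)"
    if "J \<in> S m l" for m l J
  proof -
    have "prob (B m J) \<le> p ^ card J * (1 - 1 / valency TYPE('d) ^ Suc m) ^ (t div Suc m)"
      unfolding B_def using finJ[OF that] by (rule prob_cars_wiggly)
    \<comment> \<open>The square root lets the majority condition
      \<open>Suc m \<le> 2 * card J\<close> be used without rounding.\<close>
    also have "p ^ card J = sqrt p ^ (2 * card J)"
      using p_nonneg by (simp add: power_mult)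
    also have "\<dots> \<le> sqrt p ^ Suc m"
      using that p_nonneg p_le_1 by (intro power_decreasing) (auto simp: S_def)
    finally show ?thesis
      using ratio_bounds[of m] by (simp add: mult_right_mono)
  qed
  have prob_A: "prob (A m) \<le> cluster_bound t m" for m
  proof -
    let ?b = "sqrt p ^ Suc m * (1 - 1 / valency TYPE('d) ^ Suc m) ^ (t div Suc m)"
    have b: "0 \<le> ?b"
      using ratio_bounds[of m] p_nonneg by (intro mult_nonneg_nonneg zero_le_power) auto
    have "prob (A m) \<le> (\<Sum>l\<in>Ls m. prob (\<Union>J\<in>S m l. B m J))"
      unfolding A_def using finLs finS finJ B
      by (intro finite_measure_subadditive_finite) (auto intro!: sets.finite_UN)
    also have "\<dots> \<le> (\<Sum>l\<in>Ls m. 2 ^ Suc m * ?b)"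
    proof (rule sum_mono)
      fix l assume l: "l \<in> Ls m"
      have "prob (\<Union>J\<in>S m l. B m J) \<le> (\<Sum>J\<in>S m l. prob (B m J))"
        using finS finJ B by (intro finite_measure_subadditive_finite) auto
      also have "\<dots> \<le> (\<Sum>J\<in>S m l. ?b)"
        by (intro sum_mono prob_B)
      also have "\<dots> = real (card (S m l)) * ?b"
        by simp
      also have "\<dots> \<le> 2 ^ Suc m * ?b"
      proof (rule mult_right_mono[OF _ b])
        have "card (S m l) \<le> card (Pow (trail v l))"
          by (rule card_mono) (auto simp: S_def)
        also have "\<dots> = 2 ^ Suc m"
          using l by (simp add: card_Pow Ls_def)
        finally show "real (card (S m l)) \<le> 2 ^ Suc m"
          by (metis of_nat_le_iff of_nat_numeral of_nat_power)
      qed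
      finally show "prob (\<Union>J\<in>S m l. B m J) \<le> 2 ^ Suc m * ?b" .
    qed
    also have "\<dots> = real (card (Ls m)) * (2 ^ Suc m * ?b)"
      by simp
    also have "\<dots> \<le> valency TYPE('d) ^ (2 * m) * (2 ^ Suc m * ?b)"
    proof (rule mult_right_mono)
      have "card (Ls m) \<le> card {l :: ('d \<times> bool) list. length l = 2 * m}"
        by (rule card_mono[OF finite_length]) (auto simp: Ls_def)
      then show "real (card (Ls m)) \<le> valency TYPE('d) ^ (2 * m)"
        unfolding card_length valency_def by (metis of_nat_le_iff of_nat_power)
    qed (use b in simp)
    also have "\<dots> = cluster_bound t m"
      by (simp add: cluster_bound_def power_mult_distrib mult_ac)
    finally show ?thesis .
  qed
  have "{\<omega>. unparked \<omega> t v} \<subseteq> (\<Union>m. A m)"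
  proof
    fix \<omega> assume "\<omega> \<in> {\<omega>. unparked \<omega> t v}"
    then have "unparked \<omega> t v"
      by simp
    from unparked_cluster_code[OF this, of i] obtain m l J
      where "l \<in> Ls m" "J \<in> S m l" "\<omega> \<in> B m J"
      unfolding Ls_def S_def B_def mem_Collect_eq by (elim exE conjE) metis
    then show "\<omega> \<in> (\<Union>m. A m)"
      unfolding A_def by blast
  qed
  then have "emeasure P {\<omega>. unparked \<omega> t v} \<le> emeasure P (\<Union>m. A m)"
    using A by (intro emeasure_mono) auto
  also have "\<dots> \<le> (\<Sum>m. emeasure P (A m))"
    using A by (intro emeasure_subadditive_countably) auto
  also have "\<dots> \<le> (\<Sum>m. ennreal (cluster_bound t m))"
    using prob_A by (intro suminf_le) (auto simp: emeasure_eq_measure intro!: ennreal_leI)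
  finally show ?thesis .
qed

text \<open>The sum over times contributes \<open>Suc m * valency ^ Suc m\<close>, the reciprocal of
  the chance that a block is straight times the block length. With the two powers per site for the
  traversal this makes the cube.\<close>

lemma sum_cluster_bound_le:
  "(\<Sum>t<N. cluster_bound t m) \<le> real (Suc m) * (2 * valency TYPE('d) ^ 3 * sqrt p) ^ Suc m"
proof -
  let ?D = "valency TYPE('d)"
  have D: "1 \<le> ?D"
    using valency_ge_2 by linarith
  have "(\<Sum>t<N. cluster_bound t m) = ?D ^ (2 * m) * (2 * sqrt p) ^ Suc m * (\<Sum>t<N. (1 - 1 / ?D ^ Suc m) ^ (t div Suc m))"
    by (simp add: cluster_bound_def sum_distrib_left)
  also have "\<dots> \<le> ?D ^ (2 * m) * (2 * sqrt p) ^ Suc m * (real (Suc m) / (1 - (1 - 1 / ?D ^ Suc m)))"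
    using ratio_bounds[of m] p_nonneg D by (intro mult_left_mono sum_power_div_le) auto
  also have "\<dots> = ?D ^ (2 * m) * (2 * sqrt p) ^ Suc m * (real (Suc m) * ?D ^ Suc m)"
    by simp
  \<comment> \<open>The exponent \<open>2 * m\<close> is rounded up so that everything but one
    factor is a power with exponent \<open>Suc m\<close>.\<close>
  also have "\<dots> \<le> ?D ^ (2 * Suc m) * (2 * sqrt p) ^ Suc m * (real (Suc m) * ?D ^ Suc m)"
    using p_nonneg D by (intro mult_right_mono power_increasing) auto
  also have "\<dots> = real (Suc m) * (2 * ?D ^ 3 * sqrt p) ^ Suc m"
    unfolding power_mult_distrib power_mult[symmetric] power_mult power3_eq_cube power2_eq_square by (simp add: mult_ac power_mult_distrib)
  finally show ?thesis .
qed

theorem finite_expected_visits: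
  assumes "p < inverse (256 * real CARD('d) ^ 6 * (exp 1)\<^sup>2)"
  shows "(\<integral>\<^sup>+\<omega>. total_visits \<omega> v \<partial>P) < \<infinity>"
proof -
  \<comment> \<open>Since the valency is \<open>2 * CARD('d)\<close>, this is 16 times the cube of
    the dimension times \<open>sqrt p\<close>, whose square carries the constant 256.\<close>
  define x where "x = 2 * valency TYPE('d) ^ 3 * sqrt p"
  have x0: "0 \<le> x"
    using valency_pos[where 'd = 'd] p_nonneg by (simp add: x_def)
  have d: "0 < 256 * real CARD('d) ^ 6"
    by simp
  have "inverse (256 * real CARD('d) ^ 6 * (exp 1)\<^sup>2) \<le> inverse (256 * real CARD('d) ^ 6)"
  proof (rule le_imp_inverse_le[OF _ d])
    have "1 \<le> (exp (1::real))\<^sup>2"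
      by (intro one_le_power) simp
    then show "256 * real CARD('d) ^ 6 \<le> 256 * real CARD('d) ^ 6 * (exp 1)\<^sup>2"
      by simp
  qed
  with assms have "p < inverse (256 * real CARD('d) ^ 6)"
    by linarith
  then have "256 * real CARD('d) ^ 6 * p < 1"
    using d by (simp add: field_simps)
  moreover have "x\<^sup>2 = 256 * real CARD('d) ^ 6 * p"
    using p_nonneg by (simp add: x_def valency_eq power_mult_distrib power_mult[symmetric])
  ultimately have x1: "x < 1"
    using x0 by (metis abs_of_nonneg abs_square_less_1)
  define f where "f m = real (Suc m) * x ^ Suc m" for m
  have f0: "0 \<le> f m" for m
    using x0 by (simp add: f_def)
  \<comment> \<open>The derivative of the geometric series at \<open>x\<close>.\<close>
  have "summable (\<lambda>m. real (Suc m) * x ^ m)"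
    using geometric_deriv_sums[of x] x0 x1 by (simp add: sums_iff)
  moreover have "f = (\<lambda>m. x * (real (Suc m) * x ^ m))"
    by (simp add: f_def mult_ac fun_eq_iff)
  ultimately have "summable f"
    by (simp only: summable_mult)
  have "(\<Sum>t<N. emeasure P {\<omega>. unparked \<omega> t v}) \<le> ennreal (suminf f)" for N
  proof -
    have "(\<Sum>t<N. emeasure P {\<omega>. unparked \<omega> t v}) \<le> (\<Sum>t<N. \<Sum>m. ennreal (cluster_bound t m))"
      by (intro sum_mono emeasure_unparked_le)
    also have "\<dots> = (\<Sum>m. \<Sum>t<N. ennreal (cluster_bound t m))"
      by (rule suminf_sum[symmetric]) simp
    also have "\<dots> \<le> (\<Sum>m. ennreal (f m))"
      using sum_cluster_bound_le by (intro suminf_le) (auto simp: sum_ennreal cluster_bound_nonneg f_def x_def intro!: ennreal_leI)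
    also have "\<dots> = ennreal (suminf f)"
      using f0 \<open>summable f\<close> by (rule suminf_ennreal2)
    finally show ?thesis .
  qed
  then have "(\<integral>\<^sup>+\<omega>. total_visits \<omega> v \<partial>P) \<le> ennreal (suminf f)"
    unfolding nn_integral_total_visits suminf_eq_SUP by (intro SUP_least)
  also have "\<dots> < \<infinity>"
    by simp
  finally show ?thesis .
qed

end

theorem theorem1p1:
  fixes p :: real and v :: "int ^ 'd"
  assumes "0 \<le> p" and "p \<le> 1"
  shows
    "(1 / 2 \<le> p \<longrightarrow>
        (AE \<omega> in parking_space p. total_visits \<omega> v = \<infinity>) \<and>
        (\<lambda>t. (\<integral>\<omega>. real (visits \<omega> v t) \<partial>parking_space p) - (2 * p - 1) * real t)
          \<in> o(\<lambda>t. real t)) \<and>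
     (p < 1 / 2 \<longrightarrow>
        (AE \<omega> in parking_space p. total_visits \<omega> v < \<infinity>) \<and>
        (p < inverse (256 * real CARD('d) ^ 6 * (exp 1)\<^sup>2) \<longrightarrow>
          (\<integral>\<^sup>+\<omega>. total_visits \<omega> v \<partial>parking_space p) < \<infinity>))"
proof -
  interpret parking p "TYPE('d)"
    using assms by unfold_locales
  show ?thesis
    using recurrence expectation_visits_asymp transience finite_expected_visits by blast
qed

end
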